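(* Let $k\geq1$ and $n\geq k$ be integers. Under the $\mathrm{SL}(\mathbb V)$-equivariant isomorphisms $J^k(L^n)=L^{n-k}\otimes\mathbb V_k$ and $J^{k-1}(L^n)=L^{n-k+1}\otimes\mathbb V_{k-1}$ described in the context, the natural projection $\phi_k:J^k(L^n)\to J^{k-1}(L^n)$ coincides with $$\mathrm{Id}_{L^{n-k}}\otimes\varpi^0_k:\ L^{n-k}\otimes\mathbb V_k\longrightarrow L^{n-k+1}\otimes\mathbb V_{k-1}.$$
   Context: $\mathbb V$ is a two-dimensional complex vector space, $X=\mathbb P(\mathbb V)$ is the space of lines $\xi\subset\mathbb V$. $\mathbb L\subset X\times\mathbb V$ is the tautological subbundle (fiber $\xi$ over $\xi$), $L=(X\times\mathbb V)/\mathbb L$ (degree one), $q_L:\mathbb V_1\to L$ the quotient map. $\mathbb V_j=X\times\mathrm{Sym}^j(\mathbb V)$, $\mathbb V_0=\mathcal O_X$, and $\mathrm{Sym}^j$ is viewed as symmetric tensors in $\mathbb V_1^{\otimes j}$. $\mathrm{SL}(\mathbb V)$ acts naturally on all these bundles. $J^k(W)=p_{1*}\bigl(p_2^*W/(p_2^*W\otimes\mathcal O_{X\times X}(-(k+1)\Delta))\bigr)$, with $p_1,p_2:X\times X\to X$ the projections and $\Delta$ the diagonal; $\phi_k:J^k(W)\to J^{k-1}(W)$ is the natural projection induced by $\mathcal O(-(k+1)\Delta)\subset\mathcal O(-k\Delta)$. $\varpi_k^0:\mathbb V_k\to L\otimes\mathbb V_{k-1}$ is the restriction to $\mathrm{Sym}^k(\mathbb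 V_1)\subset\mathbb V_1^{\otimes k}$ of $q_L\otimes\mathrm{Id}_{\mathbb V_1^{\otimes(k-1)}}:\mathbb V_1^{\otimes k}\to L\otimes\mathbb V_1^{\otimes(k-1)}$. The isomorphism $J^k(L^n)=L^{n-k}\otimes\mathbb V_k$ for $n\ge k\ge0$: the evaluation map $\mathbb V_n=X\times H^0(X,L^n)\to J^k(L^n)$ (taking a global section to its $k$-jet, with $H^0(X,L^n)=\mathrm{Sym}^n(\mathbb V)$) is surjective, the homomorphism $\theta_2:\mathbb V_n\to L^{n-k}\otimes\mathbb V_k$ given by restricting $q_L^{\otimes(n-k)}\otimes\mathrm{Id}_{\mathbb V_1^{\otimes k}}$ to symmetric tensors is surjective, and both have the same kernel; the isomorphism is the induced one. *)

theory Defs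
  imports "HOL-Analysis.Analysis" "HOL-Library.Multiset"
begin

text \<open>
  Everything is done over an arbitrary two-dimensional complex vector space \<open>V\<close> (the type \<open>'v\<close>
  with scalar multiplication \<open>scale\<close>). Holomorphic vector bundles on the projective line are treated
  as sheaves of modules over the holomorphic functions, given by their sections over open sets;
  sections are extensional functions, so that equality of sections is equality of functions.
\<close>

text \<open>
  Tensors are modelled as functionals on tuples of linear forms: the pure tensor
  \<open>v\<^sub>1 \<otimes> \<dots> \<otimes> v\<^sub>m\<close> is \<open>(\<beta>\<^sub>1, \<dots>, \<beta>\<^sub>m) \<mapsto> \<beta>\<^sub>1 v\<^sub>1 \<cdots> \<beta>\<^sub>m v\<^sub>m\<close> and a tensor product is the span
  of its pure tensors. A \<open>mixed\<close> tensor takes forms on a quotient \<open>V/\<xi>\<close> first, where elements of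
  \<open>V/\<xi>\<close> are cosets, and then forms on \<open>V\<close>.
\<close>

type_synonym 'v tensor = "('v \<Rightarrow> complex) list \<Rightarrow> complex"
type_synonym 'v mixed = "('v set \<Rightarrow> complex) list \<Rightarrow> 'v tensor"

definition holomorphic2_on :: "(complex \<times> complex \<Rightarrow> complex) \<Rightarrow> (complex \<times> complex) set \<Rightarrow> bool" where
  "holomorphic2_on f S \<longleftrightarrow>
     open S \<and> (\<forall>p\<in>S. \<exists>a b. (f has_derivative (\<lambda>(h, k). a * h + b * k)) (at p))"

locale complex_plane = vector_space scale
  for scale :: "complex \<Rightarrow> 'v::ab_group_add \<Rightarrow> 'v" (infixr \<open>*\<^sub>V\<close> 75) +
  assumes dim_UNIV: "dim UNIV = 2"
begin

subsection \<open>The projective line as a complex manifold\<close>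

definition lines :: "'v set set" where
  "lines = {span {v} |v. v \<noteq> 0}"

definition frame :: "'v \<Rightarrow> 'v \<Rightarrow> bool" where
  "frame e f \<longleftrightarrow> e \<noteq> f \<and> independent {e, f}"

definition chart :: "'v \<Rightarrow> 'v \<Rightarrow> complex \<Rightarrow> 'v set" where
  "chart e f z = span {e + z *\<^sub>V f}"

definition lines_top :: "'v set topology" where
  "lines_top = topology (\<lambda>U. U \<subseteq> lines \<and> (\<forall>e f. frame e f \<longrightarrow> open {z. chart e f z \<in> U}))"

lemma openin_lines_top:
  "openin lines_top U \<longleftrightarrow> U \<subseteq> lines \<and> (\<forall>e f. frame e f \<longrightarrow> open {z. chart e f z \<in> U})"
proof -
  have "istopology (\<lambda>U. U \<subseteq> lines \<and> (\<forall>e f. frame e f \<longrightarrow> open {z. chart e f z \<in> U}))"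
    unfolding istopology_def
  proof (intro conjI allI impI)
    fix S T e f
    assume "S \<subseteq> lines \<and> (\<forall>e f. frame e f \<longrightarrow> open {z. chart e f z \<in> S})"
      "T \<subseteq> lines \<and> (\<forall>e f. frame e f \<longrightarrow> open {z. chart e f z \<in> T})" "frame e f"
    then have "open ({z. chart e f z \<in> S} \<inter> {z. chart e f z \<in> T})"
      by blast
    then show "open {z. chart e f z \<in> S \<inter> T}"
      by (simp add: Collect_conj_eq)
  next
    fix K e f
    assume "\<forall>S\<in>K. S \<subseteq> lines \<and> (\<forall>e f. frame e f \<longrightarrow> open {z. chart e f z \<in> S})" "frame e f"
    then have "open (\<Union>S\<in>K. {z. chart e f z \<in> S})"
      by blast
    moreover have "(\<Union>S\<in>K. {z. chart e f z \<in> S}) = {z. chart e f z \<in> \<Union>K}"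
      by blast
    ultimately show "open {z. chart e f z \<in> \<Union>K}"
      by simp
  qed blast+
  then show ?thesis
    by (simp add: lines_top_def topology_inverse')
qed

lemma chart_in_lines:
  assumes "frame e f"
  shows "chart e f z \<in> lines"
proof -
  have "e + z *\<^sub>V f \<noteq> 0"
  proof
    assume "e + z *\<^sub>V f = 0"
    then have "e = (- z) *\<^sub>V f"
      by (simp add: add_eq_0_iff2)
    then have "e \<in> span {f}"
      by (metis span_base span_scale singletonI)
    moreover have "{e, f} - {e} = {f}"
      using assms by (auto simp: frame_def)
    ultimately show False
      using assms unfolding frame_def dependent_def by (metis insertI1)
  qed
  then show ?thesis
    unfolding chart_def lines_def by blast
qed

lemma topspace_lines_top: "topspace lines_top = lines"
proof (rule antisym)
  show "topspace lines_top \<subseteq> lines"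
    using openin_lines_top openin_topspace by blast
  have "openin lines_top lines"
    by (simp add: openin_lines_top chart_in_lines)
  then show "lines \<subseteq> topspace lines_top"
    by (rule openin_subset)
qed

definition lines2_top :: "('v set \<times> 'v set) topology" where
  "lines2_top = prod_topology lines_top lines_top"

definition hol :: "('v set \<Rightarrow> complex) \<Rightarrow> 'v set set \<Rightarrow> bool" where
  "hol g U \<longleftrightarrow> (\<forall>e f. frame e f \<longrightarrow> (\<lambda>z. g (chart e f z)) holomorphic_on {z. chart e f z \<in> U})"

definition hol2 :: "('v set \<times> 'v set \<Rightarrow> complex) \<Rightarrow> ('v set \<times> 'v set) set \<Rightarrow> bool" where
  "hol2 g \<Omega> \<longleftrightarrow> (\<forall>e f e' f'. frame e f \<longrightarrow> frame e' f' \<longrightarrow>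
     holomorphic2_on (\<lambda>(z, w). g (chart e f z, chart e' f' w))
       {(z, w). (chart e f z, chart e' f' w) \<in> \<Omega>})"

subsection \<open>Tensors\<close>

definition quot :: "'v set \<Rightarrow> 'v \<Rightarrow> 'v set" where
  "quot \<xi> v = (+) v ` \<xi>"

definition forms :: "('v \<Rightarrow> complex) set" where
  "forms = {\<beta>. Vector_Spaces.linear scale (*) \<beta>}"

text \<open>Linearity on \<open>V/\<xi>\<close> for the operations \<open>(u + \<xi>) + (v + \<xi>) = (u + v) + \<xi>\<close> and
  \<open>c (v + \<xi>) = c v + \<xi>\<close> means linearity after composition with the quotient map.\<close>

definition quot_forms :: "'v set \<Rightarrow> ('v set \<Rightarrow> complex) set" where
  "quot_forms \<xi> = {\<alpha>. \<alpha> \<circ> quot \<xi> \<in> forms}"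

definition pure :: "'v list \<Rightarrow> 'v tensor" where
  "pure vs = (\<lambda>\<beta>s. if length \<beta>s = length vs \<and> set \<beta>s \<subseteq> forms
     then \<Prod>i<length vs. (\<beta>s ! i) (vs ! i) else 0)"

definition tensors :: "nat \<Rightarrow> 'v tensor set" where
  "tensors m = {T. \<exists>(N::nat) c vs. (\<forall>j<N. length (vs j) = m) \<and>
     T = (\<lambda>\<beta>s. \<Sum>j<N. c j * pure (vs j) \<beta>s)}"

definition Sym :: "nat \<Rightarrow> 'v tensor set" where
  "Sym m = {T \<in> tensors m. \<forall>\<beta>s \<beta>s'. mset \<beta>s = mset \<beta>s' \<longrightarrow> T \<beta>s = T \<beta>s'}"

definition pure_mixed :: "'v set \<Rightarrow> 'v set list \<Rightarrow> 'v tensor \<Rightarrow> 'v mixed" where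
  "pure_mixed \<xi> xs S = (\<lambda>\<alpha>s \<beta>s. if length \<alpha>s = length xs \<and> set \<alpha>s \<subseteq> quot_forms \<xi>
     then (\<Prod>i<length xs. (\<alpha>s ! i) (xs ! i)) * S \<beta>s else 0)"

text \<open>The fiber \<open>(V/\<xi>)\<^bsup>\<otimes>a\<^esup> \<otimes> Sym\<^bsup>b\<^esup>(V)\<close> of \<open>L\<^bsup>a\<^esup> \<otimes> \<V>\<^sub>b\<close>.\<close>

definition LSym :: "'v set \<Rightarrow> nat \<Rightarrow> nat \<Rightarrow> 'v mixed set" where
  "LSym \<xi> a b = {T. \<exists>(N::nat) c xs S.
     (\<forall>j<N. length (xs j) = a \<and> set (xs j) \<subseteq> range (quot \<xi>) \<and> S j \<in> Sym b) \<and>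
     T = (\<lambda>\<alpha>s \<beta>s. \<Sum>j<N. c j * pure_mixed \<xi> (xs j) (S j) \<alpha>s \<beta>s)}"

text \<open>\<open>q\<^sub>L\<^bsup>\<otimes>a\<^esup> \<otimes> Id\<close> at \<open>\<xi>\<close>, quotienting the first \<open>a\<close> factors; a linear map acts on functionals of
  linear forms by pulling the forms back.\<close>

definition qmap :: "nat \<Rightarrow> 'v set \<Rightarrow> 'v tensor \<Rightarrow> 'v mixed" where
  "qmap a \<xi> T = (\<lambda>\<alpha>s \<beta>s. if length \<alpha>s = a then T (map (\<lambda>\<alpha>. \<alpha> \<circ> quot \<xi>) \<alpha>s @ \<beta>s) else 0)"

definition varpi :: "'v set \<Rightarrow> 'v tensor \<Rightarrow> 'v mixed" where
  "varpi \<xi> = qmap 1 \<xi>"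

text \<open>\<open>Id \<otimes> h\<close> on \<open>(V/\<xi>)\<^bsup>\<otimes>a\<^esup> \<otimes> V\<^bsup>\<otimes>b\<^esup>\<close>, for \<open>h\<close> linear with values in mixed tensors over the same \<open>\<xi>\<close>:
  contracting the first \<open>a\<close> factors of \<open>T\<close> with \<open>a\<close> forms leaves an element of \<open>V\<^bsup>\<otimes>b\<^esup>\<close>, to which
  \<open>h\<close> is applied. The factors \<open>V/\<xi>\<close> in the target of \<open>h\<close> come after the \<open>a\<close> given ones.\<close>

definition Id_tensor :: "nat \<Rightarrow> ('v tensor \<Rightarrow> 'v mixed) \<Rightarrow> 'v mixed \<Rightarrow> 'v mixed" where
  "Id_tensor a h T = (\<lambda>\<alpha>s \<beta>s. h (T (take a \<alpha>s)) (drop a \<alpha>s) \<beta>s)"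

subsection \<open>Holomorphic sections\<close>

text \<open>The forms span the dual of the fiber \<open>V\<^bsup>\<otimes>m\<^esup>\<close>, so holomorphy is tested on them.\<close>

definition V_sec :: "nat \<Rightarrow> 'v set set \<Rightarrow> ('v set \<Rightarrow> 'v tensor) set" where
  "V_sec n U = {f \<in> extensional U. (\<forall>\<xi>\<in>U. f \<xi> \<in> Sym n) \<and> (\<forall>\<beta>s. hol (\<lambda>\<xi>. f \<xi> \<beta>s) U)}"

text \<open>\<open>L\<^bsup>a\<^esup> \<otimes> V\<^bsup>\<otimes>b\<^esup>\<close> carries the holomorphic structure of a quotient of the trivial bundle
  \<open>V\<^bsup>\<otimes>(a+b)\<^esup>\<close>: a section is holomorphic iff it lifts locally to a holomorphic map. \<open>L\<^bsup>a\<^esup> \<otimes> \<V>\<^sub>b\<close> is a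
  subbundle.\<close>

definition L_sec :: "nat \<Rightarrow> nat \<Rightarrow> 'v set set \<Rightarrow> ('v set \<Rightarrow> 'v mixed) set" where
  "L_sec a b U = {s \<in> extensional U. (\<forall>\<xi>\<in>U. s \<xi> \<in> LSym \<xi> a b) \<and>
     (\<forall>\<xi>\<in>U. \<exists>U' t. openin lines_top U' \<and> \<xi> \<in> U' \<and> U' \<subseteq> U \<and>
        (\<forall>\<eta>\<in>U'. t \<eta> \<in> tensors (a + b)) \<and> (\<forall>\<beta>s. hol (\<lambda>\<eta>. t \<eta> \<beta>s) U') \<and>
        (\<forall>\<eta>\<in>U'. s \<eta> = qmap a \<eta> (t \<eta>)))}"

text \<open>Holomorphic sections over \<open>\<Omega>\<close> of the pullback of \<open>L\<^sup>n\<close> along the second projection.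
  Values outside \<open>\<Omega>\<close> are irrelevant here.\<close>

definition pullback_sec :: "nat \<Rightarrow> ('v set \<times> 'v set) set \<Rightarrow> ('v set \<times> 'v set \<Rightarrow> 'v mixed) \<Rightarrow> bool" where
  "pullback_sec n \<Omega> F \<longleftrightarrow>
     (\<forall>p\<in>\<Omega>. \<exists>\<Omega>' t. openin lines2_top \<Omega>' \<and> p \<in> \<Omega>' \<and> \<Omega>' \<subseteq> \<Omega> \<and>
        (\<forall>r\<in>\<Omega>'. t r \<in> tensors n) \<and> (\<forall>\<beta>s. hol2 (\<lambda>r. t r \<beta>s) \<Omega>') \<and>
        (\<forall>r\<in>\<Omega>'. F r = qmap n (snd r) (t r)))"

subsection \<open>Jet bundles\<close>

text \<open>Membership of the germ of \<open>F\<close> at \<open>p\<close> in \<open>p\<^sub>2\<^sup>*L\<^sup>n \<otimes> \<O>(-m\<Delta>)\<close>. The ideal sheaf \<open>\<O>(-\<Delta>)\<close> of the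
  divisor \<open>\<Delta>\<close> is locally principal, so its \<open>m\<close>-th power consists locally of the multiples of \<open>m\<close>-th
  powers of functions vanishing on \<open>\<Delta>\<close>.\<close>

definition in_diag_power :: "nat \<Rightarrow> nat \<Rightarrow> ('v set \<times> 'v set \<Rightarrow> 'v mixed) \<Rightarrow> 'v set \<times> 'v set \<Rightarrow> bool" where
  "in_diag_power n m F p \<longleftrightarrow>
     (\<exists>\<Omega> g H. openin lines2_top \<Omega> \<and> p \<in> \<Omega> \<and>
        hol2 g \<Omega> \<and> (\<forall>\<xi>. (\<xi>, \<xi>) \<in> \<Omega> \<longrightarrow> g (\<xi>, \<xi>) = 0) \<and> pullback_sec n \<Omega> H \<and>
        (\<forall>r\<in>\<Omega>. F r = (\<lambda>\<alpha>s \<beta>s. g r ^ m * H r \<alpha>s \<beta>s)))"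

text \<open>The class of \<open>F\<close> in the stalk at \<open>p\<close> of the quotient of \<open>p\<^sub>2\<^sup>*L\<^sup>n\<close> by
  \<open>p\<^sub>2\<^sup>*L\<^sup>n \<otimes> \<O>(-m\<Delta>)\<close>, as the set of all its representatives.\<close>

definition stalk_class ::
  "nat \<Rightarrow> nat \<Rightarrow> ('v set \<times> 'v set \<Rightarrow> 'v mixed) \<Rightarrow> 'v set \<times> 'v set \<Rightarrow> ('v set \<times> 'v set \<Rightarrow> 'v mixed) set" where
  "stalk_class n m F p = {H. (\<exists>\<Omega>. openin lines2_top \<Omega> \<and> p \<in> \<Omega> \<and> pullback_sec n \<Omega> H) \<and>
     in_diag_power n m (\<lambda>r \<alpha>s \<beta>s. H r \<alpha>s \<beta>s - F r \<alpha>s \<beta>s) p}"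

type_synonym 'w jet = "'w set \<times> 'w set \<Rightarrow> ('w set \<times> 'w set \<Rightarrow> 'w mixed) set"

text \<open>Sections of \<open>J\<^bsup>k\<^esup>(L\<^sup>n)\<close> over \<open>U\<close>: by definition of the direct image under \<open>p\<^sub>1\<close>, sections over
  \<open>p\<^sub>1\<^sup>-\<^sup>1(U) = U \<times> X\<close> of the quotient sheaf, that is, families of stalk elements induced locally
  by sections of \<open>p\<^sub>2\<^sup>*L\<^sup>n\<close>.\<close>

definition jet_sec :: "nat \<Rightarrow> nat \<Rightarrow> 'v set set \<Rightarrow> 'v jet set" where
  "jet_sec n k U = {\<sigma> \<in> extensional (U \<times> lines).
     \<forall>p \<in> U \<times> lines. \<exists>\<Omega> F. openin lines2_top \<Omega> \<and> p \<in> \<Omega> \<and> \<Omega> \<subseteq> U \<times> lines \<and>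
       pullback_sec n \<Omega> F \<and> (\<forall>r\<in>\<Omega>. \<sigma> r = stalk_class n (k + 1) F r)}"

definition jet_add :: "nat \<Rightarrow> nat \<Rightarrow> 'v set set \<Rightarrow> 'v jet \<Rightarrow> 'v jet \<Rightarrow> 'v jet" where
  "jet_add n k U \<sigma> \<tau> = (\<lambda>p \<in> U \<times> lines.
     \<Union>F\<in>\<sigma> p. \<Union>H\<in>\<tau> p. stalk_class n (k + 1) (\<lambda>r \<alpha>s \<beta>s. F r \<alpha>s \<beta>s + H r \<alpha>s \<beta>s) p)"

definition jet_mult :: "nat \<Rightarrow> nat \<Rightarrow> 'v set set \<Rightarrow> ('v set \<Rightarrow> complex) \<Rightarrow> 'v jet \<Rightarrow> 'v jet" where
  "jet_mult n k U g \<sigma> = (\<lambda>p \<in> U \<times> lines.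
     \<Union>F\<in>\<sigma> p. stalk_class n (k + 1) (\<lambda>r \<alpha>s \<beta>s. g (fst r) * F r \<alpha>s \<beta>s) p)"

text \<open>The projection \<open>\<phi>\<^sub>k\<close> from \<open>k\<close>-jets to \<open>(k - 1)\<close>-jets, for \<open>k \<ge> 1\<close>.\<close>

definition jet_proj :: "nat \<Rightarrow> nat \<Rightarrow> 'v set set \<Rightarrow> 'v jet \<Rightarrow> 'v jet" where
  "jet_proj n k U \<sigma> = (\<lambda>p \<in> U \<times> lines. \<Union>F\<in>\<sigma> p. stalk_class n k F p)"

subsection \<open>The identification of the jet bundles\<close>

text \<open>A symmetric tensor \<open>S\<close> is the global section \<open>\<eta> \<mapsto> q\<^bsup>\<otimes>n\<^esup> S \<in> (V/\<eta>)\<^bsup>\<otimes>n\<^esup>\<close> of \<open>L\<^sup>n\<close>. Evaluation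
  sends \<open>f\<close> at \<open>\<xi>\<close> to the \<open>k\<close>-jet at \<open>\<xi>\<close> of the global section \<open>f \<xi>\<close>, which is represented by
  \<open>(\<xi>, \<eta>) \<mapsto> q\<^bsup>\<otimes>n\<^esup> (f \<xi>)\<close> near the diagonal.\<close>

definition jet_eval :: "nat \<Rightarrow> nat \<Rightarrow> 'v set set \<Rightarrow> ('v set \<Rightarrow> 'v tensor) \<Rightarrow> 'v jet" where
  "jet_eval n k U f = (\<lambda>p \<in> U \<times> lines. stalk_class n (k + 1) (\<lambda>(\<xi>, \<eta>). qmap n \<eta> (f \<xi>)) p)"

definition theta :: "nat \<Rightarrow> nat \<Rightarrow> 'v set set \<Rightarrow> ('v set \<Rightarrow> 'v tensor) \<Rightarrow> 'v set \<Rightarrow> 'v mixed" where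
  "theta n k U f = (\<lambda>\<xi>\<in>U. qmap (n - k) \<xi> (f \<xi>))"

text \<open>The map induced by the surjections \<open>jet_eval\<close> and \<open>theta\<close> with equal kernels: lift a jet
  locally along \<open>jet_eval\<close> and apply \<open>theta\<close>.\<close>

definition jet_iso :: "nat \<Rightarrow> nat \<Rightarrow> 'v set set \<Rightarrow> 'v jet \<Rightarrow> 'v set \<Rightarrow> 'v mixed" where
  "jet_iso n k U \<sigma> = (\<lambda>\<xi>\<in>U. THE t. \<exists>U' f. openin lines_top U' \<and> \<xi> \<in> U' \<and> U' \<subseteq> U \<and> f \<in> V_sec n U' \<and>
     jet_eval n k U' f = restrict \<sigma> (U' \<times> lines) \<and> t = theta n k U' f \<xi>)"

definition Id_tensor_varpi :: "nat \<Rightarrow> 'v set set \<Rightarrow> ('v set \<Rightarrow> 'v mixed) \<Rightarrow> 'v set \<Rightarrow> 'v mixed" where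
  "Id_tensor_varpi a U s = (\<lambda>\<xi>\<in>U. Id_tensor a (varpi \<xi>) (s \<xi>))"

subsection \<open>Action of the special linear group\<close>

definition SL :: "('v \<Rightarrow> 'v) set" where
  "SL = {g. Vector_Spaces.linear scale scale g \<and>
     (\<forall>e f a b c d. frame e f \<longrightarrow> g e = a *\<^sub>V e + b *\<^sub>V f \<longrightarrow> g f = c *\<^sub>V e + d *\<^sub>V f \<longrightarrow> a * d - b * c = 1)}"

definition act :: "('v \<Rightarrow> 'v) \<Rightarrow> 'v mixed \<Rightarrow> 'v mixed" where
  "act g T = (\<lambda>\<alpha>s \<beta>s. T (map (\<lambda>\<alpha>. \<alpha> \<circ> (`) g) \<alpha>s) (map (\<lambda>\<beta>. \<beta> \<circ> g) \<beta>s))"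

definition act_sec :: "('v \<Rightarrow> 'v) \<Rightarrow> 'v set set \<Rightarrow> ('v set \<Rightarrow> 'v mixed) \<Rightarrow> 'v set \<Rightarrow> 'v mixed" where
  "act_sec g U s = (\<lambda>\<xi> \<in> (`) g ` U. act g (s (g -` \<xi>)))"

definition act_jet :: "('v \<Rightarrow> 'v) \<Rightarrow> 'v set set \<Rightarrow> 'v jet \<Rightarrow> 'v jet" where
  "act_jet g U \<sigma> = (\<lambda>(\<xi>, \<eta>) \<in> ((`) g ` U) \<times> lines.
     (\<lambda>F (\<xi>', \<eta>'). act g (F (g -` \<xi>', g -` \<eta>'))) ` \<sigma> (g -` \<xi>, g -` \<eta>))"

text \<open>An equivariant isomorphism of sheaves of modules over the holomorphic functions from
  \<open>J\<^bsup>k\<^esup>(L\<^sup>n)\<close> to \<open>L\<^bsup>n-k\<^esup> \<otimes> \<V>\<^sub>k\<close> which is compatible with the maps from \<open>\<V>\<^sub>n\<close>.\<close>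

definition equivariant_jet_iso ::
  "nat \<Rightarrow> nat \<Rightarrow> ('v set set \<Rightarrow> 'v jet \<Rightarrow> 'v set \<Rightarrow> 'v mixed) \<Rightarrow> bool" where
  "equivariant_jet_iso n k \<Phi> \<longleftrightarrow> (\<forall>U. openin lines_top U \<longrightarrow>
     bij_betw (\<Phi> U) (jet_sec n k U) (L_sec (n - k) k U) \<and>
     (\<forall>\<sigma>\<in>jet_sec n k U. \<forall>U'\<subseteq>U. openin lines_top U' \<longrightarrow>
        \<Phi> U' (restrict \<sigma> (U' \<times> lines)) = restrict (\<Phi> U \<sigma>) U') \<and>
     (\<forall>\<sigma>\<in>jet_sec n k U. \<forall>\<tau>\<in>jet_sec n k U.
        \<Phi> U (jet_add n k U \<sigma> \<tau>) = (\<lambda>\<xi>\<in>U. \<lambda>\<alpha>s \<beta>s. \<Phi> U \<sigma> \<xi> \<alpha>s \<beta>s + \<Phi> U \<tau> \<xi> \<alpha>s \<beta>s)) \<and>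
     (\<forall>g. hol g U \<longrightarrow> (\<forall>\<sigma>\<in>jet_sec n k U.
        \<Phi> U (jet_mult n k U g \<sigma>) = (\<lambda>\<xi>\<in>U. \<lambda>\<alpha>s \<beta>s. g \<xi> * \<Phi> U \<sigma> \<xi> \<alpha>s \<beta>s))) \<and>
     (\<forall>f\<in>V_sec n U. \<Phi> U (jet_eval n k U f) = theta n k U f) \<and>
     (\<forall>g\<in>SL. \<forall>\<sigma>\<in>jet_sec n k U. \<Phi> ((`) g ` U) (act_jet g U \<sigma>) = act_sec g U (\<Phi> U \<sigma>)))"

end

end

theory Submission
  imports Defs "HOL-Complex_Analysis.Complex_Analysis"
begin

text \<open>
  Fix a frame \<open>(e, f)\<close> of \<open>V\<close> with dual basis \<open>(e\<^sup>*, f\<^sup>*)\<close>. The line spanned by \<open>e + z f\<close> has coordinate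
  \<open>z\<close> and is the kernel of \<open>\<lambda>\<^sub>z = f\<^sup>* - z e\<^sup>*\<close>. Since \<open>\<lambda>\<^sub>z\<close> spans the forms on the quotient by this line,
  \<open>q\<^bsup>\<otimes>a\<^esup> \<otimes> Id\<close> is contraction with \<open>a\<close> copies of \<open>\<lambda>\<^sub>z\<close>, and a symmetric tensor \<open>S\<close> of order \<open>n\<close>, regarded as
  a section of \<open>L\<^sup>n\<close>, has the coordinate \<open>S(\<lambda>\<^sub>w, \<dots>, \<lambda>\<^sub>w)\<close> at the line with coordinate \<open>w\<close>. From
  \<open>\<lambda>\<^sub>w = \<lambda>\<^sub>z - (w - z) e\<^sup>*\<close> one gets its Taylor expansion at \<open>z\<close> (lemma \<open>Sym_lam_expand\<close>): the coefficient of
  \<open>(w - z)\<^sup>j\<close> is, up to a nonzero constant, the value of \<open>S\<close> on \<open>j\<close> copies of \<open>e\<^sup>*\<close> and \<open>n - j\<close> copies of \<open>\<lambda>\<^sub>z\<close>.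
  The \<open>k\<close>-jet at \<open>z\<close> records these values for \<open>j \<le> k\<close>. The same values determine the contraction of
  \<open>S\<close> with \<open>n - k\<close> copies of \<open>\<lambda>\<^sub>z\<close>, which is \<open>theta\<close>. So evaluation and \<open>theta\<close> have the same kernel
  (\<open>qmap_eq_if_jet_eq\<close> and \<open>jet_eq_if_qmap_eq\<close>).

  Both maps are locally surjective. For \<open>theta\<close> this is linear algebra with a basis of the symmetric
  tensors that is dual to the words in \<open>e\<^sup>*\<close> and \<open>\<lambda>\<^sub>z\<close> (\<open>L_sec_locally_theta\<close>). For evaluation, a jet is
  given near the diagonal by a holomorphic function of \<open>z\<close> and \<open>w\<close>, which is expanded in powers of \<open>w - z\<close>
  with coefficients that are holomorphic in \<open>z\<close> (\<open>diagonal_taylor\<close>, \<open>jet_sec_locally_eval\<close>). Off the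
  diagonal the quotient sheaf has zero stalks and imposes no condition.

  Hence every jet has local lifts to sections of \<open>\<V>\<^sub>n\<close>, and \<open>jet_iso\<close> is computed by \<open>theta\<close> on an arbitrary
  lift (\<open>jet_iso_eqI\<close>). Bijectivity, linearity and equivariance are read off from lifts. A lift of a
  \<open>k\<close>-jet also lifts the \<open>(k - 1)\<close>-jet below it, and therefore the projection corresponds to passing from
  \<open>q\<^bsup>\<otimes>(n-k)\<^esup> \<otimes> Id\<close> to \<open>q\<^bsup>\<otimes>(n-k+1)\<^esup> \<otimes> Id\<close>. The latter is the former followed by \<open>Id \<otimes> \<varpi>\<close>
  (\<open>jet_iso_proj\<close>).
\<close>

section \<open>Holomorphic functions of two variables\<close>

lemma open_contains_bidisc:
  fixes S :: "(complex \<times> complex) set"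
  assumes "open S" "(z, w) \<in> S"
  obtains r where "r > 0" "cball z r \<times> cball w r \<subseteq> S"
proof -
  obtain A B where AB: "open A" "open B" "z \<in> A" "w \<in> B" "A \<times> B \<subseteq> S"
    using open_prod_elim[OF assms] by (metis mem_Sigma_iff)
  obtain r1 where r1: "r1 > 0" "cball z r1 \<subseteq> A"
    using AB open_contains_cball by blast
  obtain r2 where r2: "r2 > 0" "cball w r2 \<subseteq> B"
    using AB open_contains_cball by blast
  have "cball z (min r1 r2) \<times> cball w (min r1 r2) \<subseteq> S"
    using r1 r2 AB(5) by fastforce
  then show thesis
    using r1 r2 that[of "min r1 r2"] by simp
qed

lemma open_slices:
  fixes S :: "(complex \<times> complex) set"
  assumes "open S"
  shows "open {z. (z, w) \<in> S}" "open {w. (z, w) \<in> S}" "open {z. (z, z) \<in> S}"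
proof -
  have "open ((\<lambda>z. (z, w)) -` S)" "open ((\<lambda>w. (z, w)) -` S)" "open ((\<lambda>z. (z, z)) -` S)"
    by (intro open_vimage assms continuous_intros)+
  then show "open {z. (z, w) \<in> S}" "open {w. (z, w) \<in> S}" "open {z. (z, z) \<in> S}"
    by (simp_all add: vimage_def)
qed

text \<open>
  Cauchy's inequality bounds the difference of the derivatives of two slices by the difference of the
  slices themselves, and the latter is uniformly small because \<open>f\<close> is uniformly continuous on a
  compact bidisc.
\<close>

lemma continuous_on_deriv_snd:
  fixes f :: "complex \<times> complex \<Rightarrow> complex"
  assumes S: "open S" and cont: "continuous_on S f"
    and hol: "\<And>z. (\<lambda>w. f (z, w)) holomorphic_on {w. (z, w) \<in> S}"
  shows "continuous_on S (\<lambda>p. deriv (\<lambda>w. f (fst p, w)) (snd p))"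
proof -
  have "continuous (at (z0, w0)) (\<lambda>p. deriv (\<lambda>w. f (fst p, w)) (snd p))"
    if p: "(z0, w0) \<in> S" for z0 w0
    unfolding continuous_at_eps_delta
  proof (intro allI impI)
    fix \<epsilon> :: real
    assume \<epsilon>: "\<epsilon> > 0"
    obtain R where R: "R > 0" "cball z0 R \<times> cball w0 R \<subseteq> S"
      using open_contains_bidisc[OF S p] .
    define r where "r = R / 2"
    have r: "r > 0" "r + r = R"
      using R by (simp_all add: r_def)
    have "uniformly_continuous_on (cball z0 R \<times> cball w0 R) f"
      by (rule compact_uniformly_continuous)
        (use R cont in \<open>auto intro: continuous_on_subset compact_Times\<close>)
    then obtain d where d: "d > 0" "\<And>p q. \<lbrakk>p \<in> cball z0 R \<times> cball w0 R; q \<in> cball z0 R \<times> cball w0 R;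
        dist p q < d\<rbrakk> \<Longrightarrow> dist (f p) (f q) < \<epsilon> / 2 * r"
      unfolding uniformly_continuous_on_def using \<epsilon> r by (metis half_gt_zero mult_pos_pos)
    have hol0: "(\<lambda>w. f (z, w)) holomorphic_on ball w0 R" if "z \<in> cball z0 R" for z
      using hol[of z] by (rule holomorphic_on_subset) (use R that in auto)
    have "continuous_on (ball w0 R) (deriv (\<lambda>w. f (z0, w)))"
      using hol0[of z0] R by (intro holomorphic_on_imp_continuous_on holomorphic_deriv) auto
    then have "continuous (at w0) (deriv (\<lambda>w. f (z0, w)))"
      using R by (simp add: continuous_on_eq_continuous_at)
    then obtain d' where d': "d' > 0" "\<And>w. dist w w0 < d' \<Longrightarrow>
        dist (deriv (\<lambda>w. f (z0, w)) w) (deriv (\<lambda>w. f (z0, w)) w0) < \<epsilon> / 2"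
      unfolding continuous_at_eps_delta using \<epsilon> by (metis half_gt_zero)
    define \<delta> where "\<delta> = Min {d, d', r}"
    have \<delta>: "\<delta> > 0" "\<delta> \<le> d" "\<delta> \<le> d'" "\<delta> \<le> r"
      using d d' r by (auto simp: \<delta>_def)
    show "\<exists>d>0. \<forall>p. dist p (z0, w0) < d \<longrightarrow>
        dist (deriv (\<lambda>w. f (fst p, w)) (snd p))
          (deriv (\<lambda>w. f (fst (z0, w0), w)) (snd (z0, w0))) < \<epsilon>"
    proof (intro exI[of _ \<delta>] conjI allI impI \<delta>)
      fix p :: "complex \<times> complex"
      assume dp: "dist p (z0, w0) < \<delta>"
      obtain z w where zw: "p = (z, w)"
        by fastforce
      have zw': "dist z z0 < \<delta>" "dist w w0 < \<delta>"
        using dp dist_fst_le[of p "(z0, w0)"] dist_snd_le[of p "(z0, w0)"] zw by auto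
      have zin: "z \<in> cball z0 R" "z0 \<in> cball z0 R"
        using zw' \<delta> r by (auto simp: dist_commute)
      have sub: "cball w r \<subseteq> ball w0 R"
        using zw' \<delta> r by (simp add: cball_subset_ball_iff dist_commute)
      have H: "(\<lambda>u. f (z, u) - f (z0, u)) holomorphic_on ball w0 R"
        by (intro holomorphic_intros hol0 zin)
      have "norm ((deriv ^^ 1) (\<lambda>u. f (z, u) - f (z0, u)) w) \<le> fact 1 * (\<epsilon> / 2 * r) / r ^ 1"
      proof (rule Cauchy_inequality)
        show "(\<lambda>u. f (z, u) - f (z0, u)) holomorphic_on ball w r"
          using H by (rule holomorphic_on_subset) (use sub ball_subset_cball in blast)
        show "continuous_on (cball w r) (\<lambda>u. f (z, u) - f (z0, u))"
          using H sub by (meson holomorphic_on_imp_continuous_on holomorphic_on_subset)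
        show "norm (f (z, u) - f (z0, u)) \<le> \<epsilon> / 2 * r" if u: "norm (w - u) = r" for u
        proof -
          have "u \<in> cball w r"
            using u by (simp add: dist_norm)
          then have "u \<in> cball w0 R"
            using sub ball_subset_cball by blast
          then have "dist (f (z, u)) (f (z0, u)) < \<epsilon> / 2 * r"
            using zin zw' \<delta> by (intro d) (auto simp: dist_Pair_Pair)
          then show ?thesis
            by (simp add: dist_norm)
        qed
      qed fact
      then have "norm (deriv (\<lambda>u. f (z, u) - f (z0, u)) w) \<le> \<epsilon> / 2"
        using r by simp
      moreover have "w \<in> ball w0 R"
        using sub r by (metis centre_in_cball less_imp_le subsetD)
      then have "deriv (\<lambda>u. f (z, u) - f (z0, u)) w = deriv (\<lambda>u. f (z, u)) w - deriv (\<lambda>u. f (z0, u)) w"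
        using hol0[OF zin(1)] hol0[OF zin(2)]
        by (intro deriv_diff) (auto intro: holomorphic_on_imp_differentiable_at)
      moreover have "norm (deriv (\<lambda>w. f (z0, w)) w - deriv (\<lambda>w. f (z0, w)) w0) < \<epsilon> / 2"
        using d'(2)[of w] zw' \<delta> by (simp add: dist_norm)
      ultimately have "norm (deriv (\<lambda>u. f (z, u)) w - deriv (\<lambda>w. f (z0, w)) w0) < \<epsilon>"
        using norm_triangle_ineq[of "deriv (\<lambda>u. f (z, u)) w - deriv (\<lambda>u. f (z0, u)) w"
            "deriv (\<lambda>w. f (z0, w)) w - deriv (\<lambda>w. f (z0, w)) w0"] by simp
      then show "dist (deriv (\<lambda>w. f (fst p, w)) (snd p))
          (deriv (\<lambda>w. f (fst (z0, w0), w)) (snd (z0, w0))) < \<epsilon>"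
        by (simp add: zw dist_norm)
    qed
  qed
  then show ?thesis
    using S by (auto simp: continuous_on_eq_continuous_at)
qed

lemma holomorphic2_on_separately:
  assumes "holomorphic2_on f S"
  shows "open S" "continuous_on S f"
    "(\<lambda>z. f (z, w)) holomorphic_on {z. (z, w) \<in> S}"
    "(\<lambda>w. f (z, w)) holomorphic_on {w. (z, w) \<in> S}"
proof -
  show S: "open S"
    using assms by (simp add: holomorphic2_on_def)
  have "f differentiable at p" if "p \<in> S" for p
    using assms that unfolding holomorphic2_on_def differentiable_def by blast
  then show "continuous_on S f"
    by (simp add: continuous_at_imp_continuous_on differentiable_imp_continuous_within)
  show "(\<lambda>z. f (z, w)) holomorphic_on {z. (z, w) \<in> S}"
    unfolding holomorphic_on_open[OF open_slices(1)[OF S]]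
  proof safe
    fix z assume "(z, w) \<in> S"
    then obtain a b where ab: "(f has_derivative (\<lambda>(h, k). a * h + b * k)) (at (z, w))"
      using assms unfolding holomorphic2_on_def by blast
    have "((\<lambda>z. f (z, w)) has_derivative (\<lambda>h. (\<lambda>(h, k). a * h + b * k) (h, 0))) (at z)"
      by (rule has_derivative_compose[where f = "\<lambda>z. (z, w)", OF _ ab])
        (auto intro!: derivative_eq_intros)
    then show "\<exists>f'. ((\<lambda>z. f (z, w)) has_field_derivative f') (at z)"
      by (auto simp: has_field_derivative_def)
  qed
  show "(\<lambda>w. f (z, w)) holomorphic_on {w. (z, w) \<in> S}"
    unfolding holomorphic_on_open[OF open_slices(2)[OF S]]
  proof safe
    fix w assume "(z, w) \<in> S"
    then obtain a b where ab: "(f has_derivative (\<lambda>(h, k). a * h + b * k)) (at (z, w))"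
      using assms unfolding holomorphic2_on_def by blast
    have "((\<lambda>w. f (z, w)) has_derivative (\<lambda>h. (\<lambda>(h, k). a * h + b * k) (0, h))) (at w)"
      by (rule has_derivative_compose[where f = "\<lambda>w. (z, w)", OF _ ab])
        (auto intro!: derivative_eq_intros)
    then show "\<exists>f'. ((\<lambda>w. f (z, w)) has_field_derivative f') (at w)"
      by (auto simp: has_field_derivative_def)
  qed
qed

text \<open>
  Osgood's lemma for continuous functions. Total differentiability follows from the existence of one
  partial derivative and the continuity of the other one. It reduces the closure properties of
  holomorphic functions of two variables to those of continuous functions and of holomorphic
  functions of one variable.
\<close>

lemma osgood:
  assumes S: "open S" and cont: "continuous_on S f"
    and hol1: "\<And>w. (\<lambda>z. f (z, w)) holomorphic_on {z. (z, w) \<in> S}"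
    and hol2: "\<And>z. (\<lambda>w. f (z, w)) holomorphic_on {w. (z, w) \<in> S}"
  shows "holomorphic2_on f S"
  unfolding holomorphic2_on_def
proof (intro conjI ballI S)
  fix p assume p: "p \<in> S"
  obtain z0 w0 where zw: "p = (z0, w0)"
    by fastforce
  obtain R where R: "R > 0" "cball z0 R \<times> cball w0 R \<subseteq> S"
    using open_contains_bidisc[OF S] p zw by metis
  define X where "X = ball z0 R \<times> ball w0 R"
  have X: "X \<subseteq> S" "open X" "(z0, w0) \<in> X"
    using R by (auto simp: X_def open_Times)
  have d: "((\<lambda>w. f (z, w)) has_field_derivative deriv (\<lambda>w. f (z, w)) w) (at w)"
    if "(z, w) \<in> S" for z w
    by (rule holomorphic_derivI[OF hol2 open_slices(2)[OF S]]) (simp add: that)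
  have d1: "((\<lambda>z. f (z, w0)) has_field_derivative deriv (\<lambda>z. f (z, w0)) z0) (at z0)"
    by (rule holomorphic_derivI[OF hol1 open_slices(1)[OF S]]) (use p zw in simp)
  have "((\<lambda>(x, y). f (x, y)) has_derivative (\<lambda>(h, k). deriv (\<lambda>z. f (z, w0)) z0 * h +
      blinfun_mult_right (deriv (\<lambda>w. f (z0, w)) w0) k)) (at (z0, w0) within ball z0 R \<times> ball w0 R)"
  proof (rule has_derivative_partialsI)
    show "((\<lambda>z. f (z, w0)) has_derivative (*) (deriv (\<lambda>z. f (z, w0)) z0)) (at z0 within ball z0 R)"
      using d1 by (simp add: has_field_derivative_def has_derivative_at_withinI)
    show "((\<lambda>w. f (z, w)) has_derivative
        blinfun_apply (blinfun_mult_right (deriv (\<lambda>w. f (z, w)) w))) (at w within ball w0 R)"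
      if "z \<in> ball z0 R" "w \<in> ball w0 R" for z w
    proof -
      have "(z, w) \<in> S"
        using X(1) that by (auto simp: X_def)
      then show ?thesis
        using d[THEN has_field_derivative_at_within] by (simp add: has_field_derivative_def)
    qed
    have "continuous_on X (\<lambda>p. blinfun_mult_right (deriv (\<lambda>w. f (fst p, w)) (snd p)))"
      by (intro bounded_linear.continuous_on[OF bounded_linear_blinfun_mult_right]
          continuous_on_subset[OF continuous_on_deriv_snd[OF S cont hol2] X(1)])
    then show "continuous (at (z0, w0) within ball z0 R \<times> ball w0 R)
        (\<lambda>(x, y). blinfun_mult_right (deriv (\<lambda>w. f (x, w)) y))"
      using X(3) by (simp add: continuous_on_eq_continuous_within X_def case_prod_beta')
  qed (use R in auto)
  then have "(f has_derivative (\<lambda>(h, k). deriv (\<lambda>z. f (z, w0)) z0 * h + deriv (\<lambda>w. f (z0, w)) w0 * k))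
      (at (z0, w0))"
    using X at_within_open[OF X(3,2)] by (simp add: X_def)
  then show "\<exists>a b. (f has_derivative (\<lambda>(h, k). a * h + b * k)) (at p)"
    using zw by blast
qed

lemma holomorphic2_on_iff:
  "holomorphic2_on f S \<longleftrightarrow> open S \<and> continuous_on S f \<and>
     (\<forall>w. (\<lambda>z. f (z, w)) holomorphic_on {z. (z, w) \<in> S}) \<and>
     (\<forall>z. (\<lambda>w. f (z, w)) holomorphic_on {w. (z, w) \<in> S})"
  using holomorphic2_on_separately osgood by blast

lemma holomorphic2_on_const: "open S \<Longrightarrow> holomorphic2_on (\<lambda>p. c) S"
  by (simp add: holomorphic2_on_iff)

lemma holomorphic2_on_add:
  assumes "holomorphic2_on f S" "holomorphic2_on g S"
  shows "holomorphic2_on (\<lambda>p. f p + g p) S"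
  using assms by (auto simp: holomorphic2_on_iff intro!: continuous_intros holomorphic_intros)

lemma holomorphic2_on_mult:
  assumes "holomorphic2_on f S" "holomorphic2_on g S"
  shows "holomorphic2_on (\<lambda>p. f p * g p) S"
  using assms by (auto simp: holomorphic2_on_iff intro!: continuous_intros holomorphic_intros)

lemma holomorphic2_on_diff:
  assumes "holomorphic2_on f S" "holomorphic2_on g S"
  shows "holomorphic2_on (\<lambda>p. f p - g p) S"
  using assms by (auto simp: holomorphic2_on_iff intro!: continuous_intros holomorphic_intros)

lemma holomorphic2_on_divide:
  assumes "holomorphic2_on f S" "holomorphic2_on g S" "\<And>p. p \<in> S \<Longrightarrow> g p \<noteq> 0"
  shows "holomorphic2_on (\<lambda>p. f p / g p) S"
  using assms by (auto simp: holomorphic2_on_iff intro!: continuous_intros holomorphic_intros)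

lemma holomorphic2_on_power:
  assumes "holomorphic2_on f S"
  shows "holomorphic2_on (\<lambda>p. f p ^ m) S"
  using assms by (auto simp: holomorphic2_on_iff intro!: continuous_intros holomorphic_intros)

lemma holomorphic2_on_sum:
  assumes "open S" "\<And>i. i \<in> I \<Longrightarrow> holomorphic2_on (f i) S"
  shows "holomorphic2_on (\<lambda>p. \<Sum>i\<in>I. f i p) S"
  using assms by (auto simp: holomorphic2_on_iff intro!: continuous_intros holomorphic_intros)

lemma holomorphic2_on_fst:
  assumes "f holomorphic_on A" "open S" "fst ` S \<subseteq> A"
  shows "holomorphic2_on (\<lambda>p. f (fst p)) S"
  unfolding holomorphic2_on_iff
proof (intro conjI allI)
  show "continuous_on S (\<lambda>p. f (fst p))"
    by (rule continuous_on_compose2[OF holomorphic_on_imp_continuous_on[OF assms(1)] _ assms(3)])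
      (intro continuous_intros)
  show "(\<lambda>z. f (fst (z, w))) holomorphic_on {z. (z, w) \<in> S}" for w
    using holomorphic_on_subset[OF assms(1)] assms(3) by force
qed (use assms in auto)

lemma holomorphic2_on_snd:
  assumes "f holomorphic_on A" "open S" "snd ` S \<subseteq> A"
  shows "holomorphic2_on (\<lambda>p. f (snd p)) S"
  unfolding holomorphic2_on_iff
proof (intro conjI allI)
  show "continuous_on S (\<lambda>p. f (snd p))"
    by (rule continuous_on_compose2[OF holomorphic_on_imp_continuous_on[OF assms(1)] _ assms(3)])
      (intro continuous_intros)
  show "(\<lambda>w. f (snd (z, w))) holomorphic_on {w. (z, w) \<in> S}" for z
    using holomorphic_on_subset[OF assms(1)] assms(3) by force
qed (use assms in auto)

lemma holomorphic2_on_subset: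
  "holomorphic2_on f S \<Longrightarrow> T \<subseteq> S \<Longrightarrow> open T \<Longrightarrow> holomorphic2_on f T"
  by (auto simp: holomorphic2_on_def)

lemma holomorphic2_on_cong:
  assumes "holomorphic2_on f S" "\<And>p. p \<in> S \<Longrightarrow> f p = g p"
  shows "holomorphic2_on g S"
proof -
  have S: "open S"
    using assms by (simp add: holomorphic2_on_def)
  have "(g has_derivative D) (at p)" if "p \<in> S" "(f has_derivative D) (at p)" for p D
    using has_derivative_transform_within_open[OF that(2) S that(1)] assms(2) by metis
  then show ?thesis
    using assms(1) unfolding holomorphic2_on_def by metis
qed

lemma holomorphic2_on_local:
  assumes "\<And>p. p \<in> S \<Longrightarrow> \<exists>T. p \<in> T \<and> T \<subseteq> S \<and> holomorphic2_on f T"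
  shows "holomorphic2_on f S"
  unfolding holomorphic2_on_def
proof
  show "open S"
    using assms holomorphic2_on_separately(1) by (subst open_subopen) meson
  show "\<forall>p\<in>S. \<exists>a b. (f has_derivative (\<lambda>(h, k). a * h + b * k)) (at p)"
    using assms unfolding holomorphic2_on_def by blast
qed

lemma holomorphic2_on_compose:
  assumes f: "holomorphic2_on f S" and u: "u holomorphic_on A" and v: "v holomorphic_on B"
    and T: "open T" "T \<subseteq> A \<times> B" "\<And>z w. (z, w) \<in> T \<Longrightarrow> (u z, v w) \<in> S"
  shows "holomorphic2_on (\<lambda>(z, w). f (u z, v w)) T"
  unfolding holomorphic2_on_iff
proof (intro conjI allI T(1))
  have "continuous_on T (\<lambda>p. (u (fst p), v (snd p)))"
    by (intro continuous_intros continuous_on_compose2[OF holomorphic_on_imp_continuous_on[OF u]]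
        continuous_on_compose2[OF holomorphic_on_imp_continuous_on[OF v]]) (use T in auto)
  then have "continuous_on T (\<lambda>p. f (u (fst p), v (snd p)))"
    by (rule continuous_on_compose2[OF holomorphic2_on_separately(2)[OF f]]) (use T(3) in auto)
  then show "continuous_on T (\<lambda>(z, w). f (u z, v w))"
    by (simp add: case_prod_beta')
  show "(\<lambda>z. case (z, w) of (z, w) \<Rightarrow> f (u z, v w)) holomorphic_on {z. (z, w) \<in> T}" for w
    unfolding prod.case
    by (rule holomorphic_on_compose_gen[where g = "\<lambda>z. f (z, v w)" and f = u, unfolded o_def,
          OF _ holomorphic2_on_separately(3)[OF f, of "v w"]])
      (use T u in \<open>auto intro: holomorphic_on_subset\<close>)
  show "(\<lambda>w. case (z, w) of (z, w) \<Rightarrow> f (u z, v w)) holomorphic_on {w. (z, w) \<in> T}" for z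
    unfolding prod.case
    by (rule holomorphic_on_compose_gen[where g = "\<lambda>w. f (u z, w)" and f = v, unfolded o_def,
          OF _ holomorphic2_on_separately(4)[OF f, of "u z"]])
      (use T v in \<open>auto intro: holomorphic_on_subset\<close>)
qed

lemma holomorphic2_on_diagonal:
  assumes "holomorphic2_on f S"
  shows "(\<lambda>z. f (z, z)) holomorphic_on {z. (z, z) \<in> S}"
proof -
  have S: "open S"
    using assms by (simp add: holomorphic2_on_def)
  show ?thesis
    unfolding holomorphic_on_open[OF open_slices(3)[OF S]]
  proof safe
    fix z assume "(z, z) \<in> S"
    then obtain a b where ab: "(f has_derivative (\<lambda>(h, k). a * h + b * k)) (at (z, z))"
      using assms unfolding holomorphic2_on_def by blast
    have "((\<lambda>z. f (z, z)) has_derivative (\<lambda>h. (\<lambda>(h, k). a * h + b * k) (h, h))) (at z)"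
      by (rule has_derivative_compose[where f = "\<lambda>z. (z, z)", OF _ ab])
        (auto intro!: derivative_eq_intros)
    then have "((\<lambda>z. f (z, z)) has_field_derivative (a + b)) (at z)"
      by (simp add: has_field_derivative_def distrib_right) (metis (no_types, lifting) ext distrib_right)
    then show "\<exists>f'. ((\<lambda>z. f (z, z)) has_field_derivative f') (at z)"
      by blast
  qed
qed

text \<open>
  The ideal of the diagonal is generated by \<open>w - z\<close>. The quotient \<open>f / (w - z)\<close> is extended to the
  diagonal by \<open>\<partial>f/\<partial>w\<close>. The mean value inequality in \<open>w\<close> makes the extension continuous, so that its
  slices are holomorphic by removal of singularities and Osgood's lemma applies.
\<close>

lemma diagonal_division:
  assumes f: "holomorphic2_on f S" and zero: "\<And>z. (z, z) \<in> S \<Longrightarrow> f (z, z) = 0"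
  obtains h where "holomorphic2_on h S" "\<And>z w. (z, w) \<in> S \<Longrightarrow> f (z, w) = (w - z) * h (z, w)"
proof -
  note S = holomorphic2_on_separately(1)[OF f]
  define D where "D z w = deriv (\<lambda>w. f (z, w)) w" for z w
  (* the value on the diagonal is the limit of the quotient *)
  define h where "h p = (if fst p = snd p then D (fst p) (snd p) else f p / (snd p - fst p))" for p
  have D: "((\<lambda>w. f (z, w)) has_field_derivative D z w) (at w)" if "(z, w) \<in> S" for z w
    unfolding D_def
    by (rule holomorphic_derivI[OF holomorphic2_on_separately(4)[OF f] open_slices(2)[OF S]])
      (simp add: that)
  have contD: "continuous_on S (\<lambda>p. D (fst p) (snd p))"
    unfolding D_def by (rule continuous_on_deriv_snd) (use holomorphic2_on_separately[OF f] in auto)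
  have "continuous (at (z0, w0)) h" if p: "(z0, w0) \<in> S" for z0 w0
  proof (cases "z0 = w0")
    case False
    have op: "open (S - {p. fst p = snd p})"
      by (intro open_Diff S closed_Collect_eq continuous_intros)
    have "continuous_on (S - {p. fst p = snd p}) (\<lambda>p. f p / (snd p - fst p))"
      by (intro continuous_intros continuous_on_subset[OF holomorphic2_on_separately(2)[OF f]]) auto
    then have "continuous_on (S - {p. fst p = snd p}) h"
      by (rule continuous_on_eq) (auto simp: h_def)
    then show ?thesis
      using op False p by (simp add: continuous_on_eq_continuous_at)
  next
    case True
    have "continuous (at (z0, z0)) (\<lambda>p. D (fst p) (snd p))"
      using contD p S True by (simp add: continuous_on_eq_continuous_at)
    show ?thesis
      unfolding continuous_at_eps_delta
    proof (intro allI impI)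
      fix \<epsilon> :: real assume \<epsilon>: "\<epsilon> > 0"
      obtain R where R: "R > 0" "cball z0 R \<times> cball z0 R \<subseteq> S"
        using open_contains_bidisc[OF S p] True by metis
      obtain d where d: "d > 0" "\<And>q. dist q (z0, z0) < d \<Longrightarrow> dist (D (fst q) (snd q)) (D z0 z0) < \<epsilon> / 2"
        using \<open>continuous (at (z0, z0)) (\<lambda>p. D (fst p) (snd p))\<close> \<epsilon>
        unfolding continuous_at_eps_delta by (metis fst_conv half_gt_zero snd_conv)
      define r where "r = min R (d / 2)"
      have r: "r > 0" "r \<le> R" "r \<le> d / 2"
        using R d by (auto simp: r_def)
      have D_near: "norm (D z w - D z0 z0) \<le> \<epsilon> / 2" if "z \<in> ball z0 r" "w \<in> ball z0 r" for z w
      proof -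
        have "dist (z, w) (z0, z0) \<le> dist z z0 + dist w z0"
          unfolding dist_Pair_Pair by (rule sqrt_sum_squares_le_sum) auto
        also have "\<dots> < d"
          using that r by (auto simp: dist_commute)
        finally show ?thesis
          using d(2)[of "(z, w)"] by (simp add: dist_norm)
      qed
      have "dist (h q) (h (z0, w0)) < \<epsilon>" if q: "dist q (z0, w0) < r" for q
      proof -
        obtain z w where zw: "q = (z, w)"
          by fastforce
        have zb: "z \<in> ball z0 r" "w \<in> ball z0 r"
          using q dist_fst_le[of q "(z0, w0)"] dist_snd_le[of q "(z0, w0)"] zw True
          by (auto simp: dist_commute)
        have "norm (h (z, w) - D z0 z0) \<le> \<epsilon> / 2"
        proof (cases "z = w")
          case True
          then show ?thesis
            using D_near zb by (simp add: h_def)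
        next
          case False
          have "norm ((f (z, w) - D z0 z0 * w) - (f (z, z) - D z0 z0 * z)) \<le> \<epsilon> / 2 * norm (w - z)"
          proof (rule field_differentiable_bound[OF convex_ball])
            fix u assume u: "u \<in> ball z0 r"
            have "(z, u) \<in> S"
              using u zb r R by auto
            then have "((\<lambda>u. f (z, u) - D z0 z0 * u) has_field_derivative (D z u - D z0 z0 * 1)) (at u)"
              by (intro DERIV_diff DERIV_cmult DERIV_ident D)
            then show "((\<lambda>u. f (z, u) - D z0 z0 * u) has_field_derivative (D z u - D z0 z0))
                (at u within ball z0 r)"
              by (simp add: has_field_derivative_at_within)
            show "norm (D z u - D z0 z0) \<le> \<epsilon> / 2"
              using D_near zb u by blast
          qed (use zb in auto)
          moreover have "f (z, z) = 0"
            using zb R r by (intro zero) auto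
          ultimately have "norm (f (z, w) - D z0 z0 * (w - z)) \<le> \<epsilon> / 2 * norm (w - z)"
            by (simp add: algebra_simps)
          moreover have "h (z, w) - D z0 z0 = (f (z, w) - D z0 z0 * (w - z)) / (w - z)"
            using False by (simp add: h_def field_simps)
          ultimately show ?thesis
            using False by (simp add: norm_divide divide_le_eq)
        qed
        then show ?thesis
          using \<epsilon> True by (simp add: zw dist_norm h_def)
      qed
      then show "\<exists>d>0. \<forall>x'. dist x' (z0, w0) < d \<longrightarrow> dist (h x') (h (z0, w0)) < \<epsilon>"
        using r by blast
    qed
  qed
  then have cont: "continuous_on S h"
    using S by (auto simp: continuous_on_eq_continuous_at)
  have "holomorphic2_on h S"
  proof (rule osgood[OF S cont])
    fix w
    show "(\<lambda>z. h (z, w)) holomorphic_on {z. (z, w) \<in> S}"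
    proof (rule no_isolated_singularity[where K = "{w}"])
      show "continuous_on {z. (z, w) \<in> S} (\<lambda>z. h (z, w))"
        by (rule continuous_on_compose2[OF cont]) (auto intro!: continuous_intros)
      have "(\<lambda>z. f (z, w) / (w - z)) holomorphic_on {z. (z, w) \<in> S} - {w}"
        by (intro holomorphic_intros holomorphic_on_subset[OF holomorphic2_on_separately(3)[OF f]]) auto
      then show "(\<lambda>z. h (z, w)) holomorphic_on {z. (z, w) \<in> S} - {w}"
        by (rule holomorphic_transform) (auto simp: h_def)
    qed (use open_slices(1)[OF S] in auto)
  next
    fix z
    show "(\<lambda>w. h (z, w)) holomorphic_on {w. (z, w) \<in> S}"
    proof (rule no_isolated_singularity[where K = "{z}"])
      show "continuous_on {w. (z, w) \<in> S} (\<lambda>w. h (z, w))"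
        by (rule continuous_on_compose2[OF cont]) (auto intro!: continuous_intros)
      have "(\<lambda>w. f (z, w) / (w - z)) holomorphic_on {w. (z, w) \<in> S} - {z}"
        by (intro holomorphic_intros holomorphic_on_subset[OF holomorphic2_on_separately(4)[OF f]]) auto
      then show "(\<lambda>w. h (z, w)) holomorphic_on {w. (z, w) \<in> S} - {z}"
        by (rule holomorphic_transform) (auto simp: h_def)
    qed (use open_slices(2)[OF S] in auto)
  qed
  moreover have "f (z, w) = (w - z) * h (z, w)" if "(z, w) \<in> S" for z w
    using zero that by (cases "z = w") (auto simp: h_def)
  ultimately show thesis
    using that by blast
qed

text \<open>
  The Taylor expansion of a germ along the diagonal, with coefficients that are holomorphic in the base
  point: split off the value on the diagonal and divide the rest by \<open>w - z\<close>, repeatedly.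
\<close>

lemma diagonal_taylor:
  assumes f: "holomorphic2_on f (B \<times> B)"
  obtains b h where "\<And>i. b i holomorphic_on B" "holomorphic2_on h (B \<times> B)"
    "\<And>z w. z \<in> B \<Longrightarrow> w \<in> B \<Longrightarrow> f (z, w) = (\<Sum>i<m. b i z * (w - z) ^ i) + (w - z) ^ m * h (z, w)"
proof -
  have "\<exists>b h. (\<forall>i. b i holomorphic_on B) \<and> holomorphic2_on h (B \<times> B) \<and>
    (\<forall>z\<in>B. \<forall>w\<in>B. f (z, w) = (\<Sum>i<m. b i z * (w - z) ^ i) + (w - z) ^ m * h (z, w))"
  proof (induction m)
    case 0
    then show ?case
      using f by (intro exI[of _ "\<lambda>i z. 0"] exI[of _ f]) auto
  next
    case (Suc m)
    then obtain b h where bh: "\<And>i. b i holomorphic_on B" "holomorphic2_on h (B \<times> B)"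
      "\<And>z w. z \<in> B \<Longrightarrow> w \<in> B \<Longrightarrow> f (z, w) = (\<Sum>i<m. b i z * (w - z) ^ i) + (w - z) ^ m * h (z, w)"
      by blast
    have diag: "(\<lambda>z. h (z, z)) holomorphic_on B"
      using holomorphic2_on_diagonal[OF bh(2)] by simp
    have "holomorphic2_on (\<lambda>p. h p - h (fst p, fst p)) (B \<times> B)"
      by (intro holomorphic2_on_diff bh holomorphic2_on_fst[OF diag] holomorphic2_on_separately(1)[OF f]) auto
    then obtain h' where h': "holomorphic2_on h' (B \<times> B)"
      "\<And>z w. (z, w) \<in> B \<times> B \<Longrightarrow> h (z, w) - h (fst (z, w), fst (z, w)) = (w - z) * h' (z, w)"
      by (rule diagonal_division) auto
    have eq: "f (z, w) = (\<Sum>i<Suc m. (b(m := \<lambda>z. h (z, z))) i z * (w - z) ^ i) + (w - z) ^ Suc m * h' (z, w)"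
      if "z \<in> B" "w \<in> B" for z w
    proof -
      have "h (z, w) = h (z, z) + (w - z) * h' (z, w)"
        using h'(2)[of z w] that by (simp add: algebra_simps)
      moreover have "(\<Sum>i<m. (b(m := \<lambda>z. h (z, z))) i z * (w - z) ^ i) = (\<Sum>i<m. b i z * (w - z) ^ i)"
        by (intro sum.cong) auto
      ultimately show ?thesis
        using bh(3)[OF that] by (simp add: distrib_left mult.commute mult.left_commute)
    qed
    show ?case
      by (intro exI[of _ "b(m := \<lambda>z. h (z, z))"] exI[of _ h']) (use bh(1) diag h'(1) eq in auto)
  qed
  then show thesis
    using that by blast
qed

text \<open>
  Once \<open>(w - z)\<^sup>j\<close> is cancelled, the left-hand side tends to the coefficient number \<open>j\<close> and the
  right-hand side to \<open>0\<close> as \<open>w\<close> tends to \<open>z\<close>.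
\<close>

lemma vanishing_order_coeffs:
  fixes c :: "nat \<Rightarrow> complex"
  assumes S: "open S" "z \<in> S" and h: "h holomorphic_on S"
    and eq: "\<And>w. w \<in> S \<Longrightarrow> (\<Sum>i\<le>n. c i * (w - z) ^ i) = (w - z) ^ m * h w"
    and "j < m" "j \<le> n"
  shows "c j = 0"
  using \<open>j < m\<close> \<open>j \<le> n\<close>
proof (induction j rule: less_induct)
  case (less j)
  (* by induction the terms below j vanish, so the sum is (w - z) ^ j * q w *)
  define q where "q w = (\<Sum>i\<in>{j..n}. c i * (w - z) ^ (i - j))" for w
  have poly: "(\<Sum>i\<le>n. c i * (w - z) ^ i) = (w - z) ^ j * q w" for w
  proof -
    have "(\<Sum>i\<le>n. c i * (w - z) ^ i) = (\<Sum>i\<in>{j..n}. c i * (w - z) ^ i)"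
      using less by (intro sum.mono_neutral_right) auto
    also have "\<dots> = (\<Sum>i\<in>{j..n}. (w - z) ^ j * (c i * (w - z) ^ (i - j)))"
    proof (intro sum.cong refl)
      fix i assume "i \<in> {j..n}"
      then have "(w - z) ^ i = (w - z) ^ j * (w - z) ^ (i - j)"
        by (simp flip: power_add)
      then show "c i * (w - z) ^ i = (w - z) ^ j * (c i * (w - z) ^ (i - j))"
        by simp
    qed
    finally show ?thesis
      by (simp add: q_def sum_distrib_left)
  qed
  have "q w = (w - z) ^ (m - j) * h w" if "w \<in> S - {z}" for w
  proof -
    have "(w - z) ^ j * q w = (w - z) ^ j * ((w - z) ^ (m - j) * h w)"
      using eq[of w] poly[of w] that less.prems by (simp flip: mult.assoc power_add)
    then show ?thesis
      using that by simp
  qed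
  then have ev: "eventually (\<lambda>w. q w = (w - z) ^ (m - j) * h w) (at z)"
    using S by (auto simp: eventually_at_topological)
  have "q \<midarrow>z\<rightarrow> q z"
    unfolding q_def by (intro tendsto_intros)
  moreover have "q z = (\<Sum>i\<in>{j..n}. if i = j then c j else 0)"
    unfolding q_def by (intro sum.cong) auto
  then have "q z = c j"
    using less.prems by simp
  moreover have "continuous (at z) (\<lambda>w. (w - z) ^ (m - j) * h w)"
  proof -
    have "continuous_on S (\<lambda>w. (w - z) ^ (m - j) * h w)"
      by (intro continuous_intros holomorphic_on_imp_continuous_on h)
    then show ?thesis
      using S by (simp add: continuous_on_eq_continuous_at)
  qed
  then have "(\<lambda>w. (w - z) ^ (m - j) * h w) \<midarrow>z\<rightarrow> 0"
    unfolding continuous_at using less.prems by (simp add: power_0_left)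
  then have "q \<midarrow>z\<rightarrow> 0"
    using tendsto_cong[OF ev] by simp
  ultimately show ?case
    using LIM_unique by metis
qed

context complex_plane
begin

section \<open>Frames and their dual forms\<close>

lemma forms_iff:
  "\<beta> \<in> forms \<longleftrightarrow> (\<forall>u v. \<beta> (u + v) = \<beta> u + \<beta> v) \<and> (\<forall>c v. \<beta> (c *\<^sub>V v) = c * \<beta> v)"
proof -
  have "vector_space ((*) :: complex \<Rightarrow> complex \<Rightarrow> complex)"
    by unfold_locales (auto simp: algebra_simps)
  then show ?thesis
    by (simp add: forms_def Vector_Spaces.linear_iff vector_space_axioms)
qed

lemma forms_add: "\<beta> \<in> forms \<Longrightarrow> \<beta> (u + v) = \<beta> u + \<beta> v"
  and forms_scale: "\<beta> \<in> forms \<Longrightarrow> \<beta> (c *\<^sub>V v) = c * \<beta> v"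
  by (simp_all add: forms_iff)

lemma forms_zero: "\<beta> \<in> forms \<Longrightarrow> \<beta> 0 = 0"
  using forms_scale[of \<beta> 0 0] by simp

lemma forms_add_mult: "\<beta> \<in> forms \<Longrightarrow> \<gamma> \<in> forms \<Longrightarrow> (\<lambda>v. \<beta> v + c * \<gamma> v) \<in> forms"
  by (simp add: forms_iff algebra_simps)

lemma frame_iff: "frame e f \<longleftrightarrow> (\<forall>x y. x *\<^sub>V e + y *\<^sub>V f = 0 \<longrightarrow> x = 0 \<and> y = 0)"
proof
  assume fr: "frame e f"
  then have "e \<notin> span {f}" "f \<noteq> 0"
    unfolding frame_def by (auto simp: independent_insert dependent_single)
  show "\<forall>x y. x *\<^sub>V e + y *\<^sub>V f = 0 \<longrightarrow> x = 0 \<and> y = 0"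
  proof (intro allI impI)
    fix x y
    assume 0: "x *\<^sub>V e + y *\<^sub>V f = 0"
    have "x = 0"
    proof (rule ccontr)
      assume "x \<noteq> 0"
      then have "e = inverse x *\<^sub>V (x *\<^sub>V e)"
        by simp
      also have "\<dots> = inverse x *\<^sub>V (- y *\<^sub>V f)"
        using 0 by (simp add: add_eq_0_iff2)
      finally have "e \<in> span {f}"
        by (metis span_base span_scale singletonI)
      with \<open>e \<notin> span {f}\<close> show False ..
    qed
    then show "x = 0 \<and> y = 0"
      using 0 \<open>f \<noteq> 0\<close> by simp
  qed
next
  assume *: "\<forall>x y. x *\<^sub>V e + y *\<^sub>V f = 0 \<longrightarrow> x = 0 \<and> y = 0"
  have "e \<noteq> f"
    using *[rule_format, of 1 "-1"] by auto
  moreover have "f \<noteq> 0"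
    using *[rule_format, of 0 1] by auto
  moreover have "e \<notin> span {f}"
  proof
    assume "e \<in> span {f}"
    then obtain c where "e = c *\<^sub>V f"
      by (auto simp: span_singleton)
    then show False
      using *[rule_format, of 1 "-c"] by simp
  qed
  ultimately show "frame e f"
    by (simp add: frame_def independent_insert dependent_single)
qed

lemma frame_span:
  assumes "frame e f"
  shows "span {e, f} = UNIV"
proof -
  obtain B where B: "independent B" "UNIV \<subseteq> span B" "card B = 2"
    using basis_exists[of UNIV] dim_UNIV by metis
  have "finite B"
    using B(3) card.infinite by fastforce
  have "v \<in> span {e, f}" for v
  proof (rule ccontr)
    assume v: "v \<notin> span {e, f}"
    then have "v \<notin> {e, f}"
      using span_base by blast
    then have "card {v, e, f} = 3"
      using assms by (simp add: frame_def)
    moreover have "independent {v, e, f}"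
      using v assms \<open>v \<notin> {e, f}\<close> by (simp add: insert_iff independent_insert[of v] frame_def)
    then have "card {v, e, f} \<le> card B"
      using independent_span_bound[OF \<open>finite B\<close>] B(2) by blast
    ultimately show False
      using B(3) by simp
  qed
  then show ?thesis
    by blast
qed

lemma frame_exists: "\<exists>e f. frame e f"
proof -
  obtain B where B: "independent B" "card B = 2"
    using basis_exists[of UNIV] dim_UNIV by metis
  then obtain e f where "B = {e, f}" "e \<noteq> f"
    by (meson card_2_iff)
  with B show ?thesis
    by (auto simp: frame_def)
qed

text \<open>
  The forms \<open>ecf e f\<close> and \<open>fcf e f\<close> are the basis dual to the frame \<open>(e, f)\<close>.
\<close>

definition ecf :: "'v \<Rightarrow> 'v \<Rightarrow> 'v \<Rightarrow> complex" where
  "ecf e f v = representation {e, f} v e"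

definition fcf :: "'v \<Rightarrow> 'v \<Rightarrow> 'v \<Rightarrow> complex" where
  "fcf e f v = representation {e, f} v f"

lemma frame_coords:
  assumes "frame e f"
  shows "v = ecf e f v *\<^sub>V e + fcf e f v *\<^sub>V f"
proof -
  have "(\<Sum>b\<in>{e, f}. representation {e, f} v b *\<^sub>V b) = v"
    using assms frame_span[OF assms] by (intro sum_representation_eq) (auto simp: frame_def)
  then show ?thesis
    using assms by (simp add: frame_def ecf_def fcf_def)
qed

lemma frame_coords_unique:
  assumes "frame e f"
  shows "ecf e f (a *\<^sub>V e + b *\<^sub>V f) = a" "fcf e f (a *\<^sub>V e + b *\<^sub>V f) = b"
proof -
  define v where "v = a *\<^sub>V e + b *\<^sub>V f"
  have "(ecf e f v - a) *\<^sub>V e + (fcf e f v - b) *\<^sub>V f = 0"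
    using frame_coords[OF assms, of v] v_def by (simp add: scale_left_diff_distrib algebra_simps)
  then have "ecf e f v - a = 0 \<and> fcf e f v - b = 0"
    using assms unfolding frame_iff by blast
  then show "ecf e f (a *\<^sub>V e + b *\<^sub>V f) = a" "fcf e f (a *\<^sub>V e + b *\<^sub>V f) = b"
    unfolding v_def[symmetric] by simp_all
qed

lemma ecf_forms: "frame e f \<Longrightarrow> ecf e f \<in> forms"
  and fcf_forms: "frame e f \<Longrightarrow> fcf e f \<in> forms"
  using frame_span[of e f]
  by (auto simp: forms_iff ecf_def fcf_def frame_def representation_add representation_scale)

lemma coords_basis:
  assumes "frame e f"
  shows "ecf e f e = 1" "fcf e f e = 0" "ecf e f f = 0" "fcf e f f = 1"
  using frame_coords_unique[OF assms, of 1 0] frame_coords_unique[OF assms, of 0 1] by simp_all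

lemma span_scale_line:
  assumes "c \<noteq> 0"
  shows "span {c *\<^sub>V v} = span {v}"
proof -
  have "c *\<^sub>V v \<in> span {v}"
    by (intro span_scale span_base) simp
  moreover have "v = inverse c *\<^sub>V (c *\<^sub>V v)"
    using assms by simp
  then have "v \<in> span {c *\<^sub>V v}"
    by (metis span_scale span_base singletonI)
  ultimately show ?thesis
    by (intro antisym span_minimal) auto
qed

lemma frame_extend:
  assumes "v \<noteq> 0"
  shows "\<exists>f. frame v f"
proof -
  obtain a b where ab: "frame a b"
    using frame_exists by blast
  define p q where "p = ecf a b v" and "q = fcf a b v"
  have v: "v = p *\<^sub>V a + q *\<^sub>V b"
    using frame_coords[OF ab] by (simp add: p_def q_def)
  have comb: "x * p = 0 \<and> x * q + y = 0" if "x *\<^sub>V v + y *\<^sub>V b = 0" for x y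
  proof -
    have "(x * p) *\<^sub>V a + (x * q + y) *\<^sub>V b = 0"
      using that by (simp add: v algebra_simps)
    then show ?thesis
      using ab unfolding frame_iff by blast
  qed
  have comb': "x * p + y = 0 \<and> x * q = 0" if "x *\<^sub>V v + y *\<^sub>V a = 0" for x y
  proof -
    have "(x * p + y) *\<^sub>V a + (x * q) *\<^sub>V b = 0"
      using that by (simp add: v algebra_simps)
    then show ?thesis
      using ab unfolding frame_iff by blast
  qed
  show ?thesis
  proof (cases "p = 0")
    case False
    have "frame v b"
      unfolding frame_iff using comb False by (metis add_0 mult_eq_0_iff)
    then show ?thesis ..
  next
    case True
    then have "q \<noteq> 0"
      using v assms by auto
    have "frame v a"
      unfolding frame_iff using comb' \<open>q \<noteq> 0\<close> by (metis add_0 mult_eq_0_iff)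
    then show ?thesis ..
  qed
qed

section \<open>Charts of the projective line\<close>

text \<open>
  The form that vanishes on the line \<open>chart e f z\<close> and takes the value \<open>1\<close> at \<open>f\<close>.
\<close>

definition lam :: "'v \<Rightarrow> 'v \<Rightarrow> complex \<Rightarrow> 'v \<Rightarrow> complex" where
  "lam e f z v = fcf e f v - z * ecf e f v"

text \<open>
  The form on the quotient by \<open>chart e f z\<close> whose pullback to \<open>V\<close> is \<open>lam e f z\<close>; the chosen
  representative of the coset does not matter.
\<close>

definition qlam :: "'v \<Rightarrow> 'v \<Rightarrow> complex \<Rightarrow> 'v set \<Rightarrow> complex" where
  "qlam e f z X = lam e f z (SOME v. v \<in> X)"

lemma lam_forms: "frame e f \<Longrightarrow> lam e f z \<in> forms"
  using ecf_forms[of e f] fcf_forms[of e f] by (simp add: forms_iff lam_def[abs_def] algebra_simps)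

lemma lam_simps:
  assumes "frame e f"
  shows "lam e f z f = 1" "lam e f z e = - z" "lam e f z (e + w *\<^sub>V f) = w - z"
    "ecf e f (e + w *\<^sub>V f) = 1"
  using coords_basis[OF assms] frame_coords_unique[OF assms, of 1 w] by (simp_all add: lam_def)

lemma mem_chart_iff:
  assumes "frame e f"
  shows "v \<in> chart e f z \<longleftrightarrow> lam e f z v = 0"
proof
  assume "v \<in> chart e f z"
  then obtain c where "v = c *\<^sub>V (e + z *\<^sub>V f)"
    by (auto simp: chart_def span_singleton)
  then show "lam e f z v = 0"
    using lam_simps(3)[OF assms, of z z] forms_scale[OF lam_forms[OF assms]] by simp
next
  assume "lam e f z v = 0"
  then have "v = ecf e f v *\<^sub>V (e + z *\<^sub>V f)"
    using frame_coords[OF assms, of v] by (simp add: lam_def algebra_simps)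
  then show "v \<in> chart e f z"
    unfolding chart_def by (metis span_base span_scale singletonI)
qed

lemma chart_inj: "frame e f \<Longrightarrow> chart e f z = chart e f w \<longleftrightarrow> z = w"
  using mem_chart_iff[of e f "e + z *\<^sub>V f" w] mem_chart_iff[of e f "e + z *\<^sub>V f" z] lam_simps(3)[of e f]
  by auto

lemma inj_chart: "frame e f \<Longrightarrow> inj (chart e f)"
  by (simp add: inj_def chart_inj)

lemma form_eq_lam:
  assumes "frame e f" "\<beta> \<in> forms" "\<beta> (e + z *\<^sub>V f) = 0"
  shows "\<beta> = (\<lambda>v. \<beta> f * lam e f z v)"
proof
  fix v
  have "\<beta> v = ecf e f v * \<beta> e + fcf e f v * \<beta> f"
    by (subst frame_coords[OF assms(1), of v]) (simp only: forms_add[OF assms(2)] forms_scale[OF assms(2)])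
  moreover have "\<beta> e = - z * \<beta> f"
    using assms(3) by (simp add: forms_add[OF assms(2)] forms_scale[OF assms(2)] add_eq_0_iff2)
  ultimately show "\<beta> v = \<beta> f * lam e f z v"
    by (simp add: lam_def algebra_simps)
qed

lemma quot_chart_eq_iff:
  assumes "frame e f"
  shows "quot (chart e f z) u = quot (chart e f z) v \<longleftrightarrow> lam e f z u = lam e f z v"
proof
  assume *: "quot (chart e f z) u = quot (chart e f z) v"
  have "u \<in> quot (chart e f z) u"
    unfolding quot_def chart_def using span_zero by (metis add.right_neutral imageI)
  then have "u \<in> quot (chart e f z) v"
    using * by simp
  then obtain x where "u = v + x" "x \<in> chart e f z"
    by (auto simp: quot_def)
  then show "lam e f z u = lam e f z v"
    by (simp add: mem_chart_iff[OF assms] forms_add[OF lam_forms[OF assms]])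
next
  have *: "quot (chart e f z) u \<subseteq> quot (chart e f z) v" if "lam e f z u = lam e f z v" for u v
  proof
    fix x assume "x \<in> quot (chart e f z) u"
    then obtain y where y: "x = u + y" "lam e f z y = 0"
      by (auto simp: quot_def mem_chart_iff[OF assms])
    have "lam e f z ((u - v) + v) = lam e f z (u - v) + lam e f z v"
      by (rule forms_add[OF lam_forms[OF assms]])
    then have "lam e f z ((u - v) + y) = 0"
      using that y by (simp add: forms_add[OF lam_forms[OF assms]])
    then have "(u - v) + y \<in> chart e f z"
      by (simp add: mem_chart_iff[OF assms])
    moreover have "x = v + ((u - v) + y)"
      using y by simp
    ultimately show "x \<in> quot (chart e f z) v"
      unfolding quot_def by blast
  qed
  assume "lam e f z u = lam e f z v"
  then show "quot (chart e f z) u = quot (chart e f z) v"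
    using * by (metis antisym)
qed

text \<open>
  The quotient of \<open>V\<close> by a line is one-dimensional, hence every form on it is determined by its value at
  the class of \<open>f\<close>.
\<close>

lemma quot_form_eq:
  assumes "frame e f" "\<alpha> \<in> quot_forms (chart e f z)"
  shows "\<alpha> \<circ> quot (chart e f z) = (\<lambda>v. \<alpha> (quot (chart e f z) f) * lam e f z v)"
proof -
  have fm: "\<alpha> \<circ> quot (chart e f z) \<in> forms"
    using assms(2) by (simp add: quot_forms_def)
  have "quot (chart e f z) (e + z *\<^sub>V f) = quot (chart e f z) 0"
    using assms(1) by (simp add: quot_chart_eq_iff lam_simps forms_zero[OF lam_forms])
  then have "(\<alpha> \<circ> quot (chart e f z)) (e + z *\<^sub>V f) = 0"
    using forms_zero[OF fm] by simp
  then show ?thesis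
    using form_eq_lam[OF assms(1) fm] by (metis comp_apply)
qed

lemma qlam_quot:
  assumes "frame e f"
  shows "qlam e f z (quot (chart e f z) v) = lam e f z v"
proof -
  have "v \<in> quot (chart e f z) v"
    unfolding quot_def chart_def using span_zero by (metis add.right_neutral imageI)
  then have "(SOME u. u \<in> quot (chart e f z) v) \<in> quot (chart e f z) v"
    by (rule someI)
  then obtain x where "(SOME u. u \<in> quot (chart e f z) v) = v + x" "x \<in> chart e f z"
    by (auto simp: quot_def)
  then show ?thesis
    unfolding qlam_def by (simp add: mem_chart_iff[OF assms] forms_add[OF lam_forms[OF assms]])
qed

lemma qlam_comp_quot: "frame e f \<Longrightarrow> qlam e f z \<circ> quot (chart e f z) = lam e f z"
  by (auto simp: qlam_quot)

lemma qlam_quot_forms: "frame e f \<Longrightarrow> qlam e f z \<in> quot_forms (chart e f z)"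
  by (simp add: quot_forms_def qlam_comp_quot lam_forms)

lemma lines_chart:
  assumes "\<xi> \<in> lines"
  obtains e f where "frame e f" "\<xi> = chart e f 0"
proof -
  obtain v where v: "\<xi> = span {v}" "v \<noteq> 0"
    using assms by (auto simp: lines_def)
  then obtain f where "frame v f"
    using frame_extend by blast
  then show thesis
    using that v by (simp add: chart_def)
qed

text \<open>
  With a chart that contains both components of a point of \<open>X \<times> X\<close>, points on and off the diagonal can
  be treated by the same coordinate computation.
\<close>

lemma lines_common_chart:
  assumes "\<xi> \<in> lines" "\<eta> \<in> lines"
  obtains e f z w where "frame e f" "\<xi> = chart e f z" "\<eta> = chart e f w"
proof -
  obtain u v where uv: "\<xi> = span {u}" "u \<noteq> 0" "\<eta> = span {v}" "v \<noteq> 0"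
    using assms by (auto simp: lines_def)
  show thesis
  proof (cases "frame u v")
    case True
    (* in this frame the coordinates of span {u} and span {v} are 0 and 1 *)
    have "frame u (v - u)"
      unfolding frame_iff
    proof (intro allI impI)
      fix x y assume "x *\<^sub>V u + y *\<^sub>V (v - u) = 0"
      then have "(x - y) *\<^sub>V u + y *\<^sub>V v = 0"
        by (simp add: algebra_simps)
      then show "x = 0 \<and> y = 0"
        using True unfolding frame_iff by fastforce
    qed
    then show thesis
      using uv by (intro that[of u "v - u" 0 1]) (auto simp: chart_def)
  next
    case False
    then obtain x y where xy: "x *\<^sub>V u + y *\<^sub>V v = 0" "x \<noteq> 0 \<or> y \<noteq> 0"
      unfolding frame_iff by blast
    then have xy0: "x \<noteq> 0" "y \<noteq> 0"
      using uv by auto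
    then have "y *\<^sub>V v = (- x) *\<^sub>V u"
      using xy by (simp add: add_eq_0_iff)
    then have "span {v} = span {u}"
      using span_scale_line[of y v] span_scale_line[of "- x" u] xy0 by simp
    moreover obtain e f where "frame e f" "\<xi> = chart e f 0"
      using lines_chart[OF assms(1)] .
    ultimately show thesis
      using that uv by metis
  qed
qed

text \<open>
  Changes of coordinates of the projective line are Moebius transformations.
\<close>

definition transition :: "'v \<Rightarrow> 'v \<Rightarrow> 'v \<Rightarrow> 'v \<Rightarrow> complex \<Rightarrow> complex" where
  "transition e f e' f' z = fcf e f (e' + z *\<^sub>V f') / ecf e f (e' + z *\<^sub>V f')"

definition transition_dom :: "'v \<Rightarrow> 'v \<Rightarrow> 'v \<Rightarrow> 'v \<Rightarrow> complex set" where
  "transition_dom e f e' f' = {z. ecf e f (e' + z *\<^sub>V f') \<noteq> 0}"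

lemma chart_transition:
  assumes "frame e f" "z \<in> transition_dom e f e' f'"
  shows "chart e' f' z = chart e f (transition e f e' f' z)"
proof -
  define x a b where "x = e' + z *\<^sub>V f'" and "a = ecf e f x" and "b = fcf e f x"
  have "a \<noteq> 0"
    using assms by (simp add: transition_dom_def a_def x_def)
  moreover have "x = a *\<^sub>V e + b *\<^sub>V f"
    using frame_coords[OF assms(1), of x] by (simp add: a_def b_def)
  ultimately have "x = a *\<^sub>V (e + (b / a) *\<^sub>V f)"
    by (simp add: scale_right_distrib)
  then have "span {x} = span {e + (b / a) *\<^sub>V f}"
    using span_scale_line[OF \<open>a \<noteq> 0\<close>] by metis
  then show ?thesis
    by (simp add: chart_def transition_def x_def a_def b_def)
qed

lemma chart_in_range_iff:
  assumes "frame e f" "frame e' f'"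
  shows "chart e' f' z \<in> range (chart e f) \<longleftrightarrow> z \<in> transition_dom e f e' f'"
proof
  assume "chart e' f' z \<in> range (chart e f)"
  then obtain w where w: "chart e' f' z = chart e f w"
    by blast
  define x where "x = e' + z *\<^sub>V f'"
  have "x \<noteq> 0"
    using assms(2) unfolding frame_iff x_def by (metis scale_one zero_neq_one)
  have "x \<in> chart e' f' z"
    unfolding chart_def x_def by (simp add: span_base)
  then have "x \<in> chart e f w"
    using w by simp
  then have "fcf e f x = w * ecf e f x"
    by (simp add: mem_chart_iff[OF assms(1)] lam_def)
  then have "ecf e f x \<noteq> 0"
    using frame_coords[OF assms(1), of x] \<open>x \<noteq> 0\<close> by force
  then show "z \<in> transition_dom e f e' f'"
    by (simp add: transition_dom_def x_def)
qed (use chart_transition[OF assms(1)] in blast)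

lemma coord_affine:
  assumes "\<beta> \<in> forms"
  shows "\<beta> (e' + z *\<^sub>V f') = \<beta> e' + z * \<beta> f'"
  by (simp add: forms_add[OF assms] forms_scale[OF assms])

lemma transition_holomorphic:
  assumes "frame e f"
  shows "transition e f e' f' holomorphic_on transition_dom e f e' f'" "open (transition_dom e f e' f')"
proof -
  note c = coord_affine[OF ecf_forms[OF assms]] coord_affine[OF fcf_forms[OF assms]]
  show "transition e f e' f' holomorphic_on transition_dom e f e' f'"
    unfolding transition_def[abs_def] transition_dom_def c by (intro holomorphic_intros) auto
  have "open (- {z. ecf e f e' + z * ecf e f f' = 0})"
    by (intro open_Compl closed_Collect_eq continuous_intros)
  then show "open (transition_dom e f e' f')"
    unfolding transition_dom_def c by (simp add: Collect_neg_eq)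
qed

lemma open_chart_preimage: "openin lines_top U \<Longrightarrow> frame e f \<Longrightarrow> open {z. chart e f z \<in> U}"
  by (simp add: openin_lines_top)

lemma openin_chart_image:
  assumes "frame e f" "open W"
  shows "openin lines_top (chart e f ` W)"
  unfolding openin_lines_top
proof (intro conjI allI impI)
  show "chart e f ` W \<subseteq> lines"
    using chart_in_lines[OF assms(1)] by blast
  fix e' f' assume f': "frame e' f'"
  have "{z. chart e' f' z \<in> chart e f ` W} = transition_dom e f e' f' \<inter> transition e f e' f' -` W"
  proof (intro set_eqI iffI)
    fix z assume "z \<in> {z. chart e' f' z \<in> chart e f ` W}"
    then obtain w where w: "w \<in> W" "chart e' f' z = chart e f w"
      by blast
    then have "z \<in> transition_dom e f e' f'"
      using chart_in_range_iff[OF assms(1) f', of z] by blast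
    then show "z \<in> transition_dom e f e' f' \<inter> transition e f e' f' -` W"
      using chart_transition[OF assms(1)] w chart_inj[OF assms(1)] by auto
  qed (use chart_transition[OF assms(1)] in auto)
  moreover have "open (transition_dom e f e' f' \<inter> transition e f e' f' -` W)"
    using transition_holomorphic[OF assms(1)] assms(2)
    by (intro continuous_open_preimage holomorphic_on_imp_continuous_on)
  ultimately show "open {z. chart e' f' z \<in> chart e f ` W}"
    by simp
qed

text \<open>
  One chart that covers \<open>U\<close> decides about holomorphy, because the coordinate changes are holomorphic.
\<close>

lemma hol_chartI:
  assumes fr: "frame e f" and U: "U \<subseteq> range (chart e f)"
    and g: "(\<lambda>z. g (chart e f z)) holomorphic_on {z. chart e f z \<in> U}"
  shows "hol g U"
  unfolding hol_def
proof (intro allI impI)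
  fix e' f' assume f': "frame e' f'"
  have D: "{z. chart e' f' z \<in> U} \<subseteq> transition_dom e f e' f'"
    using chart_in_range_iff[OF fr f'] U by blast
  have "((\<lambda>z. g (chart e f z)) \<circ> transition e f e' f') holomorphic_on {z. chart e' f' z \<in> U}"
  proof (rule holomorphic_on_compose_gen[OF _ g])
    show "transition e f e' f' holomorphic_on {z. chart e' f' z \<in> U}"
      using transition_holomorphic[OF fr] D holomorphic_on_subset by blast
    show "transition e f e' f' ` {z. chart e' f' z \<in> U} \<subseteq> {z. chart e f z \<in> U}"
      using chart_transition[OF fr] D by fastforce
  qed
  then show "(\<lambda>z. g (chart e' f' z)) holomorphic_on {z. chart e' f' z \<in> U}"
    by (rule holomorphic_transform) (use chart_transition[OF fr] D in auto)
qed

definition chart2 :: "'v \<Rightarrow> 'v \<Rightarrow> complex \<times> complex \<Rightarrow> 'v set \<times> 'v set" where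
  "chart2 e f p = (chart e f (fst p), chart e f (snd p))"

lemma openin_chart2_image:
  assumes "frame e f" "open W"
  shows "openin lines2_top (chart2 e f ` W)"
proof (subst openin_subopen, intro ballI)
  fix r assume "r \<in> chart2 e f ` W"
  then obtain p where p: "p \<in> W" "r = chart2 e f p"
    by blast
  obtain A B where AB: "open A" "open B" "p \<in> A \<times> B" "A \<times> B \<subseteq> W"
    using open_prod_elim[OF assms(2) p(1)] by metis
  have "openin lines2_top (chart e f ` A \<times> chart e f ` B)"
    unfolding lines2_top_def by (simp add: openin_prod_Times_iff openin_chart_image assms AB)
  moreover have "chart e f ` A \<times> chart e f ` B \<subseteq> chart2 e f ` W"
    using AB(4) by (force simp: chart2_def)
  moreover have "r \<in> chart e f ` A \<times> chart e f ` B"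
    using AB p by (auto simp: chart2_def)
  ultimately show "\<exists>T. openin lines2_top T \<and> r \<in> T \<and> T \<subseteq> chart2 e f ` W"
    by blast
qed

lemma open_charts_preimage:
  assumes "openin lines2_top \<Omega>" "frame e f" "frame e' f'"
  shows "open {(z, w). (chart e f z, chart e' f' w) \<in> \<Omega>}"
proof -
  have cm: "continuous_map euclidean lines_top (chart e f)" if "frame e f" for e f
    unfolding continuous_map_def
    using that chart_in_lines[OF that] open_chart_preimage[OF _ that] by (auto simp: topspace_lines_top)
  have "continuous_map euclidean lines_top (chart e f \<circ> fst)"
    "continuous_map euclidean lines_top (chart e' f' \<circ> snd)"
    by (intro continuous_map_compose[where X' = euclidean] cm assms;
        auto intro!: continuous_intros)+
  then have "continuous_map euclidean lines2_top (\<lambda>p. ((chart e f \<circ> fst) p, (chart e' f' \<circ> snd) p))"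
    unfolding lines2_top_def by (rule continuous_map_pairedI)
  from openin_continuous_map_preimage[OF this assms(1)] show ?thesis
    by (simp add: case_prod_beta')
qed

lemma open_chart2_preimage:
  "openin lines2_top \<Omega> \<Longrightarrow> frame e f \<Longrightarrow> open (chart2 e f -` \<Omega>)"
  using open_charts_preimage[of \<Omega> e f e f] by (simp add: vimage_def chart2_def case_prod_beta')

lemma chart2_inj: "frame e f \<Longrightarrow> chart2 e f p = chart2 e f q \<longleftrightarrow> p = q"
  by (cases p; cases q) (auto simp: chart2_def chart_inj)

lemma inj_chart2: "frame e f \<Longrightarrow> inj (chart2 e f)"
  by (simp add: inj_def chart2_inj)

lemma topspace_lines2: "topspace lines2_top = lines \<times> lines"
  by (simp add: lines2_top_def topspace_lines_top)

lemma lines2_chart2: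
  assumes "p \<in> lines \<times> lines"
  obtains e f q where "frame e f" "p = chart2 e f q"
proof -
  have "fst p \<in> lines" "snd p \<in> lines"
    using assms by auto
  then obtain e f z w where "frame e f" "fst p = chart e f z" "snd p = chart e f w"
    by (rule lines_common_chart)
  then show thesis
    using that[of e f "(z, w)"] by (simp add: chart2_def prod_eq_iff)
qed

lemma hol2_chart2:
  assumes "hol2 g \<Omega>" "frame e f"
  shows "holomorphic2_on (\<lambda>p. g (chart2 e f p)) (chart2 e f -` \<Omega>)"
  using assms unfolding hol2_def chart2_def by (simp add: case_prod_beta' vimage_def)

text \<open>
  The two-variable analogue: coordinate changes act on each factor separately.
\<close>

lemma hol2_chartI:
  assumes fr: "frame e f" and \<Omega>: "openin lines2_top \<Omega>" "\<Omega> \<subseteq> range (chart2 e f)"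
    and g: "holomorphic2_on (\<lambda>p. g (chart2 e f p)) (chart2 e f -` \<Omega>)"
  shows "hol2 g \<Omega>"
  unfolding hol2_def
proof (intro allI impI)
  fix e1 f1 e2 f2 assume f12: "frame e1 f1" "frame e2 f2"
  define T where "T = {(z, w). (chart e1 f1 z, chart e2 f2 w) \<in> \<Omega>}"
  have op: "open T"
    unfolding T_def using open_charts_preimage[OF \<Omega>(1) f12] .
  have T: "z \<in> transition_dom e f e1 f1" "w \<in> transition_dom e f e2 f2" if "(z, w) \<in> T" for z w
  proof -
    have "(chart e1 f1 z, chart e2 f2 w) \<in> range (chart2 e f)"
      using that \<Omega>(2) by (auto simp: T_def)
    then have "chart e1 f1 z \<in> range (chart e f)" "chart e2 f2 w \<in> range (chart e f)"
      by (auto simp: chart2_def)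
    then show "z \<in> transition_dom e f e1 f1" "w \<in> transition_dom e f e2 f2"
      using chart_in_range_iff fr f12 by blast+
  qed
  have eq: "chart2 e f (transition e f e1 f1 z, transition e f e2 f2 w) = (chart e1 f1 z, chart e2 f2 w)"
    if "(z, w) \<in> T" for z w
    using T[OF that] by (simp add: chart2_def chart_transition[OF fr])
  have "holomorphic2_on (\<lambda>(z, w). g (chart2 e f (transition e f e1 f1 z, transition e f e2 f2 w))) T"
    by (rule holomorphic2_on_compose[OF g transition_holomorphic(1)[OF fr] transition_holomorphic(1)[OF fr] op])
      (use T eq in \<open>auto simp: T_def\<close>)
  then show "holomorphic2_on (\<lambda>(z, w). g (chart e1 f1 z, chart e2 f2 w))
      {(z, w). (chart e1 f1 z, chart e2 f2 w) \<in> \<Omega>}"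
    unfolding T_def[symmetric] by (rule holomorphic2_on_cong) (use eq in auto)
qed

section \<open>Tensors as multilinear functionals\<close>

text \<open>
  An intrinsic description of tensors, which avoids manipulating decompositions into pure tensors.
\<close>

definition multilinear :: "nat \<Rightarrow> 'v tensor \<Rightarrow> bool" where
  "multilinear m T \<longleftrightarrow> (\<forall>\<beta>s. \<not> (length \<beta>s = m \<and> set \<beta>s \<subseteq> forms) \<longrightarrow> T \<beta>s = 0) \<and>
     (\<forall>xs ys c. \<forall>\<beta>\<in>forms. \<forall>\<gamma>\<in>forms.
        T (xs @ (\<lambda>v. \<beta> v + c * \<gamma> v) # ys) = T (xs @ \<beta> # ys) + c * T (xs @ \<gamma> # ys))"

lemma multilinear_outside:
  "multilinear m T \<Longrightarrow> \<not> (length \<beta>s = m \<and> set \<beta>s \<subseteq> forms) \<Longrightarrow> T \<beta>s = 0"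
  by (simp add: multilinear_def)

lemma multilinear_add_mult:
  "multilinear m T \<Longrightarrow> \<beta> \<in> forms \<Longrightarrow> \<gamma> \<in> forms \<Longrightarrow>
     T (xs @ (\<lambda>v. \<beta> v + c * \<gamma> v) # ys) = T (xs @ \<beta> # ys) + c * T (xs @ \<gamma> # ys)"
  by (simp add: multilinear_def)

lemma multilinear_scale:
  assumes "multilinear m T" "\<gamma> \<in> forms"
  shows "T (xs @ (\<lambda>v. c * \<gamma> v) # ys) = c * T (xs @ \<gamma> # ys)"
proof -
  have "(\<lambda>v. c * \<gamma> v) = (\<lambda>v. \<gamma> v + (c - 1) * \<gamma> v)"
    by (simp add: algebra_simps)
  then show ?thesis
    using multilinear_add_mult[OF assms(1,2,2), of xs "c - 1" ys] by (simp add: algebra_simps)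
qed

lemma multilinear_lincomb:
  assumes "multilinear m T" "\<beta> \<in> forms" "\<gamma> \<in> forms"
  shows "T (xs @ (\<lambda>v. a * \<beta> v + b * \<gamma> v) # ys) = a * T (xs @ \<beta> # ys) + b * T (xs @ \<gamma> # ys)"
proof -
  have "(\<lambda>v. a * \<beta> v) \<in> forms"
    using assms(2) by (simp add: forms_iff algebra_simps)
  then show ?thesis
    using multilinear_add_mult[OF assms(1) _ assms(3), of "\<lambda>v. a * \<beta> v" xs b ys]
      multilinear_scale[OF assms(1,2), of xs a ys] by simp
qed

lemma pure_simps:
  "pure [] \<beta>s = (if \<beta>s = [] then 1 else 0)"
  "pure (v # vs) [] = 0"
  "pure (v # vs) (\<beta> # \<beta>s) = (if \<beta> \<in> forms then \<beta> v * pure vs \<beta>s else 0)"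
  by (auto simp: pure_def prod.lessThan_Suc_shift simp del: prod.lessThan_Suc)

lemma multilinear_pure: "multilinear (length vs) (pure vs)"
  unfolding multilinear_def
proof (intro conjI allI ballI impI)
  fix xs ys c \<beta> \<gamma> assume f: "\<beta> \<in> forms" "\<gamma> \<in> forms"
  show "pure vs (xs @ (\<lambda>v. \<beta> v + c * \<gamma> v) # ys) = pure vs (xs @ \<beta> # ys) + c * pure vs (xs @ \<gamma> # ys)"
  proof (induction vs arbitrary: xs)
    case Nil
    then show ?case by (simp add: pure_simps)
  next
    case (Cons v vs)
    then show ?case
      using f by (cases xs) (auto simp: pure_simps forms_add_mult algebra_simps)
  qed
qed (auto simp: pure_def)

lemma multilinear_sum:
  assumes "\<And>j. j \<in> J \<Longrightarrow> multilinear m (T j)"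
  shows "multilinear m (\<lambda>\<beta>s. \<Sum>j\<in>J. c j * T j \<beta>s)"
  unfolding multilinear_def
proof (intro conjI allI ballI impI)
  fix xs ys d \<beta> \<gamma> assume "\<beta> \<in> forms" "\<gamma> \<in> forms"
  then have "c j * T j (xs @ (\<lambda>v. \<beta> v + d * \<gamma> v) # ys) =
      c j * T j (xs @ \<beta> # ys) + d * (c j * T j (xs @ \<gamma> # ys))" if "j \<in> J" for j
    using multilinear_add_mult[OF assms[OF that]] by (simp add: algebra_simps)
  then show "(\<Sum>j\<in>J. c j * T j (xs @ (\<lambda>v. \<beta> v + d * \<gamma> v) # ys)) =
      (\<Sum>j\<in>J. c j * T j (xs @ \<beta> # ys)) + d * (\<Sum>j\<in>J. c j * T j (xs @ \<gamma> # ys))"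
    by (simp add: sum.distrib sum_distrib_left)
next
  fix \<beta>s :: "('v \<Rightarrow> complex) list"
  assume "\<not> (length \<beta>s = m \<and> set \<beta>s \<subseteq> forms)"
  then show "(\<Sum>j\<in>J. c j * T j \<beta>s) = 0"
    using multilinear_outside[OF assms] by (intro sum.neutral ballI) (metis mult_zero_right)
qed

lemma tensors_scale:
  assumes "T \<in> tensors m"
  shows "(\<lambda>\<beta>s. a * T \<beta>s) \<in> tensors m"
proof -
  obtain N c vs where "\<forall>j<N. length (vs j) = m" "T = (\<lambda>\<beta>s. \<Sum>j<(N::nat). c j * pure (vs j) \<beta>s)"
    using assms unfolding tensors_def by blast
  then show ?thesis
    unfolding tensors_def
    by (intro CollectI exI[of _ N] exI[of _ "\<lambda>j. a * c j"] exI[of _ vs])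
      (simp add: sum_distrib_left mult.assoc)
qed

lemma tensors_add:
  assumes "T \<in> tensors m" "T' \<in> tensors m"
  shows "(\<lambda>\<beta>s. T \<beta>s + T' \<beta>s) \<in> tensors m"
proof -
  obtain N c vs where T: "\<forall>j<N. length (vs j) = m" "T = (\<lambda>\<beta>s. \<Sum>j<(N::nat). c j * pure (vs j) \<beta>s)"
    using assms unfolding tensors_def by blast
  obtain N' c' vs' where T': "\<forall>j<N'. length (vs' j) = m"
    "T' = (\<lambda>\<beta>s. \<Sum>j<(N'::nat). c' j * pure (vs' j) \<beta>s)"
    using assms unfolding tensors_def by blast
  have split: "(\<Sum>j<N + M. h j) = (\<Sum>j<N. h j) + (\<Sum>j<M. h (N + j))" for M and h :: "nat \<Rightarrow> complex"
    by (induction M) auto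
  show ?thesis
    unfolding tensors_def
    by (intro CollectI exI[of _ "N + N'"] exI[of _ "\<lambda>j. if j < N then c j else c' (j - N)"]
        exI[of _ "\<lambda>j. if j < N then vs j else vs' (j - N)"])
      (use T T' in \<open>auto simp: split\<close>)
qed

lemma tensors_pure: "pure vs \<in> tensors (length vs)"
  unfolding tensors_def
  by (intro CollectI exI[of _ 1] exI[of _ "\<lambda>_. 1"] exI[of _ "\<lambda>_. vs"]) simp

lemma tensors_prepend:
  assumes "T \<in> tensors m"
  shows "(\<lambda>\<beta>s. case \<beta>s of [] \<Rightarrow> 0 | \<beta> # \<gamma>s \<Rightarrow> (if \<beta> \<in> forms then \<beta> v * T \<gamma>s else 0)) \<in> tensors (Suc m)"
proof -
  obtain N c vs where T: "\<forall>j<N. length (vs j) = m" "T = (\<lambda>\<beta>s. \<Sum>j<(N::nat). c j * pure (vs j) \<beta>s)"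
    using assms unfolding tensors_def by blast
  show ?thesis
    unfolding tensors_def
    by (intro CollectI exI[of _ N] exI[of _ c] exI[of _ "\<lambda>j. v # vs j"])
      (auto simp: T pure_simps fun_eq_iff sum_distrib_left algebra_simps split: list.split)
qed

lemma multilinear_contract:
  assumes "multilinear (a + b) T" "length \<gamma>s = a"
  shows "multilinear b (\<lambda>\<beta>s. T (\<gamma>s @ \<beta>s))"
  unfolding multilinear_def
proof (intro conjI allI ballI impI)
  fix xs ys c \<beta> \<gamma> assume "\<beta> \<in> forms" "\<gamma> \<in> forms"
  then show "T (\<gamma>s @ xs @ (\<lambda>v. \<beta> v + c * \<gamma> v) # ys) = T (\<gamma>s @ xs @ \<beta> # ys) + c * T (\<gamma>s @ xs @ \<gamma> # ys)"
    using multilinear_add_mult[OF assms(1), of \<beta> \<gamma> "\<gamma>s @ xs" c ys] by simp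
next
  fix \<beta>s :: "('v \<Rightarrow> complex) list"
  assume "\<not> (length \<beta>s = b \<and> set \<beta>s \<subseteq> forms)"
  then show "T (\<gamma>s @ \<beta>s) = 0"
    using assms(2) by (intro multilinear_outside[OF assms(1)]) auto
qed

text \<open>
  Expanding the first argument in the dual basis of a frame writes \<open>T\<close> as
  \<open>e \<otimes> T\<^sub>1 + f \<otimes> T\<^sub>2\<close> with multilinear \<open>T\<^sub>1\<close> and \<open>T\<^sub>2\<close> of lower order.
\<close>

lemma multilinear_imp_tensors: "multilinear m T \<Longrightarrow> T \<in> tensors m"
proof (induction m arbitrary: T)
  case 0
  have "T = (\<lambda>\<beta>s. T [] * pure [] \<beta>s)"
    using multilinear_outside[OF 0] by (auto simp: pure_simps)
  then show ?case
    using tensors_scale[OF tensors_pure[of "[]"]] by (metis list.size(3))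
next
  case (Suc m)
  obtain e f where fr: "frame e f"
    using frame_exists by blast
  have IH: "(\<lambda>\<beta>s. T (\<gamma> # \<beta>s)) \<in> tensors m" for \<gamma>
    using multilinear_contract[of 1 m T "[\<gamma>]"] Suc by simp
  define P where "P v \<gamma> = (\<lambda>\<beta>s. case \<beta>s of [] \<Rightarrow> 0 | \<beta> # \<beta>s' \<Rightarrow> (if \<beta> \<in> forms then \<beta> v * T (\<gamma> # \<beta>s') else 0))"
    for v \<gamma>
  have "P v \<gamma> \<in> tensors (Suc m)" for v \<gamma>
    unfolding P_def by (rule tensors_prepend[OF IH])
  moreover have "T = (\<lambda>\<beta>s. P e (ecf e f) \<beta>s + P f (fcf e f) \<beta>s)"
  proof
    fix \<beta>s
    show "T \<beta>s = P e (ecf e f) \<beta>s + P f (fcf e f) \<beta>s"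
    proof (cases \<beta>s)
      case Nil
      then show ?thesis
        using multilinear_outside[OF Suc.prems, of "[]"] by (simp add: P_def)
    next
      case (Cons \<beta> \<gamma>s)
      show ?thesis
      proof (cases "\<beta> \<in> forms")
        case True
        have "\<beta> v = \<beta> e * ecf e f v + \<beta> f * fcf e f v" for v
          by (subst frame_coords[OF fr, of v])
            (simp add: forms_add[OF True] forms_scale[OF True])
        then have "\<beta> = (\<lambda>v. \<beta> e * ecf e f v + \<beta> f * fcf e f v)"
          by blast
        then have "T (\<beta> # \<gamma>s) = \<beta> e * T (ecf e f # \<gamma>s) + \<beta> f * T (fcf e f # \<gamma>s)"
          using multilinear_lincomb[OF Suc.prems ecf_forms[OF fr] fcf_forms[OF fr], of "[]"] by (metis append_Nil)
        then show ?thesis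
          using True Cons by (simp add: P_def)
      next
        case False
        then show ?thesis
          using Cons multilinear_outside[OF Suc.prems, of \<beta>s] by (simp add: P_def)
      qed
    qed
  qed
  ultimately show ?case
    using tensors_add by metis
qed

lemma tensors_iff_multilinear: "T \<in> tensors m \<longleftrightarrow> multilinear m T"
proof
  assume "T \<in> tensors m"
  then obtain N c vs where T: "\<forall>j<N. length (vs j) = m" "T = (\<lambda>\<beta>s. \<Sum>j<(N::nat). c j * pure (vs j) \<beta>s)"
    unfolding tensors_def by blast
  have "multilinear m (pure (vs j))" if "j < N" for j
    using multilinear_pure[of "vs j"] T that by simp
  then show "multilinear m T"
    unfolding T(2) by (intro multilinear_sum) auto
qed (rule multilinear_imp_tensors)

text \<open>
  A tensor that depends holomorphically on a parameter remains holomorphic when it is evaluated at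
  forms \<open>p - u q\<close> that vary with the parameter through \<open>u\<close>, as \<open>lam e f z\<close> does. The predicate \<open>P\<close>
  stands for holomorphy in one or in two variables. Each argument is expanded by linearity.
\<close>

lemma multilinear_affine_forms:
  fixes t :: "'x \<Rightarrow> 'v tensor" and u :: "'x \<Rightarrow> complex"
  assumes t: "\<And>x. x \<in> A \<Longrightarrow> multilinear m (t x)" "\<And>\<beta>s. P (\<lambda>x. t x \<beta>s)"
    and cong: "\<And>g h. P g \<Longrightarrow> (\<And>x. x \<in> A \<Longrightarrow> g x = h x) \<Longrightarrow> P h"
    and step: "\<And>g h. P g \<Longrightarrow> P h \<Longrightarrow> P (\<lambda>x. g x + - u x * h x)"
    and "\<And>p q. (p, q) \<in> set \<gamma>s \<Longrightarrow> p \<in> forms \<and> q \<in> forms"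
  shows "P (\<lambda>x. t x (xs @ map (\<lambda>(p, q) v. p v + - u x * q v) \<gamma>s))"
  using assms(5)
proof (induction \<gamma>s arbitrary: xs)
  case Nil
  then show ?case
    by (simp add: t(2))
next
  case (Cons pq \<gamma>s)
  obtain p q where pq: "pq = (p, q)"
    by fastforce
  have IH: "P (\<lambda>x. t x ((xs @ [r]) @ map (\<lambda>(p, q) v. p v + - u x * q v) \<gamma>s))" for r
    by (rule Cons.IH) (use Cons.prems in auto)
  have "P (\<lambda>x. t x ((xs @ [p]) @ map (\<lambda>(p, q) v. p v + - u x * q v) \<gamma>s) +
      - u x * t x ((xs @ [q]) @ map (\<lambda>(p, q) v. p v + - u x * q v) \<gamma>s))"
    by (intro step IH)
  then show ?case
  proof (rule cong)
    fix x assume "x \<in> A"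
    have "p \<in> forms" "q \<in> forms"
      using Cons.prems pq by auto
    from multilinear_add_mult[OF t(1)[OF \<open>x \<in> A\<close>] this, of xs "- u x"]
    show "t x ((xs @ [p]) @ map (\<lambda>(p, q) v. p v + - u x * q v) \<gamma>s) +
        - u x * t x ((xs @ [q]) @ map (\<lambda>(p, q) v. p v + - u x * q v) \<gamma>s) =
      t x (xs @ map (\<lambda>(p, q) v. p v + - u x * q v) (pq # \<gamma>s))"
      by (simp add: pq)
  qed
qed

section \<open>Symmetric tensors\<close>

lemma Sym_iff:
  "T \<in> Sym m \<longleftrightarrow> multilinear m T \<and> (\<forall>\<beta>s \<beta>s'. mset \<beta>s = mset \<beta>s' \<longrightarrow> T \<beta>s = T \<beta>s')"
  by (simp add: Sym_def tensors_iff_multilinear)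

lemma Sym_multilinear: "T \<in> Sym m \<Longrightarrow> multilinear m T"
  and Sym_perm: "T \<in> Sym m \<Longrightarrow> mset \<beta>s = mset \<beta>s' \<Longrightarrow> T \<beta>s = T \<beta>s'"
  unfolding Sym_iff by blast+

lemma Sym_sum:
  assumes "\<And>j. j \<in> J \<Longrightarrow> T j \<in> Sym m"
  shows "(\<lambda>\<beta>s. \<Sum>j\<in>J. c j * T j \<beta>s) \<in> Sym m"
proof -
  have "(\<Sum>j\<in>J. c j * T j \<beta>s) = (\<Sum>j\<in>J. c j * T j \<beta>s')" if "mset \<beta>s = mset \<beta>s'" for \<beta>s \<beta>s'
    by (intro sum.cong refl) (simp add: Sym_perm[OF assms that])
  then show ?thesis
    unfolding Sym_iff using multilinear_sum[of J m T c] Sym_multilinear[OF assms] by blast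
qed

lemma Sym_lincomb:
  assumes "S \<in> Sym m" "T \<in> Sym m"
  shows "(\<lambda>\<beta>s. a * S \<beta>s + b * T \<beta>s) \<in> Sym m"
  using Sym_sum[of "UNIV :: bool set" "\<lambda>j. if j then S else T" m "\<lambda>j. if j then a else b"] assms
  by (simp add: UNIV_bool add.commute)

lemma Sym_zero: "(\<lambda>\<beta>s. 0) \<in> Sym m"
  using Sym_sum[of "{} :: nat set" "\<lambda>_ _. 0" m] by simp

lemma Sym_contract:
  assumes "T \<in> Sym (a + b)" "length \<gamma>s = a"
  shows "(\<lambda>\<beta>s. T (\<gamma>s @ \<beta>s)) \<in> Sym b"
  unfolding Sym_iff
  using assms multilinear_contract[OF Sym_multilinear[OF assms(1)] assms(2)]
  by (auto intro: Sym_perm)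

text \<open>
  By symmetry the values on words in \<open>a\<close> and \<open>b\<close> only depend on the number of occurrences of \<open>a\<close>, and by
  multilinearity these values determine all others.
\<close>

lemma Sym_eqI:
  assumes ST: "S \<in> Sym m" "T \<in> Sym m"
    and ab: "a \<in> forms" "b \<in> forms" "\<And>\<beta>. \<beta> \<in> forms \<Longrightarrow> \<exists>x y. \<beta> = (\<lambda>v. x * a v + y * b v)"
    and eq: "\<And>i. i \<le> m \<Longrightarrow> S (replicate i a @ replicate (m - i) b) = T (replicate i a @ replicate (m - i) b)"
  shows "S = T"
proof -
  have "S (xs @ ys) = T (xs @ ys)"
    if "length (xs @ ys) = m" "set xs \<subseteq> forms" "set ys \<subseteq> {a, b}" for xs ys
    using that
  proof (induction xs arbitrary: ys rule: rev_induct)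
    case Nil
    have "\<exists>i\<le>length zs. mset zs = mset (replicate i a @ replicate (length zs - i) b)"
      if "set zs \<subseteq> {a, b}" for zs
      using that
    proof (induction zs)
      case (Cons z zs)
      then obtain i where i: "i \<le> length zs" "mset zs = mset (replicate i a @ replicate (length zs - i) b)"
        by auto
      show ?case
      proof (cases "z = a")
        case True
        then show ?thesis
          using i by (intro exI[of _ "Suc i"]) simp
      next
        case False
        then have "z = b"
          using Cons.prems by simp
        then show ?thesis
          using i by (intro exI[of _ i]) (simp add: Suc_diff_le)
      qed
    qed simp
    then obtain i where "i \<le> m" "mset ys = mset (replicate i a @ replicate (m - i) b)"
      using Nil by fastforce
    then have "S ys = S (replicate i a @ replicate (m - i) b)" "T ys = T (replicate i a @ replicate (m - i) b)"
      by (intro Sym_perm[OF ST(1)] Sym_perm[OF ST(2)]; simp)+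
    then show ?case
      using eq[OF \<open>i \<le> m\<close>] by simp
  next
    case (snoc x xs)
    obtain p q where x: "x = (\<lambda>v. p * a v + q * b v)"
      using ab(3)[of x] snoc.prems by auto
    have "S (xs @ c # ys) = T (xs @ c # ys)" if "c \<in> {a, b}" for c
      using snoc.IH[of "c # ys"] snoc.prems that by auto
    then show ?case
      unfolding x by (simp add: multilinear_lincomb[OF Sym_multilinear[OF ST(1)] ab(1,2)]
        multilinear_lincomb[OF Sym_multilinear[OF ST(2)] ab(1,2)])
  qed
  from this[of _ "[]"] have "S \<beta>s = T \<beta>s" if "length \<beta>s = m" "set \<beta>s \<subseteq> forms" for \<beta>s
    using that by simp
  then show ?thesis
    using multilinear_outside[OF Sym_multilinear[OF ST(1)]]
      multilinear_outside[OF Sym_multilinear[OF ST(2)]] by (metis ext)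
qed

lemma forms_ecf_lam:
  assumes "frame e f" "\<beta> \<in> forms"
  shows "\<beta> = (\<lambda>v. \<beta> (e + z *\<^sub>V f) * ecf e f v + \<beta> f * lam e f z v)"
proof
  fix v
  have "\<beta> v = ecf e f v * \<beta> e + fcf e f v * \<beta> f"
    by (subst frame_coords[OF assms(1), of v]) (simp only: forms_add[OF assms(2)] forms_scale[OF assms(2)])
  then show "\<beta> v = \<beta> (e + z *\<^sub>V f) * ecf e f v + \<beta> f * lam e f z v"
    by (simp add: lam_def coord_affine[OF assms(2)] algebra_simps)
qed

lemma Sym_eq_frameI:
  assumes "S \<in> Sym m" "T \<in> Sym m" "frame e f"
    and "\<And>i. i \<le> m \<Longrightarrow> S (replicate i (ecf e f) @ replicate (m - i) (lam e f z)) =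
      T (replicate i (ecf e f) @ replicate (m - i) (lam e f z))"
  shows "S = T"
  using forms_ecf_lam[OF assms(3)]
  by (intro Sym_eqI[OF assms(1,2) ecf_forms[OF assms(3)] lam_forms[OF assms(3)] _ assms(4)]) blast+

text \<open>
  The polynomial in \<open>x\<close> is the value of the \<open>m\<close>-th tensor power of \<open>v + x u\<close>; its coefficient at
  \<open>x\<^sup>i\<close> is the sum over all ways to place \<open>i\<close> factors \<open>u\<close> and \<open>m - i\<close> factors \<open>v\<close>. If \<open>u\<close> and \<open>v\<close>
  are a basis of \<open>V\<close>, these coefficients are a basis of the symmetric tensors; their symmetry is
  visible from the product.
\<close>

definition symb :: "nat \<Rightarrow> nat \<Rightarrow> 'v \<Rightarrow> 'v \<Rightarrow> 'v tensor" where
  "symb m i u v \<beta>s = (if length \<beta>s = m \<and> set \<beta>s \<subseteq> forms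
     then coeff (prod_list (map (\<lambda>\<beta>. [:\<beta> v, \<beta> u:]) \<beta>s)) i else 0)"

lemma symb_Sym: "symb m i u v \<in> Sym m"
  unfolding Sym_iff multilinear_def
proof (intro conjI allI ballI impI)
  fix xs ys c \<beta> \<gamma> assume f: "\<beta> \<in> forms" "\<gamma> \<in> forms"
  have "[:\<beta> v + c * \<gamma> v, \<beta> u + c * \<gamma> u:] = [:\<beta> v, \<beta> u:] + smult c [:\<gamma> v, \<gamma> u:]"
    by simp
  then show "symb m i u v (xs @ (\<lambda>v. \<beta> v + c * \<gamma> v) # ys) =
      symb m i u v (xs @ \<beta> # ys) + c * symb m i u v (xs @ \<gamma> # ys)"
    using f by (simp add: symb_def forms_add_mult distrib_left distrib_right del: add_pCons smult_pCons)
next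
  fix \<beta>s \<beta>s' :: "('v \<Rightarrow> complex) list"
  assume eq: "mset \<beta>s = mset \<beta>s'"
  have "prod_list (map (\<lambda>\<beta>. [:\<beta> v, \<beta> u:]) \<beta>s) = prod_list (map (\<lambda>\<beta>. [:\<beta> v, \<beta> u:]) \<beta>s')"
    using eq by (simp flip: prod_mset_prod_list)
  then show "symb m i u v \<beta>s = symb m i u v \<beta>s'"
    using mset_eq_length[OF eq] mset_eq_setD[OF eq] by (simp add: symb_def)
qed (auto simp: symb_def)

text \<open>
  Since \<open>e + z f\<close> and \<open>f\<close> form the basis dual to \<open>ecf e f\<close> and \<open>lam e f z\<close>, the tensors \<open>symb\<close> are dual
  to the words in these two forms.
\<close>

lemma symb_frame:
  assumes "frame e f" "i \<le> m"
  shows "symb m j (e + z *\<^sub>V f) f (replicate i (ecf e f) @ replicate (m - i) (lam e f z)) =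
    (if i = j then 1 else 0)"
proof -
  have "[:0, 1:] ^ i = (monom 1 i :: complex poly)"
    by (simp add: monom_altdef)
  then show ?thesis
    using assms ecf_forms[of e f] lam_forms[of e f z]
    by (auto simp: symb_def lam_simps coords_basis prod_list_replicate simp flip: one_pCons)
qed

text \<open>
  The factors of the generating polynomial are all equal to \<open>1 + (z - w) x\<close>.
\<close>

lemma symb_lam:
  assumes "frame e f" "i \<le> m"
  shows "symb m i (e + z *\<^sub>V f) f (replicate m (lam e f w)) = of_nat (m choose i) * (z - w) ^ i"
  using assms lam_forms[of e f w]
  by (auto simp: symb_def lam_simps prod_list_replicate coeff_linear_poly_power)

lemma symb_holomorphic: "(\<lambda>z. symb m i (e + z *\<^sub>V f) f \<beta>s) holomorphic_on A"
proof (cases "length \<beta>s = m \<and> set \<beta>s \<subseteq> forms")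
  case True
  have "(\<lambda>z. coeff (prod_list (map (\<lambda>\<beta>. [:\<beta> f, \<beta> (e + z *\<^sub>V f):]) \<gamma>s)) i) holomorphic_on A"
    if "set \<gamma>s \<subseteq> forms" for \<gamma>s i
    using that
  proof (induction \<gamma>s arbitrary: i)
    case (Cons \<gamma> \<gamma>s)
    then have IH: "(\<lambda>z. coeff (prod_list (map (\<lambda>\<beta>. [:\<beta> f, \<beta> (e + z *\<^sub>V f):]) \<gamma>s)) i) holomorphic_on A" for i
      by simp
    have "\<gamma> \<in> forms"
      using Cons.prems by simp
    then show ?case
      by (cases i) (auto simp: coord_affine coeff_pCons intro!: holomorphic_intros IH)
  qed simp
  then show ?thesis
    using True by (simp add: symb_def)
next
  case False
  then have "(\<lambda>z. symb m i (e + z *\<^sub>V f) f \<beta>s) = (\<lambda>z. 0)"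
    by (simp only: symb_def if_False)
  then show ?thesis
    by simp
qed

lemma Sym_expand:
  assumes "frame e f" "S \<in> Sym m"
  shows "S = (\<lambda>\<beta>s. \<Sum>j\<le>m. S (replicate j (ecf e f) @ replicate (m - j) (lam e f z)) *
    symb m j (e + z *\<^sub>V f) f \<beta>s)"
  by (rule Sym_eq_frameI[OF assms(2) Sym_sum[OF symb_Sym] assms(1), where z = z])
    (simp add: symb_frame[OF assms(1)] if_distrib cong: if_cong)

text \<open>
  The Taylor expansion at \<open>z\<close> of the section of \<open>L\<^sup>m\<close> given by \<open>S\<close>, in the coordinate \<open>w\<close>. Its
  coefficients are, up to nonzero factors, the values of \<open>S\<close> on words in \<open>ecf e f\<close> and \<open>lam e f z\<close>. This
  identity links jets to the contractions of \<open>S\<close> with \<open>lam e f z\<close>.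
\<close>

lemma Sym_lam_expand:
  assumes "frame e f" "S \<in> Sym m"
  shows "S (replicate m (lam e f w)) = (\<Sum>j\<le>m. (- 1) ^ j * of_nat (m choose j) *
    S (replicate j (ecf e f) @ replicate (m - j) (lam e f z)) * (w - z) ^ j)"
proof -
  have "S (replicate m (lam e f w)) =
      (\<Sum>j\<le>m. S (replicate j (ecf e f) @ replicate (m - j) (lam e f z)) * (of_nat (m choose j) * (z - w) ^ j))"
    by (subst Sym_expand[OF assms, of z]) (simp add: symb_lam[OF assms(1)])
  also have "\<dots> = (\<Sum>j\<le>m. (- 1) ^ j * of_nat (m choose j) *
    S (replicate j (ecf e f) @ replicate (m - j) (lam e f z)) * (w - z) ^ j)"
  proof (intro sum.cong refl)
    fix j
    have "(z - w) ^ j = (- 1) ^ j * (w - z) ^ j"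
      by (simp flip: power_mult_distrib)
    then show "S (replicate j (ecf e f) @ replicate (m - j) (lam e f z)) * (of_nat (m choose j) * (z - w) ^ j) =
      (- 1) ^ j * of_nat (m choose j) * S (replicate j (ecf e f) @ replicate (m - j) (lam e f z)) * (w - z) ^ j"
      by simp
  qed
  finally show ?thesis .
qed

section \<open>Mixed tensors in a frame\<close>

lemma prod_nth_eq_prod_list:
  fixes h :: "'x \<Rightarrow> complex"
  shows "(\<Prod>i<length xs. h (xs ! i)) = prod_list (map h xs)"
  by (induction xs) (simp_all add: prod.lessThan_Suc_shift del: prod.lessThan_Suc)

text \<open>
  The trivialization of \<open>L\<^sup>a\<close> by the \<open>a\<close>-th power of the class of \<open>f\<close>, tensored with the identity.
\<close>

definition qframe :: "'v \<Rightarrow> 'v \<Rightarrow> nat \<Rightarrow> complex \<Rightarrow> 'v tensor \<Rightarrow> 'v mixed" where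
  "qframe e f a z = pure_mixed (chart e f z) (replicate a (quot (chart e f z) f))"

lemma qframe_eq:
  "qframe e f a z S = (\<lambda>\<alpha>s \<beta>s. if length \<alpha>s = a \<and> set \<alpha>s \<subseteq> quot_forms (chart e f z)
     then prod_list (map (\<lambda>\<alpha>. \<alpha> (quot (chart e f z) f)) \<alpha>s) * S \<beta>s else 0)"
proof -
  have "(\<Prod>i<length \<alpha>s. (\<alpha>s ! i) (replicate (length \<alpha>s) x ! i)) = prod_list (map (\<lambda>\<alpha>. \<alpha> x) \<alpha>s)"
    for \<alpha>s :: "('v set \<Rightarrow> complex) list" and x
    by (simp flip: prod_nth_eq_prod_list)
  then show ?thesis
    unfolding qframe_def pure_mixed_def by (intro ext) auto
qed

lemma qframe_eval:
  "frame e f \<Longrightarrow> qframe e f a z S (replicate a (qlam e f z)) = S"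
  using qlam_quot_forms[of e f z]
  by (auto simp: qframe_eq prod_list_replicate qlam_quot lam_simps set_replicate_conv_if)

text \<open>
  In the trivialization given by a frame, quotienting the first \<open>a\<close> factors is contraction with \<open>a\<close>
  copies of \<open>lam e f z\<close>, by multilinearity and because forms on the quotient are multiples of one form.
\<close>

lemma qmap_eq_qframe:
  assumes fr: "frame e f" and T: "T \<in> tensors (a + b)"
  shows "qmap a (chart e f z) T = qframe e f a z (\<lambda>\<beta>s. T (replicate a (lam e f z) @ \<beta>s))"
proof (intro ext)
  fix \<alpha>s \<beta>s
  let ?q = "quot (chart e f z)"
  note ml = T[unfolded tensors_iff_multilinear]
  define Q :: "('v set \<Rightarrow> complex) \<Rightarrow> 'v \<Rightarrow> complex" where "Q = (\<lambda>\<alpha>. \<alpha> \<circ> ?q)"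
  have *: "T (xs @ map Q as @ ys) =
      prod_list (map (\<lambda>\<alpha>. \<alpha> (?q f)) as) * T (xs @ replicate (length as) (lam e f z) @ ys)"
    if "set as \<subseteq> quot_forms (chart e f z)" for xs as ys
    using that
  proof (induction as arbitrary: xs)
    case (Cons \<alpha> as)
    have "Q \<alpha> = (\<lambda>v. \<alpha> (?q f) * lam e f z v)"
      unfolding Q_def using Cons.prems by (intro quot_form_eq[OF fr]) simp
    then have "T (xs @ map Q (\<alpha> # as) @ ys) =
        \<alpha> (?q f) * T ((xs @ [lam e f z]) @ map Q as @ ys)"
      using multilinear_scale[OF ml lam_forms[OF fr], of xs "\<alpha> (?q f)"] by simp
    also have "\<dots> = \<alpha> (?q f) * (prod_list (map (\<lambda>\<alpha>. \<alpha> (?q f)) as) *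
        T ((xs @ [lam e f z]) @ replicate (length as) (lam e f z) @ ys))"
      by (subst Cons.IH) (use Cons.prems in auto)
    finally show ?case
      by simp
  qed simp
  show "qmap a (chart e f z) T \<alpha>s \<beta>s = qframe e f a z (\<lambda>\<beta>s. T (replicate a (lam e f z) @ \<beta>s)) \<alpha>s \<beta>s"
  proof (cases "length \<alpha>s = a \<and> set \<alpha>s \<subseteq> quot_forms (chart e f z)")
    case True
    then show ?thesis
      using *[of \<alpha>s "[]" \<beta>s] by (simp add: qmap_def qframe_eq Q_def)
  next
    case False
    have "T (map (\<lambda>\<alpha>. \<alpha> \<circ> ?q) \<alpha>s @ \<beta>s) = 0" if "length \<alpha>s = a"
      by (rule multilinear_outside[OF ml]) (use that False in \<open>auto simp: quot_forms_def\<close>)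
    then show ?thesis
      using False by (auto simp: qmap_def qframe_eq)
  qed
qed

lemma qmap_eval:
  assumes "frame e f" "T \<in> tensors (a + b)"
  shows "qmap a (chart e f z) T (replicate a (qlam e f z)) \<beta>s = T (replicate a (lam e f z) @ \<beta>s)"
  using assms by (simp add: qmap_eq_qframe qframe_eval)

lemma qframe_LSym: "S \<in> Sym b \<Longrightarrow> qframe e f a z S \<in> LSym (chart e f z) a b"
  unfolding LSym_def qframe_def
  by (intro CollectI exI[of _ 1] exI[of _ "\<lambda>_. 1"] exI[of _ "\<lambda>_. replicate a (quot (chart e f z) f)"]
      exI[of _ "\<lambda>_. S"]) auto

lemma LSym_eq_qframe:
  assumes fr: "frame e f" and X: "X \<in> LSym (chart e f z) a b"
  shows "X = qframe e f a z (X (replicate a (qlam e f z)))" "X (replicate a (qlam e f z)) \<in> Sym b"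
proof -
  let ?\<xi> = "chart e f z"
  let ?al = "replicate a (qlam e f z)"
  obtain N c xs S where "\<forall>j<(N::nat). length (xs j) = a \<and> set (xs j) \<subseteq> range (quot ?\<xi>) \<and> S j \<in> Sym b"
    and X: "X = (\<lambda>\<alpha>s \<beta>s. \<Sum>j<N. c j * pure_mixed ?\<xi> (xs j) (S j) \<alpha>s \<beta>s)"
    using X unfolding LSym_def by blast
  then have N: "length (xs j) = a" "set (xs j) \<subseteq> range (quot ?\<xi>)" "S j \<in> Sym b" if "j < N" for j
    using that by auto
  have pm: "pure_mixed ?\<xi> (xs j) (S j) = qframe e f a z (\<lambda>\<beta>s. (\<Prod>i<a. qlam e f z (xs j ! i)) * S j \<beta>s)"
    if j: "j < N" for j
  proof (intro ext)
    fix \<alpha>s \<beta>s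
    show "pure_mixed ?\<xi> (xs j) (S j) \<alpha>s \<beta>s =
        qframe e f a z (\<lambda>\<beta>s. (\<Prod>i<a. qlam e f z (xs j ! i)) * S j \<beta>s) \<alpha>s \<beta>s"
    proof (cases "length \<alpha>s = a \<and> set \<alpha>s \<subseteq> quot_forms ?\<xi>")
      case True
      have "(\<alpha>s ! i) (xs j ! i) = (\<alpha>s ! i) (quot ?\<xi> f) * qlam e f z (xs j ! i)" if i: "i < a" for i
      proof -
        obtain v where v: "xs j ! i = quot ?\<xi> v"
          using N(1,2)[OF j] i by (metis imageE nth_mem subsetD)
        have "\<alpha>s ! i \<in> quot_forms ?\<xi>"
          using True i nth_mem by blast
        from quot_form_eq[OF fr this] have "(\<alpha>s ! i) (quot ?\<xi> v) = (\<alpha>s ! i) (quot ?\<xi> f) * lam e f z v"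
          by (metis comp_apply)
        then show ?thesis
          by (simp add: v qlam_quot[OF fr])
      qed
      then have "(\<Prod>i<a. (\<alpha>s ! i) (xs j ! i)) =
          (\<Prod>i<a. (\<alpha>s ! i) (quot ?\<xi> f)) * (\<Prod>i<a. qlam e f z (xs j ! i))"
        by (simp flip: prod.distrib)
      moreover have "(\<Prod>i<a. (\<alpha>s ! i) (quot ?\<xi> f)) = prod_list (map (\<lambda>\<alpha>. \<alpha> (quot ?\<xi> f)) \<alpha>s)"
        using True by (simp flip: prod_nth_eq_prod_list)
      ultimately show ?thesis
        using True N[OF j] by (simp add: pure_mixed_def qframe_eq)
    qed (use N[OF j] in \<open>auto simp: pure_mixed_def qframe_eq\<close>)
  qed
  define S' where "S' \<beta>s = (\<Sum>j<N. (c j * (\<Prod>i<a. qlam e f z (xs j ! i))) * S j \<beta>s)" for \<beta>s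
  have "S' \<in> Sym b"
    unfolding S'_def by (rule Sym_sum) (use N in auto)
  have "X = qframe e f a z S'"
  proof (intro ext)
    fix \<alpha>s \<beta>s
    have "X \<alpha>s \<beta>s = (\<Sum>j<N. c j * qframe e f a z (\<lambda>\<beta>s. (\<Prod>i<a. qlam e f z (xs j ! i)) * S j \<beta>s) \<alpha>s \<beta>s)"
      by (simp add: X pm)
    also have "\<dots> = qframe e f a z S' \<alpha>s \<beta>s"
      by (cases "length \<alpha>s = a \<and> set \<alpha>s \<subseteq> quot_forms ?\<xi>")
        (simp_all only: simp_thms qframe_eq if_True if_False S'_def sum_distrib_left mult_zero_right sum.neutral_const
          mult.assoc mult.left_commute)
    finally show "X \<alpha>s \<beta>s = qframe e f a z S' \<alpha>s \<beta>s" .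
  qed
  then have "X ?al = S'"
    by (simp add: qframe_eval[OF fr])
  then show "X = qframe e f a z (X ?al)" "X ?al \<in> Sym b"
    using \<open>X = qframe e f a z S'\<close> \<open>S' \<in> Sym b\<close> by simp_all
qed

section \<open>Local sections of the pulled back line bundle\<close>

lemma hol_subset:
  assumes "hol g U" "U' \<subseteq> U"
  shows "hol g U'"
  unfolding hol_def
proof (intro allI impI)
  fix e f assume "frame e f"
  then have "(\<lambda>z. g (chart e f z)) holomorphic_on {z. chart e f z \<in> U}"
    using assms(1) by (simp add: hol_def)
  then show "(\<lambda>z. g (chart e f z)) holomorphic_on {z. chart e f z \<in> U'}"
    by (rule holomorphic_on_subset) (use assms(2) in auto)
qed

lemma hol_cong:
  assumes "hol g U" "\<And>\<xi>. \<xi> \<in> U \<Longrightarrow> g \<xi> = h \<xi>"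
  shows "hol h U"
  unfolding hol_def
proof (intro allI impI)
  fix e f assume "frame e f"
  then have "(\<lambda>z. g (chart e f z)) holomorphic_on {z. chart e f z \<in> U}"
    using assms(1) by (simp add: hol_def)
  then show "(\<lambda>z. h (chart e f z)) holomorphic_on {z. chart e f z \<in> U}"
    by (rule holomorphic_transform) (simp add: assms(2))
qed

lemma hol_add: "hol g U \<Longrightarrow> hol h U \<Longrightarrow> hol (\<lambda>\<xi>. g \<xi> + h \<xi>) U"
  and hol_mult: "hol g U \<Longrightarrow> hol h U \<Longrightarrow> hol (\<lambda>\<xi>. g \<xi> * h \<xi>) U"
  unfolding hol_def by (auto intro!: holomorphic_intros)

lemma hol2_mult: "hol2 g \<Omega> \<Longrightarrow> hol2 h \<Omega> \<Longrightarrow> hol2 (\<lambda>r. g r * h r) \<Omega>"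
  unfolding hol2_def case_prod_beta' by (auto intro!: holomorphic2_on_mult)

lemma hol2_const: "openin lines2_top \<Omega> \<Longrightarrow> hol2 (\<lambda>r. c) \<Omega>"
  unfolding hol2_def using open_charts_preimage
  by (auto simp: case_prod_beta' intro!: holomorphic2_on_const)

lemma hol2_fst:
  assumes "hol g U" "openin lines2_top \<Omega>" "fst ` \<Omega> \<subseteq> U"
  shows "hol2 (\<lambda>r. g (fst r)) \<Omega>"
  unfolding hol2_def case_prod_beta' fst_conv
proof (intro allI impI)
  fix e f e' f' assume fr: "frame e f" "frame e' f'"
  show "holomorphic2_on (\<lambda>p. g (chart e f (fst p))) {p. (chart e f (fst p), chart e' f' (snd p)) \<in> \<Omega>}"
  proof (rule holomorphic2_on_fst)
    show "(\<lambda>z. g (chart e f z)) holomorphic_on {z. chart e f z \<in> U}"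
      using assms(1) fr by (simp add: hol_def)
    show "open {p. (chart e f (fst p), chart e' f' (snd p)) \<in> \<Omega>}"
      using open_charts_preimage[OF assms(2) fr] by (simp add: case_prod_beta')
  qed (use assms(3) in force)
qed

lemma openin_times_lines: "openin lines_top U \<Longrightarrow> openin lines2_top (U \<times> lines)"
  unfolding lines2_top_def using openin_topspace[of lines_top]
  by (simp add: openin_prod_Times_iff topspace_lines_top)

lemma pullback_secE:
  assumes "pullback_sec n \<Omega> F" "p \<in> \<Omega>"
  obtains \<Omega>' t where "openin lines2_top \<Omega>'" "p \<in> \<Omega>'" "\<Omega>' \<subseteq> \<Omega>" "\<And>r. r \<in> \<Omega>' \<Longrightarrow> t r \<in> tensors n"
    "\<And>\<beta>s. hol2 (\<lambda>r. t r \<beta>s) \<Omega>'" "\<And>r. r \<in> \<Omega>' \<Longrightarrow> F r = qmap n (snd r) (t r)"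
proof -
  obtain \<Omega>' t where "openin lines2_top \<Omega>' \<and> p \<in> \<Omega>' \<and> \<Omega>' \<subseteq> \<Omega> \<and> (\<forall>r\<in>\<Omega>'. t r \<in> tensors n) \<and>
      (\<forall>\<beta>s. hol2 (\<lambda>r. t r \<beta>s) \<Omega>') \<and> (\<forall>r\<in>\<Omega>'. F r = qmap n (snd r) (t r))"
    using bspec[OF assms(1)[unfolded pullback_sec_def] assms(2)] by (elim exE)
  then show thesis
    by (intro that[of \<Omega>' t]) simp_all
qed

lemma pullback_secI:
  assumes "\<And>p. p \<in> \<Omega> \<Longrightarrow> \<exists>\<Omega>' t. openin lines2_top \<Omega>' \<and> p \<in> \<Omega>' \<and> \<Omega>' \<subseteq> \<Omega> \<and>
    (\<forall>r\<in>\<Omega>'. t r \<in> tensors n) \<and> (\<forall>\<beta>s. hol2 (\<lambda>r. t r \<beta>s) \<Omega>') \<and> (\<forall>r\<in>\<Omega>'. F r = qmap n (snd r) (t r))"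
  shows "pullback_sec n \<Omega> F"
  unfolding pullback_sec_def using assms by (intro ballI)

text \<open>
  The element of \<open>L\<^sup>n\<close> at the line with coordinate \<open>w\<close> whose coordinate is \<open>c\<close>.
\<close>

definition Lvec :: "'v \<Rightarrow> 'v \<Rightarrow> nat \<Rightarrow> complex \<Rightarrow> complex \<Rightarrow> 'v mixed" where
  "Lvec e f n w c = qframe e f n w (\<lambda>\<beta>s. if \<beta>s = [] then c else 0)"

lemma Lvec_add: "(\<lambda>\<alpha>s \<beta>s. Lvec e f n w c \<alpha>s \<beta>s + Lvec e f n w d \<alpha>s \<beta>s) = Lvec e f n w (c + d)"
  and Lvec_diff: "(\<lambda>\<alpha>s \<beta>s. Lvec e f n w c \<alpha>s \<beta>s - Lvec e f n w d \<alpha>s \<beta>s) = Lvec e f n w (c - d)"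
  and Lvec_mult: "(\<lambda>\<alpha>s \<beta>s. a * Lvec e f n w c \<alpha>s \<beta>s) = Lvec e f n w (a * c)"
  by (auto simp: Lvec_def qframe_eq fun_eq_iff algebra_simps)

lemma Lvec_inj:
  assumes "frame e f"
  shows "Lvec e f n w c = Lvec e f n w d \<longleftrightarrow> c = d"
proof -
  have "Lvec e f n w c (replicate n (qlam e f w)) [] = c" for c
    by (simp add: Lvec_def qframe_eval[OF assms])
  then show ?thesis
    by metis
qed

lemma qmap_eq_Lvec:
  assumes "frame e f" "T \<in> tensors n"
  shows "qmap n (chart e f w) T = Lvec e f n w (T (replicate n (lam e f w)))"
proof -
  have "T (replicate n (lam e f w) @ \<beta>s) = 0" if "\<beta>s \<noteq> []" for \<beta>s
    using assms(2) that by (intro multilinear_outside[of n]) (auto simp: tensors_iff_multilinear)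
  then have "(\<lambda>\<beta>s. T (replicate n (lam e f w) @ \<beta>s)) =
      (\<lambda>\<beta>s. if \<beta>s = [] then T (replicate n (lam e f w)) else 0)"
    by auto
  then show ?thesis
    using qmap_eq_qframe[OF assms(1), of T n 0] assms(2) by (simp add: Lvec_def)
qed

definition Lcoord :: "'v \<Rightarrow> 'v \<Rightarrow> nat \<Rightarrow> ('v set \<times> 'v set \<Rightarrow> 'v mixed) \<Rightarrow> complex \<times> complex \<Rightarrow> complex" where
  "Lcoord e f n F p = F (chart2 e f p) (replicate n (qlam e f (snd p))) []"

lemma Lcoord_eq: "frame e f \<Longrightarrow> F (chart2 e f p) = Lvec e f n (snd p) c \<Longrightarrow> Lcoord e f n F p = c"
  by (simp add: Lcoord_def Lvec_def qframe_eval)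

text \<open>
  In a chart, sections of \<open>L\<^sup>n\<close> pulled back along the second projection correspond to
  holomorphic functions of two variables; this is the passage from a section to its function.
\<close>

lemma pullback_chart:
  assumes fr: "frame e f" and F: "pullback_sec n \<Omega> F" and \<Omega>: "openin lines2_top \<Omega>"
  shows "holomorphic2_on (Lcoord e f n F) (chart2 e f -` \<Omega>)"
    "chart2 e f p \<in> \<Omega> \<Longrightarrow> F (chart2 e f p) = Lvec e f n (snd p) (Lcoord e f n F p)"
proof -
  have key: "\<exists>T. p \<in> T \<and> T \<subseteq> chart2 e f -` \<Omega> \<and> holomorphic2_on (Lcoord e f n F) T \<and>
      (\<forall>q\<in>T. F (chart2 e f q) = Lvec e f n (snd q) (Lcoord e f n F q))" if p: "chart2 e f p \<in> \<Omega>" for p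
  proof -
  obtain \<Omega>1 t where 1: "openin lines2_top \<Omega>1" "chart2 e f p \<in> \<Omega>1" "\<Omega>1 \<subseteq> \<Omega>" "\<And>r. r \<in> \<Omega>1 \<Longrightarrow> t r \<in> tensors n"
    "\<And>\<beta>s. hol2 (\<lambda>r. t r \<beta>s) \<Omega>1" "\<And>r. r \<in> \<Omega>1 \<Longrightarrow> F r = qmap n (snd r) (t r)"
    using pullback_secE[OF F p] by metis
    define T where "T = chart2 e f -` \<Omega>1"
    have op: "open T"
      unfolding T_def using open_chart2_preimage[OF 1(1) fr] .
    have Fq: "F (chart2 e f q) = Lvec e f n (snd q) (t (chart2 e f q) (replicate n (lam e f (snd q))))"
      if "q \<in> T" for q
      using 1(4,6)[of "chart2 e f q"] that qmap_eq_Lvec[OF fr, of "t (chart2 e f q)" n "snd q"]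
      by (simp add: T_def chart2_def)
    have "holomorphic2_on (\<lambda>q. t (chart2 e f q) ([] @ map (\<lambda>(p, r) v. p v + - (snd q) * r v)
        (replicate n (fcf e f, ecf e f)))) T"
    proof (rule multilinear_affine_forms[where P = "\<lambda>g. holomorphic2_on g T" and A = T and u = snd])
      show "multilinear n (t (chart2 e f x))" if "x \<in> T" for x
        using 1(4) that by (simp add: T_def flip: tensors_iff_multilinear)
      show "holomorphic2_on (\<lambda>x. t (chart2 e f x) \<beta>s) T" for \<beta>s
        using hol2_chart2[OF 1(5) fr] by (simp add: T_def)
      have snd: "holomorphic2_on snd T"
        using holomorphic2_on_snd[of "\<lambda>x. x" UNIV T] op by simp
      then have "holomorphic2_on (\<lambda>x. - snd x) T"
        using holomorphic2_on_mult[OF holomorphic2_on_const[OF op, of "- 1"] snd] by simp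
      then show "holomorphic2_on (\<lambda>x. g x + - snd x * h x) T"
        if "holomorphic2_on g T" "holomorphic2_on h T" for g h
        using that by (intro holomorphic2_on_add holomorphic2_on_mult)
    qed (use fr ecf_forms fcf_forms holomorphic2_on_cong in \<open>auto split: if_splits\<close>)
    then have t_hol: "holomorphic2_on (\<lambda>q. t (chart2 e f q) (replicate n (lam e f (snd q)))) T"
      by (simp add: lam_def[abs_def])
    have L: "Lcoord e f n F q = t (chart2 e f q) (replicate n (lam e f (snd q)))" if "q \<in> T" for q
      by (rule Lcoord_eq[where F = F, OF fr]) (rule Fq[OF that])
    have "holomorphic2_on (Lcoord e f n F) T"
      by (rule holomorphic2_on_cong[OF t_hol]) (simp add: L)
    moreover have "F (chart2 e f q) = Lvec e f n (snd q) (Lcoord e f n F q)" if "q \<in> T" for q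
      unfolding L[OF that] by (rule Fq[OF that])
    moreover have "p \<in> T" "T \<subseteq> chart2 e f -` \<Omega>"
      using 1(2,3) by (auto simp: T_def)
    ultimately show ?thesis
      by (intro exI[of _ T]) simp
  qed
  show "holomorphic2_on (Lcoord e f n F) (chart2 e f -` \<Omega>)"
  proof (rule holomorphic2_on_local)
    fix p assume "p \<in> chart2 e f -` \<Omega>"
    then obtain T where "p \<in> T" "T \<subseteq> chart2 e f -` \<Omega>" "holomorphic2_on (Lcoord e f n F) T"
      using key[of p] by auto
    then show "\<exists>T. p \<in> T \<and> T \<subseteq> chart2 e f -` \<Omega> \<and> holomorphic2_on (Lcoord e f n F) T"
      by (intro exI[of _ T]) simp
  qed
  show "chart2 e f p \<in> \<Omega> \<Longrightarrow> F (chart2 e f p) = Lvec e f n (snd p) (Lcoord e f n F p)"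
    using key[of p] by auto
qed

text \<open>
  The holomorphic lift is \<open>\<phi>\<close> times the \<open>n\<close>-th tensor power of \<open>f\<close>, on which \<open>lam e f w\<close> evaluates
  to \<open>1\<close>.
\<close>

lemma chart_pullback:
  assumes fr: "frame e f" and \<phi>: "holomorphic2_on \<phi> W"
    and F: "\<And>p. p \<in> W \<Longrightarrow> F (chart2 e f p) = Lvec e f n (snd p) (\<phi> p)"
  shows "pullback_sec n (chart2 e f ` W) F"
proof -
  define \<Omega> where "\<Omega> = chart2 e f ` W"
  have op: "openin lines2_top \<Omega>"
    unfolding \<Omega>_def using \<phi> by (intro openin_chart2_image fr) (simp add: holomorphic2_on_def)
  have pre: "chart2 e f -` \<Omega> = W"
    unfolding \<Omega>_def by (simp add: inj_vimage_image_eq inj_chart2 fr)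
  define c where "c = inv (chart2 e f)"
  have c: "c (chart2 e f p) = p" for p
    unfolding c_def by (simp add: inj_chart2 fr)
  have hc: "hol2 (\<lambda>r. \<phi> (c r)) \<Omega>"
  proof (rule hol2_chartI[OF fr op])
    show "\<Omega> \<subseteq> range (chart2 e f)"
      by (auto simp: \<Omega>_def)
    show "holomorphic2_on (\<lambda>p. \<phi> (c (chart2 e f p))) (chart2 e f -` \<Omega>)"
      unfolding pre c using \<phi> by simp
  qed
  define t where "t r = (\<lambda>\<beta>s. \<phi> (c r) * pure (replicate n f) \<beta>s)" for r
  have t: "t r \<in> tensors n" for r
    using tensors_scale[OF tensors_pure[of "replicate n f"]] by (simp add: t_def)
  have pf: "pure (replicate n f) (replicate n (lam e f w)) = 1" for w
    by (induction n) (simp_all add: pure_simps lam_simps[OF fr] lam_forms[OF fr])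
  have "F r = qmap n (snd r) (t r)" if r: "r \<in> \<Omega>" for r
  proof -
    obtain p where p: "p \<in> W" "r = chart2 e f p"
      using r unfolding \<Omega>_def by blast
    then show ?thesis
      using F[OF p(1)] qmap_eq_Lvec[OF fr t, of "snd p" r] by (simp add: t_def pf c) (simp add: chart2_def)
  qed
  moreover have "hol2 (\<lambda>r. t r \<beta>s) \<Omega>" for \<beta>s
    unfolding t_def by (intro hol2_mult hc hol2_const op)
  ultimately show ?thesis
    unfolding pullback_sec_def \<Omega>_def[symmetric] using op t by (intro ballI exI[of _ \<Omega>] exI[of _ t]) simp
qed

lemma holomorphic2_on_diagonal_equation: "open W \<Longrightarrow> holomorphic2_on (\<lambda>q. snd q - fst q) W"
  using holomorphic2_on_fst[of "\<lambda>x. x" UNIV W] holomorphic2_on_snd[of "\<lambda>x. x" UNIV W]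
  by (intro holomorphic2_on_diff) auto

text \<open>
  All local equations of the diagonal are multiples of \<open>w - z\<close> by division, so the arbitrary function
  in the definition can be replaced by this one. Hence the sections that vanish to order \<open>m\<close> along the
  diagonal are closed under addition.
\<close>

lemma in_diag_power_iff:
  assumes fr: "frame e f"
  shows "in_diag_power n m F (chart2 e f p) \<longleftrightarrow>
    (\<exists>W \<psi>. p \<in> W \<and> holomorphic2_on \<psi> W \<and>
       (\<forall>q\<in>W. F (chart2 e f q) = Lvec e f n (snd q) ((snd q - fst q) ^ m * \<psi> q)))"
proof
  assume "in_diag_power n m F (chart2 e f p)"
  then obtain \<Omega> g H where *: "openin lines2_top \<Omega>" "chart2 e f p \<in> \<Omega>" "hol2 g \<Omega>"
    "\<And>\<xi>. (\<xi>, \<xi>) \<in> \<Omega> \<Longrightarrow> g (\<xi>, \<xi>) = 0" "pullback_sec n \<Omega> H"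
    "\<And>r. r \<in> \<Omega> \<Longrightarrow> F r = (\<lambda>\<alpha>s \<beta>s. g r ^ m * H r \<alpha>s \<beta>s)"
    unfolding in_diag_power_def by blast
  define W where "W = chart2 e f -` \<Omega>"
  obtain h where h: "holomorphic2_on h W" "\<And>z w. (z, w) \<in> W \<Longrightarrow> g (chart2 e f (z, w)) = (w - z) * h (z, w)"
    using diagonal_division[OF hol2_chart2[OF *(3) fr]] *(4) unfolding W_def
    by (metis (no_types, lifting) chart2_def fst_conv snd_conv vimageE)
  have "F (chart2 e f q) = Lvec e f n (snd q) ((snd q - fst q) ^ m * (h q ^ m * Lcoord e f n H q))"
    if "q \<in> W" for q
  proof -
    have "H (chart2 e f q) = Lvec e f n (snd q) (Lcoord e f n H q)"
      using pullback_chart(2)[OF fr *(5) *(1)] that by (simp add: W_def)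
    moreover have "g (chart2 e f q) = (snd q - fst q) * h q"
      using h(2)[of "fst q" "snd q"] that by simp
    ultimately show ?thesis
      using *(6)[of "chart2 e f q"] that
      by (simp add: W_def Lvec_mult[symmetric] power_mult_distrib mult.assoc)
  qed
  moreover have "holomorphic2_on (\<lambda>q. h q ^ m * Lcoord e f n H q) W"
    using pullback_chart(1)[OF fr *(5) *(1)] h(1) unfolding W_def[symmetric]
    by (intro holomorphic2_on_mult holomorphic2_on_power)
  moreover have "p \<in> W"
    using *(2) by (simp add: W_def)
  ultimately show "\<exists>W \<psi>. p \<in> W \<and> holomorphic2_on \<psi> W \<and>
       (\<forall>q\<in>W. F (chart2 e f q) = Lvec e f n (snd q) ((snd q - fst q) ^ m * \<psi> q))"
    by (intro exI[of _ W] exI[of _ "\<lambda>q. h q ^ m * Lcoord e f n H q"]) simp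
next
  assume "\<exists>W \<psi>. p \<in> W \<and> holomorphic2_on \<psi> W \<and>
       (\<forall>q\<in>W. F (chart2 e f q) = Lvec e f n (snd q) ((snd q - fst q) ^ m * \<psi> q))"
  then obtain W \<psi> where *: "p \<in> W" "holomorphic2_on \<psi> W"
    "\<And>q. q \<in> W \<Longrightarrow> F (chart2 e f q) = Lvec e f n (snd q) ((snd q - fst q) ^ m * \<psi> q)"
    by blast
  have opW: "open W"
    using *(2) by (simp add: holomorphic2_on_def)
  define \<Omega> where "\<Omega> = chart2 e f ` W"
  have op: "openin lines2_top \<Omega>"
    unfolding \<Omega>_def by (intro openin_chart2_image fr opW)
  have pre: "chart2 e f -` \<Omega> = W"
    unfolding \<Omega>_def by (simp add: inj_vimage_image_eq inj_chart2 fr)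
  define c where "c = inv (chart2 e f)"
  have c: "c (chart2 e f p) = p" for p
    unfolding c_def by (simp add: inj_chart2 fr)
  have "holomorphic2_on (\<lambda>p. snd p - fst p) W"
    by (rule holomorphic2_on_diagonal_equation[OF opW])
  then have "holomorphic2_on (\<lambda>p. snd (c (chart2 e f p)) - fst (c (chart2 e f p))) (chart2 e f -` \<Omega>)"
    unfolding pre c .
  then have g: "hol2 (\<lambda>r. snd (c r) - fst (c r)) \<Omega>"
    by (rule hol2_chartI[OF fr op, rotated]) (auto simp: \<Omega>_def)
  have g0: "snd (c (\<xi>, \<xi>)) - fst (c (\<xi>, \<xi>)) = 0" if \<xi>: "(\<xi>, \<xi>) \<in> \<Omega>" for \<xi>
  proof -
    obtain q where "(\<xi>, \<xi>) = chart2 e f q"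
      using \<xi> unfolding \<Omega>_def by blast
    then show ?thesis
      using c[of q] chart_inj[OF fr, of "fst q" "snd q"] by (auto simp: chart2_def)
  qed
  define H where "H r = Lvec e f n (snd (c r)) (\<psi> (c r))" for r
  have H: "pullback_sec n \<Omega> H"
    unfolding \<Omega>_def by (rule chart_pullback[OF fr *(2)]) (simp add: H_def c)
  have "F r = (\<lambda>\<alpha>s \<beta>s. (snd (c r) - fst (c r)) ^ m * H r \<alpha>s \<beta>s)" if "r \<in> \<Omega>" for r
    using that *(3) by (auto simp: \<Omega>_def H_def c Lvec_mult)
  then show "in_diag_power n m F (chart2 e f p)"
    unfolding in_diag_power_def using op g g0 H *(1)
    by (intro exI[of _ \<Omega>] exI[of _ "\<lambda>r. snd (c r) - fst (c r)"] exI[of _ H]) (simp add: \<Omega>_def)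
qed

section \<open>Stalks of the jet sheaf\<close>

text \<open>
  The case \<open>m = 0\<close> expresses that \<open>F\<close> is a section near \<open>p\<close>.
\<close>

abbreviation germ_at :: "nat \<Rightarrow> ('v set \<times> 'v set \<Rightarrow> 'v mixed) \<Rightarrow> 'v set \<times> 'v set \<Rightarrow> bool" where
  "germ_at n \<equiv> in_diag_power n 0"

lemma germ_at_iff: "germ_at n F p \<longleftrightarrow> (\<exists>\<Omega>. openin lines2_top \<Omega> \<and> p \<in> \<Omega> \<and> pullback_sec n \<Omega> F)"
proof
  assume "germ_at n F p"
  then obtain \<Omega> H where *: "openin lines2_top \<Omega>" "p \<in> \<Omega>" "pullback_sec n \<Omega> H" "\<And>r. r \<in> \<Omega> \<Longrightarrow> F r = H r"
    unfolding in_diag_power_def by auto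
  have "pullback_sec n \<Omega> F"
  proof (rule pullback_secI)
    fix q assume "q \<in> \<Omega>"
    then obtain \<Omega>' t where "openin lines2_top \<Omega>'" "q \<in> \<Omega>'" "\<Omega>' \<subseteq> \<Omega>" "\<And>r. r \<in> \<Omega>' \<Longrightarrow> t r \<in> tensors n"
      "\<And>\<beta>s. hol2 (\<lambda>r. t r \<beta>s) \<Omega>'" "\<And>r. r \<in> \<Omega>' \<Longrightarrow> H r = qmap n (snd r) (t r)"
      using pullback_secE[OF *(3)] by metis
    then show "\<exists>\<Omega>' t. openin lines2_top \<Omega>' \<and> q \<in> \<Omega>' \<and> \<Omega>' \<subseteq> \<Omega> \<and> (\<forall>r\<in>\<Omega>'. t r \<in> tensors n) \<and>
        (\<forall>\<beta>s. hol2 (\<lambda>r. t r \<beta>s) \<Omega>') \<and> (\<forall>r\<in>\<Omega>'. F r = qmap n (snd r) (t r))"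
      using *(4) by (intro exI[of _ \<Omega>'] exI[of _ t]) (simp add: subsetD)
  qed
  then show "\<exists>\<Omega>. openin lines2_top \<Omega> \<and> p \<in> \<Omega> \<and> pullback_sec n \<Omega> F"
    using * by blast
next
  assume "\<exists>\<Omega>. openin lines2_top \<Omega> \<and> p \<in> \<Omega> \<and> pullback_sec n \<Omega> F"
  then obtain \<Omega> where "openin lines2_top \<Omega>" "p \<in> \<Omega>" "pullback_sec n \<Omega> F"
    by blast
  then show "germ_at n F p"
    unfolding in_diag_power_def
    by (intro exI[of _ \<Omega>] exI[of _ "\<lambda>r. 0"] exI[of _ F]) (simp add: hol2_const)
qed

definition hol2_at :: "('v set \<times> 'v set \<Rightarrow> complex) \<Rightarrow> 'v set \<times> 'v set \<Rightarrow> bool" where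
  "hol2_at g p \<longleftrightarrow> (\<exists>\<Omega>. openin lines2_top \<Omega> \<and> p \<in> \<Omega> \<and> hol2 g \<Omega>)"

lemma hol2_at_const: "p \<in> lines \<times> lines \<Longrightarrow> hol2_at (\<lambda>r. c) p"
  unfolding hol2_at_def using hol2_const[of "lines \<times> lines"] openin_topspace[of lines2_top]
  by (auto simp: topspace_lines2)

lemma in_diag_power_chartE:
  assumes "in_diag_power n m F p"
  obtains e f q W \<psi> where "frame e f" "p = chart2 e f q" "q \<in> W" "open W" "holomorphic2_on \<psi> W"
    "\<And>q. q \<in> W \<Longrightarrow> F (chart2 e f q) = Lvec e f n (snd q) ((snd q - fst q) ^ m * \<psi> q)"
proof -
  have "p \<in> lines \<times> lines"
    using assms openin_subset topspace_lines2 unfolding in_diag_power_def by blast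
  then obtain e f q where "frame e f" "p = chart2 e f q"
    by (rule lines2_chart2)
  then show thesis
    using assms that in_diag_power_iff holomorphic2_on_separately(1) by metis
qed

lemma in_diag_power_lines: "in_diag_power n m F p \<Longrightarrow> p \<in> lines \<times> lines"
  unfolding in_diag_power_def using openin_subset topspace_lines2 by blast

lemma in_diag_power_add:
  assumes "in_diag_power n m F p" "in_diag_power n m H p"
  shows "in_diag_power n m (\<lambda>r \<alpha>s \<beta>s. F r \<alpha>s \<beta>s + H r \<alpha>s \<beta>s) p"
proof -
  obtain e f q W \<psi> where fr: "frame e f" and p: "p = chart2 e f q" and
    1: "q \<in> W" "open W" "holomorphic2_on \<psi> W"
    "\<And>q. q \<in> W \<Longrightarrow> F (chart2 e f q) = Lvec e f n (snd q) ((snd q - fst q) ^ m * \<psi> q)"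
    using in_diag_power_chartE[OF assms(1)] by blast
  obtain W' \<psi>' where 2: "q \<in> W'" "holomorphic2_on \<psi>' W'"
    "\<And>q. q \<in> W' \<Longrightarrow> H (chart2 e f q) = Lvec e f n (snd q) ((snd q - fst q) ^ m * \<psi>' q)"
    using assms(2) unfolding p in_diag_power_iff[OF fr] by blast
  have op: "open (W \<inter> W')"
    using 1 2 by (auto simp: holomorphic2_on_def)
  show ?thesis
    unfolding p in_diag_power_iff[OF fr]
  proof (intro exI[of _ "W \<inter> W'"] exI[of _ "\<lambda>q. \<psi> q + \<psi>' q"] conjI ballI)
    show "holomorphic2_on (\<lambda>q. \<psi> q + \<psi>' q) (W \<inter> W')"
      by (intro holomorphic2_on_add holomorphic2_on_subset[OF 1(3) _ op] holomorphic2_on_subset[OF 2(2) _ op]) auto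
  qed (use 1 2 in \<open>auto simp: Lvec_add algebra_simps\<close>)
qed

lemma in_diag_power_mult:
  assumes "in_diag_power n m F p" "hol2_at g p"
  shows "in_diag_power n m (\<lambda>r \<alpha>s \<beta>s. g r * F r \<alpha>s \<beta>s) p"
proof -
  obtain e f q W \<psi> where fr: "frame e f" and p: "p = chart2 e f q" and
    1: "q \<in> W" "open W" "holomorphic2_on \<psi> W"
    "\<And>q. q \<in> W \<Longrightarrow> F (chart2 e f q) = Lvec e f n (snd q) ((snd q - fst q) ^ m * \<psi> q)"
    using in_diag_power_chartE[OF assms(1)] by blast
  obtain \<Omega> where 2: "openin lines2_top \<Omega>" "p \<in> \<Omega>" "hol2 g \<Omega>"
    using assms(2) by (auto simp: hol2_at_def)
  define W' where "W' = W \<inter> chart2 e f -` \<Omega>"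
  have op: "open W'"
    unfolding W'_def by (intro open_Int 1 open_chart2_preimage[OF 2(1) fr])
  have "holomorphic2_on (\<lambda>q. g (chart2 e f q) * \<psi> q) W'"
    by (intro holomorphic2_on_mult holomorphic2_on_subset[OF hol2_chart2[OF 2(3) fr] _ op]
        holomorphic2_on_subset[OF 1(3) _ op]) (auto simp: W'_def)
  then show ?thesis
    unfolding p in_diag_power_iff[OF fr] using 1 2(2)
    by (intro exI[of _ W'] exI[of _ "\<lambda>q. g (chart2 e f q) * \<psi> q"])
      (auto simp: W'_def p Lvec_mult mult.left_commute)
qed

lemma in_diag_power_Suc:
  assumes "in_diag_power n (Suc m) F p"
  shows "in_diag_power n m F p"
proof -
  obtain e f q W \<psi> where fr: "frame e f" and p: "p = chart2 e f q" and
    1: "q \<in> W" "open W" "holomorphic2_on \<psi> W"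
    "\<And>q. q \<in> W \<Longrightarrow> F (chart2 e f q) = Lvec e f n (snd q) ((snd q - fst q) ^ Suc m * \<psi> q)"
    using in_diag_power_chartE[OF assms] by blast
  have "holomorphic2_on (\<lambda>q. (snd q - fst q) * \<psi> q) W"
    by (intro holomorphic2_on_mult 1 holomorphic2_on_diagonal_equation)
  then show ?thesis
    unfolding p in_diag_power_iff[OF fr] using 1
    by (intro exI[of _ W] exI[of _ "\<lambda>q. (snd q - fst q) * \<psi> q"]) (simp add: mult_ac)
qed

lemma in_diag_power_cong:
  assumes "in_diag_power n m F p" "openin lines2_top \<Omega>" "p \<in> \<Omega>" "\<And>r. r \<in> \<Omega> \<Longrightarrow> F r = F' r"
  shows "in_diag_power n m F' p"
proof -
  obtain e f q W \<psi> where fr: "frame e f" and p: "p = chart2 e f q" and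
    1: "q \<in> W" "open W" "holomorphic2_on \<psi> W"
    "\<And>q. q \<in> W \<Longrightarrow> F (chart2 e f q) = Lvec e f n (snd q) ((snd q - fst q) ^ m * \<psi> q)"
    using in_diag_power_chartE[OF assms(1)] by blast
  define W' where "W' = W \<inter> chart2 e f -` \<Omega>"
  have "holomorphic2_on \<psi> W'"
    by (rule holomorphic2_on_subset[OF 1(3)])
      (auto simp: W'_def intro!: open_Int 1 open_chart2_preimage[OF assms(2) fr])
  then show ?thesis
    unfolding p in_diag_power_iff[OF fr] using 1 assms(3)
    by (intro exI[of _ W'] exI[of _ \<psi>]) (simp add: W'_def p flip: assms(4))
qed

text \<open>
  Away from the diagonal \<open>w - z\<close> is invertible, so the stalks of the quotient sheaf vanish there.
\<close>

lemma in_diag_power_off_diagonal: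
  assumes "germ_at n F p" "fst p \<noteq> snd p"
  shows "in_diag_power n m F p"
proof -
  obtain e f q W \<psi> where fr: "frame e f" and p: "p = chart2 e f q" and
    1: "q \<in> W" "open W" "holomorphic2_on \<psi> W"
    "\<And>q. q \<in> W \<Longrightarrow> F (chart2 e f q) = Lvec e f n (snd q) ((snd q - fst q) ^ 0 * \<psi> q)"
    using in_diag_power_chartE[OF assms(1)] by blast
  define W' where "W' = W - {q. fst q = snd q}"
  have op: "open W'"
    unfolding W'_def by (intro open_Diff 1 closed_Collect_eq continuous_intros)
  have "holomorphic2_on (\<lambda>q. \<psi> q / (snd q - fst q) ^ m) W'"
    by (intro holomorphic2_on_divide holomorphic2_on_power holomorphic2_on_diagonal_equation
        holomorphic2_on_subset[OF 1(3) _ op] op) (auto simp: W'_def)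
  moreover have "q \<in> W'"
    using 1 assms(2) by (auto simp: W'_def p chart2_def)
  ultimately show ?thesis
    unfolding p in_diag_power_iff[OF fr] using 1(4)
    by (intro exI[of _ W'] exI[of _ "\<lambda>q. \<psi> q / (snd q - fst q) ^ m"]) (auto simp: W'_def)
qed

lemma in_diag_power_diff:
  assumes "in_diag_power n m F p" "in_diag_power n m H p"
  shows "in_diag_power n m (\<lambda>r \<alpha>s \<beta>s. F r \<alpha>s \<beta>s - H r \<alpha>s \<beta>s) p"
  using in_diag_power_add[OF assms(1) in_diag_power_mult[OF assms(2) hol2_at_const[of p "- 1"]]]
    in_diag_power_lines[OF assms(1)] by simp

lemma in_diag_power_zero: "p \<in> lines \<times> lines \<Longrightarrow> in_diag_power n m (\<lambda>r \<alpha>s \<beta>s. 0) p"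
proof -
  assume "p \<in> lines \<times> lines"
  then obtain e f q where fr: "frame e f" and p: "p = chart2 e f q"
    using lines2_chart2 by blast
  have "(\<lambda>\<alpha>s \<beta>s. 0) = Lvec e f n w 0" for w
    by (auto simp: Lvec_def qframe_eq fun_eq_iff)
  then show ?thesis
    unfolding p in_diag_power_iff[OF fr]
    by (intro exI[of _ UNIV] exI[of _ "\<lambda>_. 0"]) (auto intro: holomorphic2_on_const)
qed

lemma in_diag_power_minus:
  assumes "in_diag_power n m (\<lambda>r \<alpha>s \<beta>s. F r \<alpha>s \<beta>s - H r \<alpha>s \<beta>s) p"
  shows "in_diag_power n m (\<lambda>r \<alpha>s \<beta>s. H r \<alpha>s \<beta>s - F r \<alpha>s \<beta>s) p"
  using in_diag_power_mult[OF assms hol2_at_const[of p "- 1"]] in_diag_power_lines[OF assms] by simp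

lemma stalk_class_iff:
  "H \<in> stalk_class n m F p \<longleftrightarrow> germ_at n H p \<and> in_diag_power n m (\<lambda>r \<alpha>s \<beta>s. H r \<alpha>s \<beta>s - F r \<alpha>s \<beta>s) p"
  by (simp add: stalk_class_def germ_at_iff)

lemma stalk_class_refl: "germ_at n F p \<Longrightarrow> F \<in> stalk_class n m F p"
  using in_diag_power_zero[of p n m] in_diag_power_lines[of n 0 F p] by (simp add: stalk_class_iff)

lemma stalk_class_eqI:
  assumes "in_diag_power n m (\<lambda>r \<alpha>s \<beta>s. F r \<alpha>s \<beta>s - F' r \<alpha>s \<beta>s) p"
  shows "stalk_class n m F p = stalk_class n m F' p"
proof -
  have "stalk_class n m F p \<subseteq> stalk_class n m F' p"
    if "in_diag_power n m (\<lambda>r \<alpha>s \<beta>s. F r \<alpha>s \<beta>s - F' r \<alpha>s \<beta>s) p" for F F'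
    using in_diag_power_add[OF _ that] by (fastforce simp: stalk_class_iff)
  then show ?thesis
    using assms in_diag_power_minus[OF assms] by blast
qed

lemma stalk_class_eq_iff:
  assumes "germ_at n F p"
  shows "stalk_class n m F p = stalk_class n m F' p \<longleftrightarrow>
    in_diag_power n m (\<lambda>r \<alpha>s \<beta>s. F r \<alpha>s \<beta>s - F' r \<alpha>s \<beta>s) p"
proof
  assume "stalk_class n m F p = stalk_class n m F' p"
  then have "F \<in> stalk_class n m F' p"
    using stalk_class_refl[OF assms] by blast
  then show "in_diag_power n m (\<lambda>r \<alpha>s \<beta>s. F r \<alpha>s \<beta>s - F' r \<alpha>s \<beta>s) p"
    by (simp add: stalk_class_iff)
qed (rule stalk_class_eqI)

lemma stalk_class_off_diagonal:
  assumes "germ_at n F p" "germ_at n F' p" "fst p \<noteq> snd p"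
  shows "stalk_class n m F p = stalk_class n m F' p"
  by (rule stalk_class_eqI[OF in_diag_power_off_diagonal[OF in_diag_power_diff[OF assms(1,2)] assms(3)]])

lemma stalk_class_proj:
  assumes "germ_at n F p"
  shows "(\<Union>H\<in>stalk_class n (Suc m) F p. stalk_class n m H p) = stalk_class n m F p"
proof -
  have eq: "stalk_class n m H p = stalk_class n m F p" if "H \<in> stalk_class n (Suc m) F p" for H
    by (rule stalk_class_eqI, rule in_diag_power_Suc) (use that in \<open>simp add: stalk_class_iff\<close>)
  show ?thesis
    by (intro UN_constant_eq[OF stalk_class_refl[OF assms]] ballI eq)
qed

lemma stalk_class_add:
  assumes "germ_at n F p" "germ_at n F' p"
  shows "(\<Union>H\<in>stalk_class n m F p. \<Union>H'\<in>stalk_class n m F' p.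
      stalk_class n m (\<lambda>r \<alpha>s \<beta>s. H r \<alpha>s \<beta>s + H' r \<alpha>s \<beta>s) p) =
    stalk_class n m (\<lambda>r \<alpha>s \<beta>s. F r \<alpha>s \<beta>s + F' r \<alpha>s \<beta>s) p"
proof -
  have eq: "stalk_class n m (\<lambda>r \<alpha>s \<beta>s. H r \<alpha>s \<beta>s + H' r \<alpha>s \<beta>s) p =
      stalk_class n m (\<lambda>r \<alpha>s \<beta>s. F r \<alpha>s \<beta>s + F' r \<alpha>s \<beta>s) p"
    if "H \<in> stalk_class n m F p" "H' \<in> stalk_class n m F' p" for H H'
  proof (rule stalk_class_eqI)
    have "in_diag_power n m (\<lambda>r \<alpha>s \<beta>s. (H r \<alpha>s \<beta>s - F r \<alpha>s \<beta>s) + (H' r \<alpha>s \<beta>s - F' r \<alpha>s \<beta>s)) p"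
      using that by (intro in_diag_power_add) (simp_all only: stalk_class_iff)
    then show "in_diag_power n m (\<lambda>r \<alpha>s \<beta>s. H r \<alpha>s \<beta>s + H' r \<alpha>s \<beta>s - (F r \<alpha>s \<beta>s + F' r \<alpha>s \<beta>s)) p"
      by (simp only: add_diff_add)
  qed
  show ?thesis
    by (intro UN_constant_eq[OF stalk_class_refl[OF assms(1)]]
        UN_constant_eq[OF stalk_class_refl[OF assms(2)]] ballI eq)
qed

lemma stalk_class_mult:
  assumes "germ_at n F p" "hol2_at g p"
  shows "(\<Union>H\<in>stalk_class n m F p. stalk_class n m (\<lambda>r \<alpha>s \<beta>s. g r * H r \<alpha>s \<beta>s) p) =
    stalk_class n m (\<lambda>r \<alpha>s \<beta>s. g r * F r \<alpha>s \<beta>s) p"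
proof -
  have eq: "stalk_class n m (\<lambda>r \<alpha>s \<beta>s. g r * H r \<alpha>s \<beta>s) p = stalk_class n m (\<lambda>r \<alpha>s \<beta>s. g r * F r \<alpha>s \<beta>s) p"
    if "H \<in> stalk_class n m F p" for H
  proof (rule stalk_class_eqI)
    have "in_diag_power n m (\<lambda>r \<alpha>s \<beta>s. g r * (H r \<alpha>s \<beta>s - F r \<alpha>s \<beta>s)) p"
      using that by (intro in_diag_power_mult assms) (simp only: stalk_class_iff)
    then show "in_diag_power n m (\<lambda>r \<alpha>s \<beta>s. g r * H r \<alpha>s \<beta>s - g r * F r \<alpha>s \<beta>s) p"
      by (simp only: right_diff_distrib)
  qed
  show ?thesis
    by (intro UN_constant_eq[OF stalk_class_refl[OF assms(1)]] ballI eq)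
qed

section \<open>Comparison of jets with mixed tensors\<close>

definition eval_sec :: "nat \<Rightarrow> ('v set \<Rightarrow> 'v tensor) \<Rightarrow> 'v set \<times> 'v set \<Rightarrow> 'v mixed" where
  "eval_sec n f = (\<lambda>(\<xi>, \<eta>). qmap n \<eta> (f \<xi>))"

lemma jet_eval_eq: "jet_eval n k U f = (\<lambda>p \<in> U \<times> lines. stalk_class n (Suc k) (eval_sec n f) p)"
  by (simp add: jet_eval_def eval_sec_def)

lemma Sym_tensors: "S \<in> Sym m \<Longrightarrow> S \<in> tensors m"
  by (simp add: Sym_def)

lemma V_secD:
  assumes "f \<in> V_sec n U"
  shows "\<And>\<xi>. \<xi> \<in> U \<Longrightarrow> f \<xi> \<in> Sym n" "\<And>\<beta>s. hol (\<lambda>\<xi>. f \<xi> \<beta>s) U" "f \<in> extensional U"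
  using assms by (auto simp: V_sec_def)

lemma pullback_eval_sec:
  assumes f: "f \<in> V_sec n U" and U: "openin lines_top U"
  shows "pullback_sec n (U \<times> lines) (eval_sec n f)"
proof (rule pullback_secI)
  fix p assume p: "p \<in> U \<times> lines"
  have "hol2 (\<lambda>r. f (fst r) \<beta>s) (U \<times> lines)" for \<beta>s
    by (rule hol2_fst[OF V_secD(2)[OF f] openin_times_lines[OF U]]) auto
  then show "\<exists>\<Omega>' t. openin lines2_top \<Omega>' \<and> p \<in> \<Omega>' \<and> \<Omega>' \<subseteq> U \<times> lines \<and> (\<forall>r\<in>\<Omega>'. t r \<in> tensors n) \<and>
      (\<forall>\<beta>s. hol2 (\<lambda>r. t r \<beta>s) \<Omega>') \<and> (\<forall>r\<in>\<Omega>'. eval_sec n f r = qmap n (snd r) (t r))"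
    using p openin_times_lines[OF U] Sym_tensors[OF V_secD(1)[OF f]]
    by (intro exI[of _ "U \<times> lines"] exI[of _ "\<lambda>r. f (fst r)"]) (auto simp: eval_sec_def)
qed

lemma germ_eval_sec:
  "f \<in> V_sec n U \<Longrightarrow> openin lines_top U \<Longrightarrow> p \<in> U \<times> lines \<Longrightarrow> germ_at n (eval_sec n f) p"
  unfolding germ_at_iff using pullback_eval_sec openin_times_lines by blast

lemma eval_sec_chart:
  assumes "frame e h" "f (chart e h (fst q)) \<in> Sym n"
  shows "eval_sec n f (chart2 e h q) =
    Lvec e h n (snd q) (f (chart e h (fst q)) (replicate n (lam e h (snd q))))"
  using qmap_eq_Lvec[OF assms(1) Sym_tensors[OF assms(2)]] by (simp add: eval_sec_def chart2_def)

lemma tensor_word_holomorphic: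
  assumes fr: "frame e h" and t: "\<And>\<xi>. \<xi> \<in> U \<Longrightarrow> t \<xi> \<in> tensors m" "\<And>\<beta>s. hol (\<lambda>\<xi>. t \<xi> \<beta>s) U"
  shows "(\<lambda>z. t (chart e h z) (replicate a (lam e h z) @ replicate i (ecf e h) @ replicate b (lam e h z)))
    holomorphic_on {z. chart e h z \<in> U}"
proof -
  let ?A = "{z. chart e h z \<in> U}"
  (* pairs (p, q) that encode the forms p - z q; constant forms have q = 0 *)
  define \<gamma>s where "\<gamma>s = replicate a (fcf e h, ecf e h) @ replicate i (ecf e h, \<lambda>_. 0) @
    replicate b (fcf e h, ecf e h)"
  have zero: "(\<lambda>_. 0) \<in> forms"
    by (simp add: forms_iff)
  have "(\<lambda>z. t (chart e h z) ([] @ map (\<lambda>(p, q) v. p v + - z * q v) \<gamma>s)) holomorphic_on ?A"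
  proof (rule multilinear_affine_forms[where P = "\<lambda>g. g holomorphic_on ?A" and A = ?A])
    show "multilinear m (t (chart e h z))" if "z \<in> ?A" for z
      using t(1) that by (simp flip: tensors_iff_multilinear)
    show "(\<lambda>z. t (chart e h z) \<beta>s) holomorphic_on ?A" for \<beta>s
      using t(2) fr by (simp add: hol_def)
    show "p \<in> forms \<and> q \<in> forms" if "(p, q) \<in> set \<gamma>s" for p q
      using that zero ecf_forms[OF fr] fcf_forms[OF fr] by (auto simp: \<gamma>s_def split: if_splits)
  qed (auto intro!: holomorphic_intros elim: holomorphic_transform)
  moreover have "map (\<lambda>(p, q) v. p v + - z * q v) \<gamma>s =
      replicate a (lam e h z) @ replicate i (ecf e h) @ replicate b (lam e h z)" for z
    by (simp add: \<gamma>s_def lam_def[abs_def])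
  ultimately show ?thesis
    by simp
qed

lemma Sym_word_perm:
  assumes "S \<in> Sym n" "k \<le> n" "i \<le> k"
  shows "S (replicate (n - k) b @ replicate i a @ replicate (k - i) b) = S (replicate i a @ replicate (n - i) b)"
proof (rule Sym_perm[OF assms(1)])
  have "n - i = (n - k) + (k - i)"
    using assms by simp
  then have "replicate (n - i) b = replicate (n - k) b @ replicate (k - i) b"
    by (simp only: replicate_add)
  then show "mset (replicate (n - k) b @ replicate i a @ replicate (k - i) b) = mset (replicate i a @ replicate (n - i) b)"
    by simp
qed

text \<open>
  By symmetry, the contraction of \<open>S\<close> with \<open>n - k\<close> copies of \<open>lam e h z\<close> is determined by, and determines,
  the values of \<open>S\<close> on words with at most \<open>k\<close> letters \<open>ecf e h\<close>.
\<close>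

lemma qmap_eq_iff_words:
  assumes fr: "frame e h" and S: "S \<in> Sym n" "T \<in> Sym n" and k: "k \<le> n"
  shows "qmap (n - k) (chart e h z) S = qmap (n - k) (chart e h z) T \<longleftrightarrow>
    (\<forall>i\<le>k. S (replicate i (ecf e h) @ replicate (n - i) (lam e h z)) =
      T (replicate i (ecf e h) @ replicate (n - i) (lam e h z)))"
proof
  assume *: "qmap (n - k) (chart e h z) S = qmap (n - k) (chart e h z) T"
  have "S (replicate (n - k) (lam e h z) @ \<beta>s) = T (replicate (n - k) (lam e h z) @ \<beta>s)" for \<beta>s
    using qmap_eval[OF fr, of S "n - k" k z \<beta>s] qmap_eval[OF fr, of T "n - k" k z \<beta>s] * k
      Sym_tensors[OF S(1)] Sym_tensors[OF S(2)] by simp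
  then show "\<forall>i\<le>k. S (replicate i (ecf e h) @ replicate (n - i) (lam e h z)) =
      T (replicate i (ecf e h) @ replicate (n - i) (lam e h z))"
    using Sym_word_perm[OF S(1) k] Sym_word_perm[OF S(2) k] by metis
next
  assume *: "\<forall>i\<le>k. S (replicate i (ecf e h) @ replicate (n - i) (lam e h z)) =
      T (replicate i (ecf e h) @ replicate (n - i) (lam e h z))"
  have "(\<lambda>\<beta>s. S (replicate (n - k) (lam e h z) @ \<beta>s)) = (\<lambda>\<beta>s. T (replicate (n - k) (lam e h z) @ \<beta>s))"
  proof (rule Sym_eq_frameI[OF _ _ fr, where z = z])
    show "(\<lambda>\<beta>s. S (replicate (n - k) (lam e h z) @ \<beta>s)) \<in> Sym k"
      "(\<lambda>\<beta>s. T (replicate (n - k) (lam e h z) @ \<beta>s)) \<in> Sym k"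
      using S k by (auto intro!: Sym_contract[where a = "n - k"])
  qed (use * Sym_word_perm[OF S(1) k] Sym_word_perm[OF S(2) k] in auto)
  then show "qmap (n - k) (chart e h z) S = qmap (n - k) (chart e h z) T"
    using qmap_eq_qframe[OF fr, of S "n - k" k z] qmap_eq_qframe[OF fr, of T "n - k" k z] k
      Sym_tensors[OF S(1)] Sym_tensors[OF S(2)] by simp
qed

text \<open>
  The kernel of evaluation is contained in the kernel of \<open>theta\<close>, pointwise: if the difference \<open>D\<close> of
  the two symmetric tensors gives a section vanishing to order \<open>k + 1\<close> at \<open>\<xi>\<close>, then its Taylor
  coefficients up to order \<open>k\<close> vanish, and these are the values of \<open>D\<close> on words.
\<close>

lemma qmap_eq_if_jet_eq:
  assumes f: "f \<in> V_sec n U" "f' \<in> V_sec n U'" and U: "openin lines_top U" "openin lines_top U'"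
    and \<xi>: "\<xi> \<in> U" "\<xi> \<in> U'" and k: "k \<le> n"
    and eq: "stalk_class n (Suc k) (eval_sec n f) (\<xi>, \<xi>) = stalk_class n (Suc k) (eval_sec n f') (\<xi>, \<xi>)"
  shows "qmap (n - k) \<xi> (f \<xi>) = qmap (n - k) \<xi> (f' \<xi>)"
proof -
  have "\<xi> \<in> lines"
    using U(1) \<xi>(1) openin_subset topspace_lines_top by blast
  then obtain e h where fr: "frame e h" and \<xi>_eq: "\<xi> = chart e h 0"
    using lines_chart by blast
  have S: "f \<xi> \<in> Sym n" "f' \<xi> \<in> Sym n"
    using V_secD(1) f \<xi> by blast+
  define D where "D \<beta>s = 1 * f \<xi> \<beta>s + - 1 * f' \<xi> \<beta>s" for \<beta>s
  have D: "D \<in> Sym n"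
    unfolding D_def by (rule Sym_lincomb[OF S])
  have "germ_at n (eval_sec n f) (\<xi>, \<xi>)"
    using germ_eval_sec[OF f(1) U(1)] \<xi> \<open>\<xi> \<in> lines\<close> by simp
  then have "in_diag_power n (Suc k) (\<lambda>r \<alpha>s \<beta>s. eval_sec n f r \<alpha>s \<beta>s - eval_sec n f' r \<alpha>s \<beta>s) (chart2 e h (0, 0))"
    using eq by (simp add: stalk_class_eq_iff chart2_def \<xi>_eq)
  then obtain W \<psi> where W: "(0, 0) \<in> W" "holomorphic2_on \<psi> W"
    "\<And>q. q \<in> W \<Longrightarrow> (\<lambda>\<alpha>s \<beta>s. eval_sec n f (chart2 e h q) \<alpha>s \<beta>s - eval_sec n f' (chart2 e h q) \<alpha>s \<beta>s) =
      Lvec e h n (snd q) ((snd q - fst q) ^ Suc k * \<psi> q)"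
    unfolding in_diag_power_iff[OF fr] by blast
  have DL: "D (replicate n (lam e h w)) = (w - 0) ^ Suc k * \<psi> (0, w)" if "(0, w) \<in> W" for w
  proof -
    have "Lvec e h n w (f \<xi> (replicate n (lam e h w)) - f' \<xi> (replicate n (lam e h w))) =
        Lvec e h n w ((w - 0) ^ Suc k * \<psi> (0, w))"
      using W(3)[OF that] eval_sec_chart[OF fr, of f "(0, w)" n] eval_sec_chart[OF fr, of f' "(0, w)" n] S
      by (simp add: \<xi>_eq Lvec_diff)
    then show ?thesis
      by (simp add: Lvec_inj[OF fr] D_def)
  qed
  define c where "c j = (- 1) ^ j * of_nat (n choose j) *
    D (replicate j (ecf e h) @ replicate (n - j) (lam e h 0))" for j
  have "c i = 0" if "i \<le> k" for i
  proof (rule vanishing_order_coeffs[where S = "{w. (0, w) \<in> W}" and h = "\<lambda>w. \<psi> (0, w)" and z = 0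
        and m = "Suc k" and n = n])
    show "(\<Sum>i\<le>n. c i * (w - 0) ^ i) = (w - 0) ^ Suc k * \<psi> (0, w)" if "w \<in> {w. (0, w) \<in> W}" for w
      using DL[of w] that Sym_lam_expand[OF fr D, of w 0] by (simp add: c_def)
  qed (use W that k holomorphic2_on_separately[OF W(2)] in \<open>auto intro: open_slices\<close>)
  then have "D (replicate i (ecf e h) @ replicate (n - i) (lam e h 0)) = 0" if "i \<le> k" for i
    using that k by (auto simp: c_def)
  then show ?thesis
    using qmap_eq_iff_words[OF fr S[unfolded \<xi>_eq] k, of 0] by (simp add: D_def \<xi>_eq)
qed

text \<open>
  The converse inclusion of kernels, over an open set: the Taylor coefficients up to order \<open>k\<close> vanish
  at every point, so that the rest of the expansion is divisible by \<open>(w - z)\<^bsup>k + 1\<^esup>\<close> with a quotient that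
  is holomorphic in both variables. Off the diagonal there is nothing to compare.
\<close>

lemma jet_eq_if_qmap_eq:
  assumes f: "f \<in> V_sec n U" "f' \<in> V_sec n U" and U: "openin lines_top U" and k: "k \<le> n"
    and eq: "\<And>\<xi>. \<xi> \<in> U \<Longrightarrow> qmap (n - k) \<xi> (f \<xi>) = qmap (n - k) \<xi> (f' \<xi>)"
    and p: "p \<in> U \<times> lines"
  shows "stalk_class n (Suc k) (eval_sec n f) p = stalk_class n (Suc k) (eval_sec n f') p"
proof (cases "fst p = snd p")
  case False
  then show ?thesis
    using stalk_class_off_diagonal germ_eval_sec[OF f(1) U p] germ_eval_sec[OF f(2) U p] by blast
next
  case True
  obtain e h where fr: "frame e h" and \<xi>: "fst p = chart e h 0"
    using lines_chart[of "snd p"] p True by (metis mem_Times_iff)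
  have p_eq: "p = chart2 e h (0, 0)"
    using True \<xi> by (simp add: chart2_def prod_eq_iff)
  define A where "A = {z. chart e h z \<in> U}"
  define W where "W = A \<times> (UNIV :: complex set)"
  have opW: "open W"
    unfolding W_def A_def using open_chart_preimage[OF U fr] by (intro open_Times) auto
  define D where "D z \<beta>s = 1 * f (chart e h z) \<beta>s + - 1 * f' (chart e h z) \<beta>s" for z \<beta>s
  define c where "c j z = (- 1) ^ j * of_nat (n choose j) *
    D z (replicate j (ecf e h) @ replicate (n - j) (lam e h z))" for j z
  (* the quotient of the expansion by (w - z) ^ Suc k *)
  define \<psi> where "\<psi> q = (\<Sum>j\<in>{Suc k..n}. c j (fst q) * (snd q - fst q) ^ (j - Suc k))" for q
  have S: "f (chart e h z) \<in> Sym n" "f' (chart e h z) \<in> Sym n" if "z \<in> A" for z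
    using that V_secD(1) f by (auto simp: A_def)
  have c_hol: "c j holomorphic_on A" for j
  proof -
    have "(\<lambda>z. g (chart e h z) (replicate j (ecf e h) @ replicate (n - j) (lam e h z))) holomorphic_on A"
      if "g \<in> V_sec n U" for g
      using tensor_word_holomorphic[OF fr Sym_tensors[OF V_secD(1)[OF that]] V_secD(2)[OF that],
          of 0 j "n - j"] by (simp add: A_def)
    then show ?thesis
      unfolding c_def D_def using f by (intro holomorphic_intros) auto
  qed
  have c0: "c j z = 0" if "z \<in> A" "j \<le> k" for j z
  proof -
    have "qmap (n - k) (chart e h z) (f (chart e h z)) = qmap (n - k) (chart e h z) (f' (chart e h z))"
      using eq that by (simp add: A_def)
    then show ?thesis
      using qmap_eq_iff_words[OF fr S[OF that(1)] k, of z] that(2) by (simp add: c_def D_def)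
  qed
  have key: "D z (replicate n (lam e h w)) = (w - z) ^ Suc k * \<psi> (z, w)" if z: "z \<in> A" for z w
  proof -
    have "D z \<in> Sym n"
      unfolding D_def using Sym_lincomb[OF S[OF z]] .
    then have "D z (replicate n (lam e h w)) = (\<Sum>j\<le>n. c j z * (w - z) ^ j)"
      using Sym_lam_expand[OF fr, of "D z" n w z] by (simp add: c_def)
    also have "\<dots> = (\<Sum>j\<in>{Suc k..n}. c j z * (w - z) ^ j)"
      using c0[OF z] by (intro sum.mono_neutral_right) auto
    also have "\<dots> = (\<Sum>j\<in>{Suc k..n}. (w - z) ^ Suc k * (c j z * (w - z) ^ (j - Suc k)))"
    proof (intro sum.cong refl)
      fix j assume "j \<in> {Suc k..n}"
      then have "(w - z) ^ j = (w - z) ^ Suc k * (w - z) ^ (j - Suc k)"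
        by (simp flip: power_add power_Suc)
      then show "c j z * (w - z) ^ j = (w - z) ^ Suc k * (c j z * (w - z) ^ (j - Suc k))"
        by simp
    qed
    finally show ?thesis
      by (simp add: \<psi>_def sum_distrib_left)
  qed
  have "holomorphic2_on \<psi> W"
  proof -
    have "holomorphic2_on (\<lambda>q. c j (fst q)) W" for j
      by (rule holomorphic2_on_fst[OF c_hol opW]) (auto simp: W_def)
    then show ?thesis
      unfolding \<psi>_def by (intro holomorphic2_on_sum opW holomorphic2_on_mult holomorphic2_on_power
          holomorphic2_on_diagonal_equation)
  qed
  moreover have "(0, 0) \<in> W"
    using p \<xi> by (auto simp: W_def A_def)
  moreover have "(\<lambda>\<alpha>s \<beta>s. eval_sec n f (chart2 e h q) \<alpha>s \<beta>s - eval_sec n f' (chart2 e h q) \<alpha>s \<beta>s) =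
      Lvec e h n (snd q) ((snd q - fst q) ^ Suc k * \<psi> q)" if "q \<in> W" for q
  proof -
    have "fst q \<in> A"
      using that by (auto simp: W_def)
    then show ?thesis
      using S[of "fst q"] key[of "fst q" "snd q"]
      by (simp add: eval_sec_chart[OF fr] Lvec_diff D_def)
  qed
  ultimately have "in_diag_power n (Suc k) (\<lambda>r \<alpha>s \<beta>s. eval_sec n f r \<alpha>s \<beta>s - eval_sec n f' r \<alpha>s \<beta>s) p"
    unfolding p_eq in_diag_power_iff[OF fr] by blast
  then show ?thesis
    by (rule stalk_class_eqI)
qed

text \<open>
  Sections of \<open>\<V>\<^sub>n\<close> with prescribed holomorphic values on the words in \<open>ecf e h\<close> and \<open>lam e h z\<close>.
\<close>

lemma symb_section:
  assumes fr: "frame e h" and W: "open W" and a: "\<And>i. i \<le> k \<Longrightarrow> a i holomorphic_on W"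
  shows "\<exists>f\<in>V_sec n (chart e h ` W). \<forall>z\<in>W. \<forall>\<beta>s.
    f (chart e h z) \<beta>s = (\<Sum>i\<le>k. a i z * symb n i (e + z *\<^sub>V h) h \<beta>s)"
proof -
  define c where "c = inv (chart e h)"
  have c: "c (chart e h z) = z" for z
    unfolding c_def by (simp add: inj_chart[OF fr])
  define f where "f = (\<lambda>\<xi>\<in>chart e h ` W. \<lambda>\<beta>s. \<Sum>i\<le>k. a i (c \<xi>) * symb n i (e + c \<xi> *\<^sub>V h) h \<beta>s)"
  have eq: "f (chart e h z) \<beta>s = (\<Sum>i\<le>k. a i z * symb n i (e + z *\<^sub>V h) h \<beta>s)" if "z \<in> W" for z \<beta>s
    using that by (simp add: f_def c)
  have pre: "{z. chart e h z \<in> chart e h ` W} = W"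
    using chart_inj[OF fr] by auto
  have "hol (\<lambda>\<xi>. f \<xi> \<beta>s) (chart e h ` W)" for \<beta>s
  proof (rule hol_chartI[OF fr])
    have "(\<lambda>z. \<Sum>i\<le>k. a i z * symb n i (e + z *\<^sub>V h) h \<beta>s) holomorphic_on W"
      using a by (intro holomorphic_intros symb_holomorphic) auto
    then show "(\<lambda>z. f (chart e h z) \<beta>s) holomorphic_on {z. chart e h z \<in> chart e h ` W}"
      unfolding pre by (rule holomorphic_transform) (simp add: eq)
  qed auto
  moreover have "f \<xi> \<in> Sym n" if "\<xi> \<in> chart e h ` W" for \<xi>
    unfolding f_def using that by (simp add: Sym_sum[OF symb_Sym])
  ultimately have "f \<in> V_sec n (chart e h ` W)"
    by (auto simp: V_sec_def f_def)
  then show ?thesis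
    using eq by blast
qed

text \<open>
  Local surjectivity of evaluation: near the diagonal a jet is a function of two variables, whose
  Taylor coefficients along the diagonal are those of a suitable symmetric tensor depending
  holomorphically on the base point.
\<close>

lemma jet_sec_locally_eval:
  assumes \<sigma>: "\<sigma> \<in> jet_sec n k U" and U: "openin lines_top U" and \<xi>: "\<xi> \<in> U" and k: "k \<le> n"
  obtains U' f where "openin lines_top U'" "\<xi> \<in> U'" "U' \<subseteq> U" "f \<in> V_sec n U'"
    "jet_eval n k U' f = restrict \<sigma> (U' \<times> lines)"
proof -
  have Ul: "U \<subseteq> lines"
    using U openin_subset topspace_lines_top by blast
  have loc: "\<exists>\<Omega> F. openin lines2_top \<Omega> \<and> p \<in> \<Omega> \<and> \<Omega> \<subseteq> U \<times> lines \<and>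
       pullback_sec n \<Omega> F \<and> (\<forall>r\<in>\<Omega>. \<sigma> r = stalk_class n (Suc k) F r)" if "p \<in> U \<times> lines" for p
    using \<sigma> that unfolding jet_sec_def Suc_eq_plus1 by blast
  obtain \<Omega> F where \<Omega>: "openin lines2_top \<Omega>" "(\<xi>, \<xi>) \<in> \<Omega>" "\<Omega> \<subseteq> U \<times> lines"
    "pullback_sec n \<Omega> F" "\<And>r. r \<in> \<Omega> \<Longrightarrow> \<sigma> r = stalk_class n (Suc k) F r"
    using loc[of "(\<xi>, \<xi>)"] \<xi> Ul by blast
  obtain e h where fr: "frame e h" and \<xi>_eq: "\<xi> = chart e h 0"
    using lines_chart[of \<xi>] \<xi> Ul by blast
  have "(0, 0) \<in> chart2 e h -` \<Omega>"
    using \<Omega>(2) by (simp add: chart2_def \<xi>_eq)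
  then obtain r where r: "r > 0" "cball 0 r \<times> cball 0 r \<subseteq> chart2 e h -` \<Omega>"
    using open_contains_bidisc[OF open_chart2_preimage[OF \<Omega>(1) fr]] by metis
  define B where "B = ball (0 :: complex) r"
  have B: "B \<times> B \<subseteq> chart2 e h -` \<Omega>" "open B" "0 \<in> B"
    using r ball_subset_cball by (auto simp: B_def)
  have "holomorphic2_on (Lcoord e h n F) (B \<times> B)"
    by (rule holomorphic2_on_subset[OF pullback_chart(1)[OF fr \<Omega>(4,1)] B(1)]) (simp add: open_Times B)
  then obtain b g where b: "\<And>i. b i holomorphic_on B" and g: "holomorphic2_on g (B \<times> B)"
    and taylor: "\<And>z w. z \<in> B \<Longrightarrow> w \<in> B \<Longrightarrow> Lcoord e h n F (z, w) =
      (\<Sum>i<Suc k. b i z * (w - z) ^ i) + (w - z) ^ Suc k * g (z, w)"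
    using diagonal_taylor[where m = "Suc k"] by blast
  (* symb n i contributes (n choose i) * (z - w) ^ i to the Taylor expansion; the factor turns this
     into b i z * (w - z) ^ i *)
  define a where "a i z = (- 1) ^ i * b i z / of_nat (n choose i)" for i z
  have a_hol: "a i holomorphic_on B" if "i \<le> k" for i
    unfolding a_def using b that k by (intro holomorphic_intros) auto
  obtain f where f: "f \<in> V_sec n (chart e h ` B)"
    and f_eq: "\<And>z \<beta>s. z \<in> B \<Longrightarrow> f (chart e h z) \<beta>s = (\<Sum>i\<le>k. a i z * symb n i (e + z *\<^sub>V h) h \<beta>s)"
    using symb_section[OF fr B(2), of k a n] a_hol by blast
  define U' where "U' = chart e h ` B"
  have "chart e h z \<in> U" if "z \<in> B" for z
  proof -
    have "chart2 e h (z, z) \<in> \<Omega>"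
      using that B(1) by blast
    then show ?thesis
      using \<Omega>(3) by (auto simp: chart2_def)
  qed
  then have U': "openin lines_top U'" "\<xi> \<in> U'" "U' \<subseteq> U"
    using openin_chart_image[OF fr B(2)] B(3) by (auto simp: U'_def \<xi>_eq)
  note f = f[folded U'_def]
  have f_lam: "f (chart e h z) (replicate n (lam e h w)) = (\<Sum>i<Suc k. b i z * (w - z) ^ i)" if "z \<in> B" for z w
  proof -
    have "a i z * symb n i (e + z *\<^sub>V h) h (replicate n (lam e h w)) = b i z * (w - z) ^ i" if "i \<le> k" for i
    proof -
      have "(z - w) ^ i = (- 1) ^ i * (w - z) ^ i"
        by (simp flip: power_mult_distrib)
      moreover have "(of_nat (n choose i) :: complex) \<noteq> 0"
        using that k by simp
      ultimately show ?thesis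
        using that k by (simp add: symb_lam[OF fr] a_def)
    qed
    then show ?thesis
      by (simp add: f_eq[OF that] lessThan_Suc_atMost)
  qed
  have "stalk_class n (Suc k) (eval_sec n f) p = \<sigma> p" if p: "p \<in> U' \<times> lines" for p
  proof (cases "fst p = snd p")
    case True
    then obtain z where z: "z \<in> B" "p = chart2 e h (z, z)"
      using p by (auto simp: U'_def chart2_def)
    have "in_diag_power n (Suc k) (\<lambda>r \<alpha>s \<beta>s. eval_sec n f r \<alpha>s \<beta>s - F r \<alpha>s \<beta>s) p"
      unfolding z(2) in_diag_power_iff[OF fr]
    proof (intro exI[of _ "B \<times> B"] exI[of _ "\<lambda>q. 0 - g q"] conjI ballI)
      show "holomorphic2_on (\<lambda>q. 0 - g q) (B \<times> B)"
        by (intro holomorphic2_on_diff g holomorphic2_on_const open_Times B)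
      fix q assume q: "q \<in> B \<times> B"
      have "f (chart e h (fst q)) \<in> Sym n"
        using q V_secD(1)[OF f] by (auto simp: U'_def)
      moreover have "F (chart2 e h q) = Lvec e h n (snd q) (Lcoord e h n F q)"
        using pullback_chart(2)[OF fr \<Omega>(4,1)] q B(1) by blast
      ultimately show "(\<lambda>\<alpha>s \<beta>s. eval_sec n f (chart2 e h q) \<alpha>s \<beta>s - F (chart2 e h q) \<alpha>s \<beta>s) =
          Lvec e h n (snd q) ((snd q - fst q) ^ Suc k * (0 - g q))"
        using q taylor[of "fst q" "snd q"] f_lam[of "fst q" "snd q"]
        by (auto simp: eval_sec_chart[OF fr] Lvec_diff)
    qed (use z in auto)
    moreover have "p \<in> \<Omega>"
      using z B(1) by auto
    ultimately show ?thesis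
      using stalk_class_eqI \<Omega>(5) by blast
  next
    case False
    have "p \<in> U \<times> lines"
      using p U'(3) by auto
    then obtain \<Omega>' F' where F': "openin lines2_top \<Omega>'" "p \<in> \<Omega>'" "pullback_sec n \<Omega>' F'"
      "\<sigma> p = stalk_class n (Suc k) F' p"
      using loc by metis
    then have "germ_at n F' p"
      unfolding germ_at_iff by blast
    then show ?thesis
      unfolding F'(4) by (rule stalk_class_off_diagonal[OF germ_eval_sec[OF f U'(1) p] _ False])
  qed
  then have "jet_eval n k U' f = restrict \<sigma> (U' \<times> lines)"
    unfolding jet_eval_eq by (rule restrict_ext)
  then show thesis
    using that U' f by blast
qed

text \<open>
  Local surjectivity of \<open>theta\<close>: the values of \<open>s\<close> on words prescribe those of the symmetric tensor.
\<close>

lemma L_sec_locally_theta: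
  assumes s: "s \<in> L_sec (n - k) k U" and U: "openin lines_top U" and \<xi>: "\<xi> \<in> U" and k: "k \<le> n"
  obtains U' f where "openin lines_top U'" "\<xi> \<in> U'" "U' \<subseteq> U" "f \<in> V_sec n U'"
    "\<And>\<eta>. \<eta> \<in> U' \<Longrightarrow> qmap (n - k) \<eta> (f \<eta>) = s \<eta>"
proof -
  have sL: "s \<eta> \<in> LSym \<eta> (n - k) k" if "\<eta> \<in> U" for \<eta>
    using s that by (simp add: L_sec_def)
  have "\<exists>U' t. openin lines_top U' \<and> \<xi> \<in> U' \<and> U' \<subseteq> U \<and>
      (\<forall>\<eta>\<in>U'. t \<eta> \<in> tensors (n - k + k)) \<and> (\<forall>\<beta>s. hol (\<lambda>\<eta>. t \<eta> \<beta>s) U') \<and>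
      (\<forall>\<eta>\<in>U'. s \<eta> = qmap (n - k) \<eta> (t \<eta>))"
    using s \<xi> by (simp add: L_sec_def)
  then obtain U1 t where U1: "openin lines_top U1" "\<xi> \<in> U1" "U1 \<subseteq> U"
    and t: "\<And>\<eta>. \<eta> \<in> U1 \<Longrightarrow> t \<eta> \<in> tensors n" "\<And>\<beta>s. hol (\<lambda>\<eta>. t \<eta> \<beta>s) U1"
      "\<And>\<eta>. \<eta> \<in> U1 \<Longrightarrow> s \<eta> = qmap (n - k) \<eta> (t \<eta>)"
    using k by (metis le_add_diff_inverse2)
  have "\<xi> \<in> lines"
    using U \<xi> openin_subset topspace_lines_top by blast
  then obtain e h where fr: "frame e h" and \<xi>_eq: "\<xi> = chart e h 0"
    using lines_chart by blast
  define W where "W = {z. chart e h z \<in> U1}"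
  have opW: "open W"
    unfolding W_def using open_chart_preimage[OF U1(1) fr] .
  define a where "a i z = t (chart e h z)
    (replicate (n - k) (lam e h z) @ replicate i (ecf e h) @ replicate (k - i) (lam e h z))" for i z
  have a_hol: "a i holomorphic_on W" if "i \<le> k" for i
    unfolding a_def W_def by (rule tensor_word_holomorphic[OF fr t(1,2)])
  obtain f where f: "f \<in> V_sec n (chart e h ` W)"
    and f_eq: "\<And>z \<beta>s. z \<in> W \<Longrightarrow> f (chart e h z) \<beta>s = (\<Sum>i\<le>k. a i z * symb n i (e + z *\<^sub>V h) h \<beta>s)"
    using symb_section[OF fr opW, of k a n] a_hol by blast
  define U' where "U' = chart e h ` W"
  have U': "openin lines_top U'" "\<xi> \<in> U'" "U' \<subseteq> U" "U' \<subseteq> U1"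
    using openin_chart_image[OF fr opW] U1 by (auto simp: U'_def W_def \<xi>_eq)
  have "qmap (n - k) \<eta> (f \<eta>) = s \<eta>" if \<eta>: "\<eta> \<in> U'" for \<eta>
  proof -
    obtain z where z: "z \<in> W" "\<eta> = chart e h z"
      using \<eta> by (auto simp: U'_def)
    let ?al = "replicate (n - k) (qlam e h z)" and ?la = "replicate (n - k) (lam e h z)"
    have fS: "f \<eta> \<in> Sym n"
      using V_secD(1)[OF f] \<eta> by (simp add: U'_def)
    have sz: "s \<eta> ?al \<beta>s = t \<eta> (?la @ \<beta>s)" for \<beta>s
      using t(1,3)[of \<eta>] qmap_eval[OF fr, of "t \<eta>" "n - k" k z \<beta>s] \<eta> U'(4) k z by auto
    have L: "s \<eta> = qframe e h (n - k) z (s \<eta> ?al)" "s \<eta> ?al \<in> Sym k"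
      using LSym_eq_qframe[OF fr, of "s \<eta>" z "n - k" k] sL[of \<eta>] \<eta> U'(3) z by auto
    have "(\<lambda>\<beta>s. f \<eta> (?la @ \<beta>s)) = s \<eta> ?al"
    proof (rule Sym_eq_frameI[OF _ L(2) fr, where z = z])
      show "(\<lambda>\<beta>s. f \<eta> (?la @ \<beta>s)) \<in> Sym k"
        using fS k by (auto intro!: Sym_contract[where a = "n - k"])
      fix i assume i: "i \<le> k"
      have "f \<eta> (?la @ replicate i (ecf e h) @ replicate (k - i) (lam e h z)) =
          f \<eta> (replicate i (ecf e h) @ replicate (n - i) (lam e h z))"
        by (rule Sym_word_perm[OF fS k i])
      also have "\<dots> = a i z"
        using i k by (simp add: z f_eq symb_frame[OF fr] if_distrib cong: if_cong)
      also have "\<dots> = s \<eta> ?al (replicate i (ecf e h) @ replicate (k - i) (lam e h z))"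
        unfolding sz by (simp add: a_def z)
      finally show "f \<eta> (?la @ replicate i (ecf e h) @ replicate (k - i) (lam e h z)) =
          s \<eta> ?al (replicate i (ecf e h) @ replicate (k - i) (lam e h z))" .
    qed
    then show ?thesis
      using qmap_eq_qframe[OF fr, of "f \<eta>" "n - k" k z] Sym_tensors[OF fS] k L(1) z by simp
  qed
  then show thesis
    using that U' f by (metis U'_def)
qed

section \<open>The isomorphism of sheaves\<close>

lemma openin_lines_sub: "openin lines_top U \<Longrightarrow> U \<subseteq> lines"
  using openin_subset topspace_lines_top by blast

lemma stalk_class_cong:
  assumes "openin lines2_top \<Omega>" "p \<in> \<Omega>" "\<And>r. r \<in> \<Omega> \<Longrightarrow> F r = F' r"
  shows "stalk_class n m F p = stalk_class n m F' p"
proof (rule stalk_class_eqI)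
  have "p \<in> lines \<times> lines"
    using assms openin_subset topspace_lines2 by blast
  then have "in_diag_power n m (\<lambda>r \<alpha>s \<beta>s. 0) p"
    by (rule in_diag_power_zero)
  then show "in_diag_power n m (\<lambda>r \<alpha>s \<beta>s. F r \<alpha>s \<beta>s - F' r \<alpha>s \<beta>s) p"
    by (rule in_diag_power_cong[OF _ assms(1,2)]) (simp add: assms(3))
qed

text \<open>
  A local lift of the jet \<open>\<sigma>\<close> along evaluation. Every property of the isomorphism is checked on lifts.
\<close>

definition represents :: "nat \<Rightarrow> nat \<Rightarrow> 'v jet \<Rightarrow> 'v set set \<Rightarrow> ('v set \<Rightarrow> 'v tensor) \<Rightarrow> bool" where
  "represents n k \<sigma> U f \<longleftrightarrow> openin lines_top U \<and> f \<in> V_sec n U \<and>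
     (\<forall>p\<in>U \<times> lines. \<sigma> p = stalk_class n (Suc k) (eval_sec n f) p)"

lemma representsD:
  assumes "represents n k \<sigma> U f"
  shows "openin lines_top U" "f \<in> V_sec n U"
    "p \<in> U \<times> lines \<Longrightarrow> \<sigma> p = stalk_class n (Suc k) (eval_sec n f) p"
  using assms unfolding represents_def by blast+

lemma jet_eval_eq_restrict_iff:
  "jet_eval n k U f = restrict \<sigma> (U \<times> lines) \<longleftrightarrow>
     (\<forall>p\<in>U \<times> lines. \<sigma> p = stalk_class n (Suc k) (eval_sec n f) p)"
proof
  assume eq: "jet_eval n k U f = restrict \<sigma> (U \<times> lines)"
  show "\<forall>p\<in>U \<times> lines. \<sigma> p = stalk_class n (Suc k) (eval_sec n f) p"
  proof
    fix p assume "p \<in> U \<times> lines"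
    then show "\<sigma> p = stalk_class n (Suc k) (eval_sec n f) p"
      using fun_cong[OF eq, of p] by (simp add: jet_eval_eq)
  qed
next
  assume eq: "\<forall>p\<in>U \<times> lines. \<sigma> p = stalk_class n (Suc k) (eval_sec n f) p"
  show "jet_eval n k U f = restrict \<sigma> (U \<times> lines)"
    unfolding jet_eval_eq by (rule restrict_ext) (rule bspec[OF eq, symmetric])
qed

lemma jet_sec_represents:
  assumes "\<sigma> \<in> jet_sec n k U" "openin lines_top U" "\<xi> \<in> U" "k \<le> n"
  obtains U' f where "represents n k \<sigma> U' f" "\<xi> \<in> U'" "U' \<subseteq> U"
  using jet_sec_locally_eval[OF assms] unfolding jet_eval_eq_restrict_iff represents_def by metis

lemma represents_qmap_unique:
  assumes "represents n k \<sigma> U f" "represents n k \<sigma> U' f'" "\<xi> \<in> U" "\<xi> \<in> U'" "k \<le> n"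
  shows "qmap (n - k) \<xi> (f \<xi>) = qmap (n - k) \<xi> (f' \<xi>)"
proof (rule qmap_eq_if_jet_eq[where U = U and U' = U'])
  have "\<xi> \<in> lines"
    using assms openin_lines_sub by (auto simp: represents_def)
  then show "stalk_class n (Suc k) (eval_sec n f) (\<xi>, \<xi>) = stalk_class n (Suc k) (eval_sec n f') (\<xi>, \<xi>)"
    using representsD(3)[OF assms(1), of "(\<xi>, \<xi>)"] representsD(3)[OF assms(2), of "(\<xi>, \<xi>)"] assms(3,4) by simp
qed (use assms in \<open>auto simp: represents_def\<close>)

text \<open>
  The value is well defined because two lifts of the same jet have the same image under \<open>theta\<close>; and so
  any lift computes it.
\<close>

lemma jet_iso_eqI:
  assumes r: "represents n k \<sigma> U' f" and "\<xi> \<in> U'" "U' \<subseteq> U" "k \<le> n"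
  shows "jet_iso n k U \<sigma> \<xi> = qmap (n - k) \<xi> (f \<xi>)"
proof -
  have "(THE t. \<exists>U' f. openin lines_top U' \<and> \<xi> \<in> U' \<and> U' \<subseteq> U \<and> f \<in> V_sec n U' \<and>
     jet_eval n k U' f = restrict \<sigma> (U' \<times> lines) \<and> t = theta n k U' f \<xi>) = qmap (n - k) \<xi> (f \<xi>)"
  proof (rule the_equality)
    show "\<exists>U' f'. openin lines_top U' \<and> \<xi> \<in> U' \<and> U' \<subseteq> U \<and> f' \<in> V_sec n U' \<and>
       jet_eval n k U' f' = restrict \<sigma> (U' \<times> lines) \<and> qmap (n - k) \<xi> (f \<xi>) = theta n k U' f' \<xi>"
      using assms by (intro exI[of _ U'] exI[of _ f]) (simp add: represents_def jet_eval_eq_restrict_iff theta_def)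
  next
    fix t
    assume "\<exists>U' f'. openin lines_top U' \<and> \<xi> \<in> U' \<and> U' \<subseteq> U \<and> f' \<in> V_sec n U' \<and>
       jet_eval n k U' f' = restrict \<sigma> (U' \<times> lines) \<and> t = theta n k U' f' \<xi>"
    then obtain U'' f' where "represents n k \<sigma> U'' f'" "\<xi> \<in> U''" "t = qmap (n - k) \<xi> (f' \<xi>)"
      by (auto simp: represents_def jet_eval_eq_restrict_iff theta_def)
    then show "t = qmap (n - k) \<xi> (f \<xi>)"
      using represents_qmap_unique[OF _ r] assms by blast
  qed
  then show ?thesis
    using assms by (simp add: jet_iso_def subsetD)
qed

lemma jet_iso_extensional: "jet_iso n k U \<sigma> \<in> extensional U"
  by (simp add: jet_iso_def)

lemma V_sec_restrict:
  assumes "f \<in> V_sec n U" "U' \<subseteq> U"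
  shows "restrict f U' \<in> V_sec n U'"
proof -
  have "hol (\<lambda>\<xi>. restrict f U' \<xi> \<beta>s) U'" for \<beta>s
    by (rule hol_cong[OF hol_subset[OF V_secD(2)[OF assms(1)] assms(2)]]) simp
  then show ?thesis
    using V_secD(1)[OF assms(1)] assms(2) by (auto simp: V_sec_def)
qed

lemma V_sec_add:
  assumes "f \<in> V_sec n U" "f' \<in> V_sec n U"
  shows "(\<lambda>\<xi>\<in>U. \<lambda>\<beta>s. f \<xi> \<beta>s + f' \<xi> \<beta>s) \<in> V_sec n U"
proof -
  have "hol (\<lambda>\<xi>. (\<lambda>\<xi>\<in>U. \<lambda>\<beta>s. f \<xi> \<beta>s + f' \<xi> \<beta>s) \<xi> \<beta>s) U" for \<beta>s
    by (rule hol_cong[OF hol_add[OF V_secD(2)[OF assms(1)] V_secD(2)[OF assms(2)]]]) simp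
  moreover have "(\<lambda>\<beta>s. f \<xi> \<beta>s + f' \<xi> \<beta>s) \<in> Sym n" if "\<xi> \<in> U" for \<xi>
    using Sym_lincomb[OF V_secD(1)[OF assms(1) that] V_secD(1)[OF assms(2) that], of 1 1] by simp
  ultimately show ?thesis
    by (auto simp: V_sec_def)
qed

lemma V_sec_mult:
  assumes "f \<in> V_sec n U" "hol g U"
  shows "(\<lambda>\<xi>\<in>U. \<lambda>\<beta>s. g \<xi> * f \<xi> \<beta>s) \<in> V_sec n U"
proof -
  have "hol (\<lambda>\<xi>. (\<lambda>\<xi>\<in>U. \<lambda>\<beta>s. g \<xi> * f \<xi> \<beta>s) \<xi> \<beta>s) U" for \<beta>s
    by (rule hol_cong[OF hol_mult[OF assms(2) V_secD(2)[OF assms(1), of \<beta>s]]]) simp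
  moreover have "(\<lambda>\<beta>s. g \<xi> * f \<xi> \<beta>s) \<in> Sym n" if "\<xi> \<in> U" for \<xi>
    using Sym_lincomb[OF V_secD(1)[OF assms(1) that] Sym_zero, of "g \<xi>" 0] by simp
  ultimately show ?thesis
    by (auto simp: V_sec_def)
qed

lemma represents_cong:
  assumes r: "represents n k \<sigma> U f" and U': "openin lines_top U'" "U' \<subseteq> U" and f': "f' \<in> V_sec n U'"
    and eq: "\<And>\<xi>. \<xi> \<in> U' \<Longrightarrow> f' \<xi> = f \<xi>"
  shows "represents n k \<sigma> U' f'"
  unfolding represents_def
proof (intro conjI ballI U' f')
  fix p assume p: "p \<in> U' \<times> lines"
  then have "stalk_class n (Suc k) (eval_sec n f) p = stalk_class n (Suc k) (eval_sec n f') p"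
    by (rule stalk_class_cong[OF openin_times_lines[OF U'(1)]]) (auto simp: eval_sec_def eq)
  then show "\<sigma> p = stalk_class n (Suc k) (eval_sec n f') p"
    using r p U'(2) by (auto simp: represents_def)
qed

lemma represents_restrict:
  assumes r: "represents n k \<sigma> U f" and "openin lines_top U'" "U' \<subseteq> U"
  shows "represents n k \<sigma> U' (restrict f U')"
  by (rule represents_cong[OF assms V_sec_restrict]) (use r assms in \<open>auto simp: represents_def\<close>)

lemma represents_jet_eval: "f \<in> V_sec n U \<Longrightarrow> openin lines_top U \<Longrightarrow> represents n k (jet_eval n k U f) U f"
  by (simp add: represents_def jet_eval_eq)

lemma represents_imp_jet_sec_local:
  assumes "represents n k \<sigma> U' f" "U' \<subseteq> U" "p \<in> U' \<times> lines"
  shows "\<exists>\<Omega> F. openin lines2_top \<Omega> \<and> p \<in> \<Omega> \<and> \<Omega> \<subseteq> U \<times> lines \<and>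
       pullback_sec n \<Omega> F \<and> (\<forall>r\<in>\<Omega>. \<sigma> r = stalk_class n (k + 1) F r)"
  using assms pullback_eval_sec[of f n U'] openin_times_lines[of U']
  by (intro exI[of _ "U' \<times> lines"] exI[of _ "eval_sec n f"]) (auto simp: represents_def)

lemma qmap_LSym:
  assumes "S \<in> Sym n" "\<xi> \<in> lines" "k \<le> n"
  shows "qmap (n - k) \<xi> S \<in> LSym \<xi> (n - k) k"
proof -
  obtain e h where fr: "frame e h" and \<xi>: "\<xi> = chart e h 0"
    using lines_chart[OF assms(2)] .
  have "(\<lambda>\<beta>s. S (replicate (n - k) (lam e h 0) @ \<beta>s)) \<in> Sym k"
    using assms by (auto intro!: Sym_contract[where a = "n - k"])
  then show ?thesis
    using qmap_eq_qframe[OF fr, of S "n - k" k 0] Sym_tensors[OF assms(1)] assms(3) qframe_LSym \<xi> by simp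
qed

lemma jet_iso_L_sec:
  assumes \<sigma>: "\<sigma> \<in> jet_sec n k U" and U: "openin lines_top U" and k: "k \<le> n"
  shows "jet_iso n k U \<sigma> \<in> L_sec (n - k) k U"
proof -
  have key: "jet_iso n k U \<sigma> \<xi> \<in> LSym \<xi> (n - k) k \<and> (\<exists>U' t. openin lines_top U' \<and> \<xi> \<in> U' \<and> U' \<subseteq> U \<and>
        (\<forall>\<eta>\<in>U'. t \<eta> \<in> tensors (n - k + k)) \<and> (\<forall>\<beta>s. hol (\<lambda>\<eta>. t \<eta> \<beta>s) U') \<and>
        (\<forall>\<eta>\<in>U'. jet_iso n k U \<sigma> \<eta> = qmap (n - k) \<eta> (t \<eta>)))" if \<xi>: "\<xi> \<in> U" for \<xi>
  proof -
    obtain U' f where r: "represents n k \<sigma> U' f" "\<xi> \<in> U'" "U' \<subseteq> U"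
      using jet_sec_represents[OF \<sigma> U \<xi> k] .
    have eq: "jet_iso n k U \<sigma> \<eta> = qmap (n - k) \<eta> (f \<eta>)" if "\<eta> \<in> U'" for \<eta>
      using jet_iso_eqI[OF r(1) that r(3) k] .
    have f: "f \<in> V_sec n U'" "openin lines_top U'"
      using r(1) by (simp_all add: represents_def)
    have "jet_iso n k U \<sigma> \<xi> \<in> LSym \<xi> (n - k) k"
      unfolding eq[OF r(2)] using qmap_LSym[OF V_secD(1)[OF f(1) r(2)] _ k] U \<xi> openin_lines_sub by blast
    moreover have "f \<eta> \<in> tensors (n - k + k)" if "\<eta> \<in> U'" for \<eta>
      using Sym_tensors[OF V_secD(1)[OF f(1) that]] k by simp
    ultimately show ?thesis
      using r f eq V_secD(2)[OF f(1)] by (intro conjI exI[of _ U'] exI[of _ f]) simp_all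
  qed
  then show ?thesis
    unfolding L_sec_def using jet_iso_extensional by blast
qed

text \<open>
  If lifts of two jets have the same image under \<open>theta\<close>, the lifts have the same jets.
\<close>

lemma jet_iso_inj:
  assumes \<sigma>: "\<sigma> \<in> jet_sec n k U" "\<tau> \<in> jet_sec n k U" and U: "openin lines_top U" and k: "k \<le> n"
    and eq: "jet_iso n k U \<sigma> = jet_iso n k U \<tau>"
  shows "\<sigma> = \<tau>"
proof (rule extensionalityI)
  show "\<sigma> \<in> extensional (U \<times> lines)" "\<tau> \<in> extensional (U \<times> lines)"
    using \<sigma> by (auto simp: jet_sec_def)
  fix p assume p: "p \<in> U \<times> lines"
  then have \<xi>: "fst p \<in> U"
    by auto
  obtain U1 f1 where 1: "represents n k \<sigma> U1 f1" "fst p \<in> U1" "U1 \<subseteq> U"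
    using jet_sec_represents[OF \<sigma>(1) U \<xi> k] .
  obtain U2 f2 where 2: "represents n k \<tau> U2 f2" "fst p \<in> U2" "U2 \<subseteq> U"
    using jet_sec_represents[OF \<sigma>(2) U \<xi> k] .
  define U' where "U' = U1 \<inter> U2"
  have U': "openin lines_top U'" and U'U: "U' \<subseteq> U"
    using 1 2 by (auto simp: U'_def represents_def)
  have r: "represents n k \<sigma> U' (restrict f1 U')" "represents n k \<tau> U' (restrict f2 U')"
    using represents_restrict[OF 1(1) U'] represents_restrict[OF 2(1) U'] by (auto simp: U'_def)
  have pU: "p \<in> U' \<times> lines"
    using p 1 2 by (cases p) (auto simp: U'_def)
  have "stalk_class n (Suc k) (eval_sec n (restrict f1 U')) p = stalk_class n (Suc k) (eval_sec n (restrict f2 U')) p"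
  proof (rule jet_eq_if_qmap_eq[OF _ _ U' k _ pU])
    fix \<xi> assume "\<xi> \<in> U'"
    then show "qmap (n - k) \<xi> (restrict f1 U' \<xi>) = qmap (n - k) \<xi> (restrict f2 U' \<xi>)"
      using jet_iso_eqI[OF r(1) _ U'U k] jet_iso_eqI[OF r(2) _ U'U k] eq by metis
  qed (use representsD(2) r in blast)+
  then show "\<sigma> p = \<tau> p"
    using representsD(3)[OF r(1) pU] representsD(3)[OF r(2) pU] by simp
qed

text \<open>
  Lift \<open>s\<close> locally along \<open>theta\<close> and evaluate. The local jets glue, because lifts that agree under
  \<open>theta\<close> have the same jets.
\<close>

lemma jet_iso_surj:
  assumes s: "s \<in> L_sec (n - k) k U" and U: "openin lines_top U" and k: "k \<le> n"
  obtains \<sigma> where "\<sigma> \<in> jet_sec n k U" "jet_iso n k U \<sigma> = s"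
proof -
  have "\<exists>U' f. openin lines_top U' \<and> \<xi> \<in> U' \<and> U' \<subseteq> U \<and> f \<in> V_sec n U' \<and>
      (\<forall>\<eta>\<in>U'. qmap (n - k) \<eta> (f \<eta>) = s \<eta>)" if "\<xi> \<in> U" for \<xi>
    using L_sec_locally_theta[OF s U that k] by metis
  then obtain N g where Ng: "\<And>\<xi>. \<xi> \<in> U \<Longrightarrow> openin lines_top (N \<xi>)" "\<And>\<xi>. \<xi> \<in> U \<Longrightarrow> \<xi> \<in> N \<xi>"
    "\<And>\<xi>. \<xi> \<in> U \<Longrightarrow> N \<xi> \<subseteq> U" "\<And>\<xi>. \<xi> \<in> U \<Longrightarrow> g \<xi> \<in> V_sec n (N \<xi>)"
    "\<And>\<xi> \<eta>. \<xi> \<in> U \<Longrightarrow> \<eta> \<in> N \<xi> \<Longrightarrow> qmap (n - k) \<eta> (g \<xi> \<eta>) = s \<eta>"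
    by metis
  (* over each point the lift chosen for this very point is used; r shows that any other lift
     defined there gives the same jet *)
  define \<sigma> where "\<sigma> = (\<lambda>p\<in>U \<times> lines. stalk_class n (Suc k) (eval_sec n (g (fst p))) p)"
  have r: "represents n k \<sigma> (N \<xi>) (g \<xi>)" if \<xi>: "\<xi> \<in> U" for \<xi>
    unfolding represents_def
  proof (intro conjI ballI Ng(1,4) \<xi>)
    fix p assume p: "p \<in> N \<xi> \<times> lines"
    let ?\<eta> = "fst p"
    have \<eta>: "?\<eta> \<in> U" "?\<eta> \<in> N \<xi>"
      using p Ng(3)[OF \<xi>] by auto
    define U' where "U' = N \<xi> \<inter> N ?\<eta>"
    have U': "openin lines_top U'" "U' \<subseteq> N \<xi>" "U' \<subseteq> N ?\<eta>"
      using Ng(1) \<xi> \<eta> by (auto simp: U'_def)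
    have pU: "p \<in> U' \<times> lines"
      using p Ng(2)[OF \<eta>(1)] by (cases p) (auto simp: U'_def)
    have "stalk_class n (Suc k) (eval_sec n (restrict (g ?\<eta>) U')) p =
        stalk_class n (Suc k) (eval_sec n (restrict (g \<xi>) U')) p"
    proof (rule jet_eq_if_qmap_eq[OF V_sec_restrict V_sec_restrict U'(1) k _ pU])
      show "g ?\<eta> \<in> V_sec n (N ?\<eta>)" "g \<xi> \<in> V_sec n (N \<xi>)"
        using Ng(4) \<xi> \<eta> by auto
      fix \<zeta> assume "\<zeta> \<in> U'"
      then show "qmap (n - k) \<zeta> (restrict (g ?\<eta>) U' \<zeta>) = qmap (n - k) \<zeta> (restrict (g \<xi>) U' \<zeta>)"
        using Ng(5)[OF \<xi>, of \<zeta>] Ng(5)[OF \<eta>(1), of \<zeta>] U'(2,3) by (simp add: subset_iff)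
    qed (use U' in auto)
    moreover have "stalk_class n (Suc k) (eval_sec n (restrict f U')) p = stalk_class n (Suc k) (eval_sec n f) p" for f
      by (rule stalk_class_cong[OF openin_times_lines[OF U'(1)] pU]) (auto simp: eval_sec_def)
    ultimately show "\<sigma> p = stalk_class n (Suc k) (eval_sec n (g \<xi>)) p"
      using p \<eta>(1) by (auto simp: \<sigma>_def)
  qed
  have "\<sigma> \<in> jet_sec n k U"
    unfolding jet_sec_def
  proof (intro CollectI conjI ballI)
    show "\<sigma> \<in> extensional (U \<times> lines)"
      by (simp add: \<sigma>_def)
    fix p assume "p \<in> U \<times> lines"
    then show "\<exists>\<Omega> F. openin lines2_top \<Omega> \<and> p \<in> \<Omega> \<and> \<Omega> \<subseteq> U \<times> lines \<and>
       pullback_sec n \<Omega> F \<and> (\<forall>r\<in>\<Omega>. \<sigma> r = stalk_class n (k + 1) F r)"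
      using Ng(2,3)[of "fst p"] by (intro represents_imp_jet_sec_local[OF r[of "fst p"]]) auto
  qed
  moreover have "jet_iso n k U \<sigma> = s"
  proof (rule extensionalityI[OF jet_iso_extensional])
    show "s \<in> extensional U"
      using s by (simp add: L_sec_def)
    show "jet_iso n k U \<sigma> \<xi> = s \<xi>" if "\<xi> \<in> U" for \<xi>
      using jet_iso_eqI[OF r[OF that] Ng(2)[OF that] Ng(3)[OF that] k] Ng(5)[OF that Ng(2)[OF that]] by simp
  qed
  ultimately show thesis
    using that by blast
qed

lemma bij_betw_jet_iso:
  assumes "openin lines_top U" "k \<le> n"
  shows "bij_betw (jet_iso n k U) (jet_sec n k U) (L_sec (n - k) k U)"
  unfolding bij_betw_def
proof
  show "inj_on (jet_iso n k U) (jet_sec n k U)"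
    using jet_iso_inj assms by (intro inj_onI) blast
  show "jet_iso n k U ` jet_sec n k U = L_sec (n - k) k U"
    using jet_iso_L_sec[OF _ assms] jet_iso_surj[OF _ assms] by blast
qed

lemma jet_iso_restrict:
  assumes \<sigma>: "\<sigma> \<in> jet_sec n k U" and U: "openin lines_top U" "openin lines_top U'" "U' \<subseteq> U" and k: "k \<le> n"
  shows "jet_iso n k U' (restrict \<sigma> (U' \<times> lines)) = restrict (jet_iso n k U \<sigma>) U'"
proof (rule extensionalityI[OF jet_iso_extensional])
  fix \<xi> assume \<xi>: "\<xi> \<in> U'"
  then obtain V f where r: "represents n k \<sigma> V f" "\<xi> \<in> V" "V \<subseteq> U"
    using jet_sec_represents[OF \<sigma> U(1) _ k] U(3) by (metis subsetD)
  define V' where "V' = V \<inter> U'"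
  have V': "openin lines_top V'" "V' \<subseteq> V" "\<xi> \<in> V'" "V' \<subseteq> U'"
    using r U \<xi> by (auto simp: V'_def represents_def)
  have r': "represents n k \<sigma> V' (restrict f V')"
    by (rule represents_restrict[OF r(1) V'(1,2)])
  then have "represents n k (restrict \<sigma> (U' \<times> lines)) V' (restrict f V')"
    using V'(4) by (auto simp: represents_def)
  then show "jet_iso n k U' (restrict \<sigma> (U' \<times> lines)) \<xi> = restrict (jet_iso n k U \<sigma>) U' \<xi>"
    using jet_iso_eqI[OF _ V'(3,4) k] jet_iso_eqI[OF r(1,2,3) k] \<xi> V'(3) by simp
qed auto

lemma jet_iso_add:
  assumes \<sigma>: "\<sigma> \<in> jet_sec n k U" "\<tau> \<in> jet_sec n k U" and U: "openin lines_top U" and k: "k \<le> n"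
  shows "jet_iso n k U (jet_add n k U \<sigma> \<tau>) =
    (\<lambda>\<xi>\<in>U. \<lambda>\<alpha>s \<beta>s. jet_iso n k U \<sigma> \<xi> \<alpha>s \<beta>s + jet_iso n k U \<tau> \<xi> \<alpha>s \<beta>s)"
proof (rule extensionalityI[OF jet_iso_extensional])
  fix \<xi> assume \<xi>: "\<xi> \<in> U"
  obtain U1 f1 where 1: "represents n k \<sigma> U1 f1" "\<xi> \<in> U1" "U1 \<subseteq> U"
    using jet_sec_represents[OF \<sigma>(1) U \<xi> k] .
  obtain U2 f2 where 2: "represents n k \<tau> U2 f2" "\<xi> \<in> U2" "U2 \<subseteq> U"
    using jet_sec_represents[OF \<sigma>(2) U \<xi> k] .
  define U' where "U' = U1 \<inter> U2"
  have U': "openin lines_top U'" "\<xi> \<in> U'" "U' \<subseteq> U" "U' \<subseteq> U1" "U' \<subseteq> U2"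
    using 1 2 by (auto simp: U'_def represents_def)
  have r: "represents n k \<sigma> U' (restrict f1 U')" "represents n k \<tau> U' (restrict f2 U')"
    using represents_restrict[OF 1(1) U'(1,4)] represents_restrict[OF 2(1) U'(1,5)] .
  define h where "h = (\<lambda>\<xi>\<in>U'. \<lambda>\<beta>s. restrict f1 U' \<xi> \<beta>s + restrict f2 U' \<xi> \<beta>s)"
  have h: "h \<in> V_sec n U'"
    unfolding h_def by (intro V_sec_add representsD(2)[OF r(1)] representsD(2)[OF r(2)])
  have "represents n k (jet_add n k U \<sigma> \<tau>) U' h"
    unfolding represents_def
  proof (intro conjI ballI U'(1) h)
    fix p assume p: "p \<in> U' \<times> lines"
    have g: "germ_at n (eval_sec n (restrict f1 U')) p" "germ_at n (eval_sec n (restrict f2 U')) p"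
      using germ_eval_sec[OF _ U'(1) p] r by (auto simp: represents_def)
    have "stalk_class n (Suc k) (eval_sec n h) p = stalk_class n (Suc k)
        (\<lambda>r \<alpha>s \<beta>s. eval_sec n (restrict f1 U') r \<alpha>s \<beta>s + eval_sec n (restrict f2 U') r \<alpha>s \<beta>s) p"
      by (rule stalk_class_cong[OF openin_times_lines[OF U'(1)] p])
        (auto simp: eval_sec_def h_def qmap_def fun_eq_iff)
    moreover have "\<sigma> p = stalk_class n (Suc k) (eval_sec n (restrict f1 U')) p"
      "\<tau> p = stalk_class n (Suc k) (eval_sec n (restrict f2 U')) p"
      using representsD(3)[OF r(1) p] representsD(3)[OF r(2) p] .
    moreover have "p \<in> U \<times> lines"
      using p U'(3) by auto
    ultimately show "jet_add n k U \<sigma> \<tau> p = stalk_class n (Suc k) (eval_sec n h) p"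
      using stalk_class_add[OF g, of "Suc k"] by (simp add: jet_add_def)
  qed
  from jet_iso_eqI[OF this U'(2,3) k]
  show "jet_iso n k U (jet_add n k U \<sigma> \<tau>) \<xi> =
    (\<lambda>\<xi>\<in>U. \<lambda>\<alpha>s \<beta>s. jet_iso n k U \<sigma> \<xi> \<alpha>s \<beta>s + jet_iso n k U \<tau> \<xi> \<alpha>s \<beta>s) \<xi>"
    using jet_iso_eqI[OF 1 k] jet_iso_eqI[OF 2 k] \<xi> U'(2) by (auto simp: h_def qmap_def fun_eq_iff)
qed auto

lemma jet_iso_mult:
  assumes \<sigma>: "\<sigma> \<in> jet_sec n k U" and U: "openin lines_top U" and g: "hol g U" and k: "k \<le> n"
  shows "jet_iso n k U (jet_mult n k U g \<sigma>) = (\<lambda>\<xi>\<in>U. \<lambda>\<alpha>s \<beta>s. g \<xi> * jet_iso n k U \<sigma> \<xi> \<alpha>s \<beta>s)"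
proof (rule extensionalityI[OF jet_iso_extensional])
  fix \<xi> assume \<xi>: "\<xi> \<in> U"
  obtain U' f where r: "represents n k \<sigma> U' f" and U': "\<xi> \<in> U'" "U' \<subseteq> U"
    using jet_sec_represents[OF \<sigma> U \<xi> k] .
  have f: "f \<in> V_sec n U'" "openin lines_top U'"
    using r by (simp_all add: represents_def)
  define h where "h = (\<lambda>\<xi>\<in>U'. \<lambda>\<beta>s. g \<xi> * f \<xi> \<beta>s)"
  have h: "h \<in> V_sec n U'"
    unfolding h_def using f hol_subset[OF g U'(2)] by (intro V_sec_mult)
  have "represents n k (jet_mult n k U g \<sigma>) U' h"
    unfolding represents_def
  proof (intro conjI ballI f(2) h)
    fix p assume p: "p \<in> U' \<times> lines"
    have gm: "germ_at n (eval_sec n f) p"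
      using germ_eval_sec[OF f p] .
    have "hol2 (\<lambda>r. g (fst r)) (U' \<times> lines)"
      by (rule hol2_fst[OF g openin_times_lines[OF f(2)]]) (use U'(2) in auto)
    then have g2: "hol2_at (\<lambda>r. g (fst r)) p"
      unfolding hol2_at_def using openin_times_lines[OF f(2)] p by blast
    have "stalk_class n (Suc k) (eval_sec n h) p =
        stalk_class n (Suc k) (\<lambda>r \<alpha>s \<beta>s. g (fst r) * eval_sec n f r \<alpha>s \<beta>s) p"
      by (rule stalk_class_cong[OF openin_times_lines[OF f(2)] p])
        (auto simp: eval_sec_def h_def qmap_def fun_eq_iff)
    moreover have "\<sigma> p = stalk_class n (Suc k) (eval_sec n f) p"
      using representsD(3)[OF r p] .
    moreover have "p \<in> U \<times> lines"
      using p U'(2) by auto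
    ultimately show "jet_mult n k U g \<sigma> p = stalk_class n (Suc k) (eval_sec n h) p"
      using stalk_class_mult[OF gm g2, of "Suc k"] by (simp add: jet_mult_def)
  qed
  from jet_iso_eqI[OF this U' k]
  show "jet_iso n k U (jet_mult n k U g \<sigma>) \<xi> = (\<lambda>\<xi>\<in>U. \<lambda>\<alpha>s \<beta>s. g \<xi> * jet_iso n k U \<sigma> \<xi> \<alpha>s \<beta>s) \<xi>"
    using jet_iso_eqI[OF r U' k] \<xi> U'(1) by (auto simp: h_def qmap_def fun_eq_iff)
qed auto

lemma jet_iso_jet_eval:
  assumes "f \<in> V_sec n U" "openin lines_top U" "k \<le> n"
  shows "jet_iso n k U (jet_eval n k U f) = theta n k U f"
  by (rule extensionalityI[OF jet_iso_extensional])
    (auto simp: theta_def jet_iso_eqI[OF represents_jet_eval[OF assms(1,2)] _ subset_refl assms(3)])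

text \<open>
  A lift of a \<open>k\<close>-jet is also a lift of the underlying \<open>(k - 1)\<close>-jet. Thus the projection corresponds
  to passing from \<open>n - k\<close> quotiented factors to \<open>n - k + 1\<close>, that is, to quotienting one more factor.
\<close>

lemma jet_iso_proj:
  assumes \<sigma>: "\<sigma> \<in> jet_sec n k U" and U: "openin lines_top U" and k: "1 \<le> k" "k \<le> n"
  shows "jet_iso n (k - 1) U (jet_proj n k U \<sigma>) = Id_tensor_varpi (n - k) U (jet_iso n k U \<sigma>)"
proof (rule extensionalityI[OF jet_iso_extensional])
  show "Id_tensor_varpi (n - k) U (jet_iso n k U \<sigma>) \<in> extensional U"
    by (simp add: Id_tensor_varpi_def)
  fix \<xi> assume \<xi>: "\<xi> \<in> U"
  obtain U' f where r: "represents n k \<sigma> U' f" and U': "\<xi> \<in> U'" "U' \<subseteq> U"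
    using jet_sec_represents[OF \<sigma> U \<xi> k(2)] .
  have f: "f \<in> V_sec n U'" "openin lines_top U'"
    using r by (simp_all add: represents_def)
  have "represents n (k - 1) (jet_proj n k U \<sigma>) U' f"
    unfolding represents_def
  proof (intro conjI ballI f)
    fix p assume p: "p \<in> U' \<times> lines"
    then have "p \<in> U \<times> lines" "\<sigma> p = stalk_class n (Suc k) (eval_sec n f) p"
      using U' representsD(3)[OF r p] by auto
    then show "jet_proj n k U \<sigma> p = stalk_class n (Suc (k - 1)) (eval_sec n f) p"
      using stalk_class_proj[OF germ_eval_sec[OF f p], of k] k by (simp add: jet_proj_def)
  qed
  then have "jet_iso n (k - 1) U (jet_proj n k U \<sigma>) \<xi> = qmap (n - (k - 1)) \<xi> (f \<xi>)"
    using jet_iso_eqI[OF _ U', of n "k - 1" _ f] k by simp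
  also have "\<dots> = Id_tensor (n - k) (varpi \<xi>) (qmap (n - k) \<xi> (f \<xi>))"
  proof (intro ext)
    fix \<alpha>s :: "('v set \<Rightarrow> complex) list" and \<beta>s :: "('v \<Rightarrow> complex) list"
    let ?m = "\<lambda>as. map (\<lambda>\<alpha>. \<alpha> \<circ> quot \<xi>) as"
    have len: "length (drop (n - k) \<alpha>s) = 1 \<longleftrightarrow> length \<alpha>s = n - (k - 1)"
      using k by auto
    have "?m (take (n - k) \<alpha>s) @ ?m (drop (n - k) \<alpha>s) = ?m \<alpha>s"
      by (simp only: map_append[symmetric] append_take_drop_id)
    then show "qmap (n - (k - 1)) \<xi> (f \<xi>) \<alpha>s \<beta>s =
        Id_tensor (n - k) (varpi \<xi>) (qmap (n - k) \<xi> (f \<xi>)) \<alpha>s \<beta>s"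
      unfolding Id_tensor_def varpi_def qmap_def len using k
      by (auto simp flip: append_assoc)
  qed
  also have "\<dots> = Id_tensor_varpi (n - k) U (jet_iso n k U \<sigma>) \<xi>"
    using jet_iso_eqI[OF r U' k(2)] \<xi> by (simp add: Id_tensor_varpi_def)
  finally show "jet_iso n (k - 1) U (jet_proj n k U \<sigma>) \<xi> = Id_tensor_varpi (n - k) U (jet_iso n k U \<sigma>) \<xi>" .
qed

section \<open>Linear automorphisms\<close>

definition aut :: "('v \<Rightarrow> 'v) \<Rightarrow> bool" where
  "aut g \<longleftrightarrow> bij g \<and> (\<forall>u v. g (u + v) = g u + g v) \<and> (\<forall>c v. g (c *\<^sub>V v) = c *\<^sub>V g v)"

lemma autD:
  assumes "aut g"
  shows "bij g" "g (u + v) = g u + g v" "g (c *\<^sub>V v) = c *\<^sub>V g v"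
  using assms by (simp_all add: aut_def)

lemma aut_zero: "aut g \<Longrightarrow> g 0 = 0"
  using autD(3)[of g 0 0] by simp

lemma aut_inv:
  assumes "aut g"
  shows "aut (inv g)"
proof -
  note g = autD[OF assms]
  have inj: "inj g" and s: "g (inv g v) = v" for v
    using g(1) by (simp_all add: bij_is_inj bij_is_surj surj_f_inv_f)
  have "inv g (u + v) = inv g u + inv g v" for u v
    by (rule injD[OF inj]) (simp add: s g(2))
  moreover have "inv g (c *\<^sub>V v) = c *\<^sub>V inv g v" for c v
    by (rule injD[OF inj]) (simp add: s g(3))
  ultimately show ?thesis
    using g(1) by (simp add: aut_def bij_imp_bij_inv)
qed

text \<open>
  The determinant condition makes the matrix of \<open>g\<close> in a frame invertible.
\<close>

lemma SL_aut:
  assumes "g \<in> SL"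
  shows "aut g"
proof -
  obtain e f where fr: "frame e f"
    using frame_exists by blast
  have lin: "g (u + v) = g u + g v" "g (c *\<^sub>V v) = c *\<^sub>V g v" for u v c
    using assms by (auto simp: SL_def Vector_Spaces.linear_iff)
  define a b c d where "a = ecf e f (g e)" and "b = fcf e f (g e)"
    and "c = ecf e f (g f)" and "d = fcf e f (g f)"
  have ge: "g e = a *\<^sub>V e + b *\<^sub>V f" and gf: "g f = c *\<^sub>V e + d *\<^sub>V f"
    using frame_coords[OF fr] by (simp_all add: a_def b_def c_def d_def)
  have det: "a * d - b * c = 1"
    using assms fr ge gf unfolding SL_def by blast
  have g_comb: "g (x *\<^sub>V e + y *\<^sub>V f) = (x * a + y * c) *\<^sub>V e + (x * b + y * d) *\<^sub>V f" for x y
    by (simp add: lin ge gf algebra_simps)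
  have "inj g"
  proof (rule injI)
    fix u v assume "g u = g v"
    define x y where "x = ecf e f u - ecf e f v" and "y = fcf e f u - fcf e f v"
    have uv: "u = v + (x *\<^sub>V e + y *\<^sub>V f)"
      using frame_coords[OF fr, of u] frame_coords[OF fr, of v] by (simp add: x_def y_def algebra_simps)
    then have "g (x *\<^sub>V e + y *\<^sub>V f) = 0"
      using \<open>g u = g v\<close> lin(1)[of v "x *\<^sub>V e + y *\<^sub>V f"] by simp
    then have 0: "x * a + y * c = 0" "x * b + y * d = 0"
      using fr unfolding g_comb frame_iff by blast+
    have "x = d * (x * a + y * c) - c * (x * b + y * d)" "y = a * (x * b + y * d) - b * (x * a + y * c)"
      using det by algebra+
    then have "x = 0" "y = 0"
      unfolding 0 by simp_all
    then show "u = v"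
      using uv by simp
  qed
  moreover have "surj g"
  proof (rule surjI)
    fix v
    define p q where "p = ecf e f v" and "q = fcf e f v"
    have "(d * p - c * q) * a + (a * q - b * p) * c = p" "(d * p - c * q) * b + (a * q - b * p) * d = q"
      using det by algebra+
    then show "g ((d * ecf e f v - c * fcf e f v) *\<^sub>V e + (a * fcf e f v - b * ecf e f v) *\<^sub>V f) = v"
      unfolding g_comb p_def[symmetric] q_def[symmetric]
      using frame_coords[OF fr, of v] by (simp add: p_def q_def)
  qed
  ultimately show ?thesis
    by (simp add: aut_def lin bij_def)
qed

context
  fixes g
  assumes aut: "aut g"
begin

lemma aut_inv_simps: "inv g (g v) = v" "g (inv g v) = v"
  using autD(1)[OF aut] by (simp_all add: bij_is_inj bij_is_surj surj_f_inv_f)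

lemma aut_image_vimage: "g ` (g -` X) = X" "g -` (g ` X) = X"
  using autD(1)[OF aut] by (simp_all add: bij_is_inj bij_is_surj inj_vimage_image_eq surj_image_vimage_eq)

lemma aut_vimage_eq: "g -` X = inv g ` X"
  using autD(1)[OF aut] by (rule bij_vimage_eq_inv_image)

lemma aut_frame:
  assumes "frame e f"
  shows "frame (g e) (g f)"
  unfolding frame_iff
proof (intro allI impI)
  fix x y assume "x *\<^sub>V g e + y *\<^sub>V g f = 0"
  then have "g (x *\<^sub>V e + y *\<^sub>V f) = g 0"
    by (simp add: autD[OF aut] aut_zero[OF aut])
  then have "x *\<^sub>V e + y *\<^sub>V f = 0"
    using aut_inv_simps by metis
  then show "x = 0 \<and> y = 0"
    using assms unfolding frame_iff by blast
qed

lemma aut_chart: "g ` chart e f z = chart (g e) (g f) z"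
  by (simp add: chart_def span_singleton image_image autD[OF aut])

lemma aut_forms_iff: "\<beta> \<circ> g \<in> forms \<longleftrightarrow> \<beta> \<in> forms"
proof
  assume *: "\<beta> \<circ> g \<in> forms"
  have "\<beta> (u + v) = \<beta> u + \<beta> v" for u v
    using forms_add[OF *, of "inv g u" "inv g v"] by (simp add: autD(2)[OF aut] aut_inv_simps)
  moreover have "\<beta> (c *\<^sub>V v) = c * \<beta> v" for c v
    using forms_scale[OF *, of c "inv g v"] by (simp add: autD(3)[OF aut] aut_inv_simps)
  ultimately show "\<beta> \<in> forms"
    by (simp add: forms_iff)
qed (simp add: forms_iff autD[OF aut])

lemma aut_lines: "g ` X \<in> lines \<longleftrightarrow> X \<in> lines"
proof -
  have *: "h ` X \<in> lines" if X: "X \<in> lines" and h: "aut h" for h X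
  proof -
    obtain v where v: "X = span {v}" "v \<noteq> 0"
      using X by (auto simp: lines_def)
    have "h ` X = span {h v}"
      by (simp add: v span_singleton image_image autD[OF h])
    moreover have "h v \<noteq> 0"
      using v autD(1)[OF h] aut_zero[OF h] by (metis bij_is_inj injD)
    ultimately show ?thesis
      by (auto simp: lines_def)
  qed
  have "X = inv g ` (g ` X)"
    by (simp add: image_image aut_inv_simps)
  then show ?thesis
    using * aut aut_inv[OF aut] by metis
qed

end

lemma aut_vimage_chart:
  assumes "aut g"
  shows "g -` chart e f z = chart (inv g e) (inv g f) z"
  by (simp add: aut_vimage_eq[OF assms] aut_chart[OF aut_inv[OF assms]])

lemma image_aut_eq_vimage:
  assumes "aut g"
  shows "(`) g ` U = {\<xi>. g -` \<xi> \<in> U}"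
proof (intro set_eqI iffI)
  fix \<xi> assume "\<xi> \<in> {\<xi>. g -` \<xi> \<in> U}"
  then show "\<xi> \<in> (`) g ` U"
    using aut_image_vimage(1)[OF assms, of \<xi>] by (metis imageI mem_Collect_eq)
qed (auto simp: aut_image_vimage(2)[OF assms])

lemma aut_openin:
  assumes g: "aut g" and U: "openin lines_top U"
  shows "openin lines_top ((`) g ` U)"
  unfolding openin_lines_top
proof (intro conjI allI impI)
  show "(`) g ` U \<subseteq> lines"
    using openin_lines_sub[OF U] aut_lines[OF g] by blast
  fix e f assume "frame e f"
  then have "open {z. chart (inv g e) (inv g f) z \<in> U}"
    using open_chart_preimage[OF U] aut_frame[OF aut_inv[OF g]] by blast
  then show "open {z. chart e f z \<in> (`) g ` U}"
    by (simp add: image_aut_eq_vimage[OF g] aut_vimage_chart[OF g])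
qed

lemma aut_hol:
  assumes g: "aut g" and u: "hol u U"
  shows "hol (\<lambda>\<xi>. u (g -` \<xi>)) ((`) g ` U)"
  unfolding hol_def
proof (intro allI impI)
  fix e f assume "frame e f"
  then have "(\<lambda>z. u (chart (inv g e) (inv g f) z)) holomorphic_on {z. chart (inv g e) (inv g f) z \<in> U}"
    using u aut_frame[OF aut_inv[OF g]] by (simp add: hol_def)
  then show "(\<lambda>z. u (g -` chart e f z)) holomorphic_on {z. chart e f z \<in> (`) g ` U}"
    by (simp add: image_aut_eq_vimage[OF g] aut_vimage_chart[OF g])
qed

definition pull2 :: "('v \<Rightarrow> 'v) \<Rightarrow> 'v set \<times> 'v set \<Rightarrow> 'v set \<times> 'v set" where
  "pull2 g p = (g -` fst p, g -` snd p)"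

lemma aut_openin2:
  assumes g: "aut g" and \<Omega>: "openin lines2_top \<Omega>"
  shows "openin lines2_top (pull2 g -` \<Omega>)"
proof -
  have "continuous_map lines_top lines_top (\<lambda>\<xi>. g -` \<xi>)"
    unfolding continuous_map_def topspace_lines_top
  proof (intro conjI allI impI funcsetI)
    show "g -` \<xi> \<in> lines" if "\<xi> \<in> lines" for \<xi>
      using that aut_lines[OF g, of "g -` \<xi>"] aut_image_vimage[OF g] by simp
    fix U assume U: "openin lines_top U"
    have "(`) g ` U \<subseteq> lines"
      using openin_lines_sub[OF aut_openin[OF g U]] .
    then have "{\<xi> \<in> lines. g -` \<xi> \<in> U} = (`) g ` U"
      by (auto simp: image_aut_eq_vimage[OF g])
    then show "openin lines_top {\<xi> \<in> lines. g -` \<xi> \<in> U}"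
      using aut_openin[OF g U] by simp
  qed
  then have "continuous_map lines2_top lines_top (\<lambda>p. g -` fst p)"
    "continuous_map lines2_top lines_top (\<lambda>p. g -` snd p)"
    unfolding lines2_top_def
    using continuous_map_compose[OF continuous_map_fst] continuous_map_compose[OF continuous_map_snd]
    by (auto simp: o_def)
  then have "continuous_map lines2_top lines2_top (pull2 g)"
    unfolding pull2_def[abs_def] by (subst (2) lines2_top_def) (rule continuous_map_pairedI)
  from openin_continuous_map_preimage[OF this \<Omega>]
  have "openin lines2_top {p \<in> lines \<times> lines. pull2 g p \<in> \<Omega>}"
    by (simp add: topspace_lines2)
  moreover have "pull2 g -` \<Omega> \<subseteq> lines \<times> lines"
  proof
    fix p assume "p \<in> pull2 g -` \<Omega>"
    then have "pull2 g p \<in> lines \<times> lines"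
      using openin_subset[OF \<Omega>] by (auto simp: topspace_lines2)
    then show "p \<in> lines \<times> lines"
      using aut_lines[OF g, of "g -` fst p"] aut_lines[OF g, of "g -` snd p"] aut_image_vimage[OF g]
      by (cases p) (auto simp: pull2_def)
  qed
  then have "{p \<in> lines \<times> lines. pull2 g p \<in> \<Omega>} = pull2 g -` \<Omega>"
    by auto
  ultimately show ?thesis
    by simp
qed

lemma aut_hol2:
  assumes g: "aut g" and u: "hol2 u \<Omega>"
  shows "hol2 (\<lambda>r. u (pull2 g r)) (pull2 g -` \<Omega>)"
  unfolding hol2_def
proof (intro allI impI)
  fix e f e' f' assume "frame e f" "frame e' f'"
  then have "frame (inv g e) (inv g f)" "frame (inv g e') (inv g f')"
    using aut_frame[OF aut_inv[OF g]] by auto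
  then show "holomorphic2_on (\<lambda>(z, w). u (pull2 g (chart e f z, chart e' f' w)))
      {(z, w). (chart e f z, chart e' f' w) \<in> pull2 g -` \<Omega>}"
    using u by (simp add: hol2_def pull2_def aut_vimage_chart[OF g])
qed

definition act_tensor :: "('v \<Rightarrow> 'v) \<Rightarrow> 'v tensor \<Rightarrow> 'v tensor" where
  "act_tensor g t \<beta>s = t (map (\<lambda>\<beta>. \<beta> \<circ> g) \<beta>s)"

lemma act_tensor_multilinear:
  assumes g: "aut g" and t: "multilinear m t"
  shows "multilinear m (act_tensor g t)"
  unfolding multilinear_def
proof (intro conjI allI ballI impI)
  fix xs ys c \<beta> \<gamma> assume "\<beta> \<in> forms" "\<gamma> \<in> forms"
  then have "\<beta> \<circ> g \<in> forms" "\<gamma> \<circ> g \<in> forms"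
    using aut_forms_iff[OF g] by auto
  moreover have "(\<lambda>v. \<beta> v + c * \<gamma> v) \<circ> g = (\<lambda>v. (\<beta> \<circ> g) v + c * (\<gamma> \<circ> g) v)"
    by auto
  ultimately show "act_tensor g t (xs @ (\<lambda>v. \<beta> v + c * \<gamma> v) # ys) =
      act_tensor g t (xs @ \<beta> # ys) + c * act_tensor g t (xs @ \<gamma> # ys)"
    unfolding act_tensor_def list.map map_append by (simp only: multilinear_add_mult[OF t])
next
  fix \<beta>s :: "('v \<Rightarrow> complex) list"
  assume "\<not> (length \<beta>s = m \<and> set \<beta>s \<subseteq> forms)"
  then have "\<not> (length (map (\<lambda>\<beta>. \<beta> \<circ> g) \<beta>s) = m \<and> set (map (\<lambda>\<beta>. \<beta> \<circ> g) \<beta>s) \<subseteq> forms)"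
    using aut_forms_iff[OF g] by auto
  then show "act_tensor g t \<beta>s = 0"
    unfolding act_tensor_def by (rule multilinear_outside[OF t])
qed

lemma act_tensor_tensors: "aut g \<Longrightarrow> t \<in> tensors m \<Longrightarrow> act_tensor g t \<in> tensors m"
  by (simp add: tensors_iff_multilinear act_tensor_multilinear)

lemma act_tensor_Sym:
  assumes "aut g" "t \<in> Sym m"
  shows "act_tensor g t \<in> Sym m"
proof -
  have "act_tensor g t \<beta>s = act_tensor g t \<beta>s'" if "mset \<beta>s = mset \<beta>s'" for \<beta>s \<beta>s'
    unfolding act_tensor_def by (rule Sym_perm[OF assms(2)]) (simp add: that)
  then show ?thesis
    unfolding Sym_iff using act_tensor_multilinear[OF assms(1) Sym_multilinear[OF assms(2)]] by blast
qed

text \<open>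
  The linear map \<open>g\<close> sends the coset of \<open>v\<close> modulo \<open>g\<^sup>-\<^sup>1 \<xi>\<close> to the coset of \<open>g v\<close> modulo \<open>\<xi>\<close>.
\<close>

lemma qmap_act_tensor:
  assumes g: "aut g"
  shows "qmap a \<xi> (act_tensor g t) = act g (qmap a (g -` \<xi>) t)"
proof -
  have "quot \<xi> (g v) = g ` quot (g -` \<xi>) v" for v
  proof -
    have "g ` quot (g -` \<xi>) v = (+) (g v) ` (g ` (g -` \<xi>))"
      unfolding quot_def image_image by (simp only: autD(2)[OF g])
    then show ?thesis
      unfolding aut_image_vimage(1)[OF g] quot_def by simp
  qed
  then have "\<alpha> \<circ> quot \<xi> \<circ> g = \<alpha> \<circ> (`) g \<circ> quot (g -` \<xi>)" for \<alpha> :: "'v set \<Rightarrow> complex"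
    by auto
  then show ?thesis
    unfolding qmap_def act_tensor_def act_def map_append map_map length_map
    by (intro ext) (simp add: comp_def)
qed

definition act_germ :: "('v \<Rightarrow> 'v) \<Rightarrow> ('v set \<times> 'v set \<Rightarrow> 'v mixed) \<Rightarrow> 'v set \<times> 'v set \<Rightarrow> 'v mixed" where
  "act_germ g F = (\<lambda>p. act g (F (pull2 g p)))"

lemma act_germ_inv:
  assumes "aut g"
  shows "act_germ g (act_germ (inv g) F) = F" "pull2 g (pull2 (inv g) p) = p"
proof -
  have comp: "g \<circ> inv g = id" "inv g \<circ> g = id"
    using aut_inv_simps[OF assms] by auto
  have "g -` (inv g -` X) = X" "inv g -` (g -` X) = X" for X
    using comp by (simp_all add: vimage_comp)
  then show "pull2 g (pull2 (inv g) p) = p"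
    by (simp add: pull2_def)
  have im: "g ` inv g ` X = X" "inv g ` g ` X = X" for X
    by (simp_all add: image_image aut_inv_simps[OF assms])
  have "act g (act (inv g) T) = T" for T
    unfolding act_def map_map by (intro ext) (simp add: comp_def im aut_inv_simps[OF assms])
  moreover have "pull2 (inv g) (pull2 g p) = p" for p
    using \<open>\<And>X. inv g -` (g -` X) = X\<close> by (simp add: pull2_def)
  ultimately show "act_germ g (act_germ (inv g) F) = F"
    by (simp add: act_germ_def)
qed

lemma act_germ_pullback:
  assumes g: "aut g" and F: "pullback_sec n \<Omega> F"
  shows "pullback_sec n (pull2 g -` \<Omega>) (act_germ g F)"
proof (rule pullback_secI)
  fix p assume "p \<in> pull2 g -` \<Omega>"
  then have "pull2 g p \<in> \<Omega>"
    by simp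
  then obtain \<Omega>1 t where 1: "openin lines2_top \<Omega>1" "pull2 g p \<in> \<Omega>1" "\<Omega>1 \<subseteq> \<Omega>" "\<And>r. r \<in> \<Omega>1 \<Longrightarrow> t r \<in> tensors n"
    "\<And>\<beta>s. hol2 (\<lambda>r. t r \<beta>s) \<Omega>1" "\<And>r. r \<in> \<Omega>1 \<Longrightarrow> F r = qmap n (snd r) (t r)"
    using pullback_secE[OF F] by metis
  have "hol2 (\<lambda>r. act_tensor g (t (pull2 g r)) \<beta>s) (pull2 g -` \<Omega>1)" for \<beta>s
    unfolding act_tensor_def by (rule aut_hol2[OF g 1(5)])
  moreover have "act_germ g F r = qmap n (snd r) (act_tensor g (t (pull2 g r)))" if "r \<in> pull2 g -` \<Omega>1" for r
    using that 1(6)[of "pull2 g r"] by (simp add: act_germ_def qmap_act_tensor[OF g]) (simp add: pull2_def)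
  ultimately show "\<exists>\<Omega>' t. openin lines2_top \<Omega>' \<and> p \<in> \<Omega>' \<and> \<Omega>' \<subseteq> pull2 g -` \<Omega> \<and>
    (\<forall>r\<in>\<Omega>'. t r \<in> tensors n) \<and> (\<forall>\<beta>s. hol2 (\<lambda>r. t r \<beta>s) \<Omega>') \<and>
    (\<forall>r\<in>\<Omega>'. act_germ g F r = qmap n (snd r) (t r))"
    using aut_openin2[OF g 1(1)] 1(2,3,4) act_tensor_tensors[OF g]
    by (intro exI[of _ "pull2 g -` \<Omega>1"] exI[of _ "\<lambda>r. act_tensor g (t (pull2 g r))"]) auto
qed

lemma act_germ_in_diag:
  assumes g: "aut g" and F: "in_diag_power n m F (pull2 g p)"
  shows "in_diag_power n m (act_germ g F) p"
proof -
  obtain \<Omega> u H where *: "openin lines2_top \<Omega>" "pull2 g p \<in> \<Omega>" "hol2 u \<Omega>"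
    "\<And>\<xi>. (\<xi>, \<xi>) \<in> \<Omega> \<Longrightarrow> u (\<xi>, \<xi>) = 0" "pullback_sec n \<Omega> H"
    "\<And>r. r \<in> \<Omega> \<Longrightarrow> F r = (\<lambda>\<alpha>s \<beta>s. u r ^ m * H r \<alpha>s \<beta>s)"
    using F unfolding in_diag_power_def by blast
  show ?thesis
    unfolding in_diag_power_def
  proof (intro exI[of _ "pull2 g -` \<Omega>"] exI[of _ "\<lambda>r. u (pull2 g r)"] exI[of _ "act_germ g H"] conjI
      aut_openin2[OF g *(1)] aut_hol2[OF g *(3)] act_germ_pullback[OF g *(5)])
    show "\<forall>\<xi>. (\<xi>, \<xi>) \<in> pull2 g -` \<Omega> \<longrightarrow> u (pull2 g (\<xi>, \<xi>)) = 0"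
      using *(4) by (simp add: pull2_def)
    show "\<forall>r\<in>pull2 g -` \<Omega>. act_germ g F r = (\<lambda>\<alpha>s \<beta>s. u (pull2 g r) ^ m * act_germ g H r \<alpha>s \<beta>s)"
      using *(6) by (simp add: act_germ_def act_def)
  qed (use *(2) in simp)
qed

text \<open>
  One inclusion is the invariance of the ideal of the diagonal; the other one is the same inclusion for
  the inverse of \<open>g\<close>.
\<close>

lemma act_germ_stalk_class:
  assumes g: "aut g"
  shows "act_germ g ` stalk_class n m F (pull2 g p) = stalk_class n m (act_germ g F) p"
proof -
  have sub: "act_germ h ` stalk_class n m F (pull2 h q) \<subseteq> stalk_class n m (act_germ h F) q"
    if h: "aut h" for h F q
  proof
    fix K assume "K \<in> act_germ h ` stalk_class n m F (pull2 h q)"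
    then obtain H where K: "K = act_germ h H" and H: "germ_at n H (pull2 h q)"
      "in_diag_power n m (\<lambda>r \<alpha>s \<beta>s. H r \<alpha>s \<beta>s - F r \<alpha>s \<beta>s) (pull2 h q)"
      by (auto simp: stalk_class_iff)
    have "act_germ h (\<lambda>r \<alpha>s \<beta>s. H r \<alpha>s \<beta>s - F r \<alpha>s \<beta>s) =
        (\<lambda>r \<alpha>s \<beta>s. act_germ h H r \<alpha>s \<beta>s - act_germ h F r \<alpha>s \<beta>s)"
      by (simp add: act_germ_def act_def)
    then show "K \<in> stalk_class n m (act_germ h F) q"
      using act_germ_in_diag[OF h H(1)] act_germ_in_diag[OF h H(2)] by (simp add: K stalk_class_iff)
  qed
  have ii: "inv (inv g) = g"
    using autD(1)[OF g] by (rule inv_inv_eq)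
  note inv = aut_inv[OF g]
  show ?thesis
  proof
    show "stalk_class n m (act_germ g F) p \<subseteq> act_germ g ` stalk_class n m F (pull2 g p)"
    proof
      fix H assume H: "H \<in> stalk_class n m (act_germ g F) p"
      have "pull2 (inv g) (pull2 g p) = p"
        using act_germ_inv(2)[OF inv, of p] by (simp add: ii)
      then have "act_germ (inv g) H \<in> stalk_class n m (act_germ (inv g) (act_germ g F)) (pull2 g p)"
        using sub[OF inv, of "act_germ g F" "pull2 g p"] H by auto
      then have "act_germ (inv g) H \<in> stalk_class n m F (pull2 g p)"
        using act_germ_inv(1)[OF inv, of F] by (simp add: ii)
      then show "H \<in> act_germ g ` stalk_class n m F (pull2 g p)"
        using act_germ_inv(1)[OF g, of H] by (metis imageI)
    qed
  qed (rule sub[OF g])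
qed

text \<open>
  If \<open>f\<close> is a lift of \<open>\<sigma>\<close>, its transform by \<open>g\<close> is a lift of the transform of \<open>\<sigma>\<close>.
\<close>

lemma jet_iso_act:
  assumes \<sigma>: "\<sigma> \<in> jet_sec n k U" and U: "openin lines_top U" and k: "k \<le> n" and g: "aut g"
  shows "jet_iso n k ((`) g ` U) (act_jet g U \<sigma>) = act_sec g U (jet_iso n k U \<sigma>)"
proof (rule extensionalityI[OF jet_iso_extensional])
  show "act_sec g U (jet_iso n k U \<sigma>) \<in> extensional ((`) g ` U)"
    by (simp add: act_sec_def)
  fix \<xi> assume \<xi>: "\<xi> \<in> (`) g ` U"
  then have \<xi>': "g -` \<xi> \<in> U"
    by (simp add: image_aut_eq_vimage[OF g])
  obtain U' f where r: "represents n k \<sigma> U' f" and U': "g -` \<xi> \<in> U'" "U' \<subseteq> U"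
    using jet_sec_represents[OF \<sigma> U \<xi>' k] .
  have f: "f \<in> V_sec n U'" "openin lines_top U'"
    using r by (simp_all add: represents_def)
  define V where "V = (`) g ` U'"
  have V: "openin lines_top V" "\<xi> \<in> V" "V \<subseteq> (`) g ` U" "\<And>\<eta>. \<eta> \<in> V \<longleftrightarrow> g -` \<eta> \<in> U'"
    using aut_openin[OF g f(2)] U' by (auto simp: V_def image_aut_eq_vimage[OF g])
  define h where "h = (\<lambda>\<eta>\<in>V. act_tensor g (f (g -` \<eta>)))"
  have "hol (\<lambda>\<eta>. h \<eta> \<beta>s) V" for \<beta>s
  proof -
    have "hol (\<lambda>\<eta>. f (g -` \<eta>) (map (\<lambda>\<beta>. \<beta> \<circ> g) \<beta>s)) V"
      unfolding V_def by (rule aut_hol[OF g V_secD(2)[OF f(1)]])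
    then show ?thesis
      by (rule hol_cong) (simp add: h_def act_tensor_def)
  qed
  moreover have "h \<eta> \<in> Sym n" if "\<eta> \<in> V" for \<eta>
    using that V(4) act_tensor_Sym[OF g V_secD(1)[OF f(1)]] by (simp add: h_def)
  ultimately have h: "h \<in> V_sec n V"
    by (auto simp: V_sec_def h_def)
  have "represents n k (act_jet g U \<sigma>) V h"
    unfolding represents_def
  proof (intro conjI ballI V(1) h)
    fix p assume p: "p \<in> V \<times> lines"
    have "snd p \<in> lines"
      using p by auto
    then have "g -` snd p \<in> lines"
      using aut_lines[OF g, of "g -` snd p"] aut_image_vimage[OF g] by simp
    then have pp: "pull2 g p \<in> U' \<times> lines"
      using p V(4)[of "fst p"] by (auto simp: pull2_def)
    have "p \<in> ((`) g ` U) \<times> lines"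
      using p V(3) by auto
    then have "act_jet g U \<sigma> p = act_germ g ` \<sigma> (pull2 g p)"
      by (cases p) (simp add: act_jet_def act_germ_def[abs_def] pull2_def case_prod_beta')
    also have "\<dots> = act_germ g ` stalk_class n (Suc k) (eval_sec n f) (pull2 g p)"
      using representsD(3)[OF r pp] by simp
    also have "\<dots> = stalk_class n (Suc k) (act_germ g (eval_sec n f)) p"
      by (rule act_germ_stalk_class[OF g])
    also have "\<dots> = stalk_class n (Suc k) (eval_sec n h) p"
      by (rule stalk_class_cong[OF openin_times_lines[OF V(1)] p])
        (auto simp: act_germ_def eval_sec_def pull2_def h_def qmap_act_tensor[OF g])
    finally show "act_jet g U \<sigma> p = stalk_class n (Suc k) (eval_sec n h) p" .
  qed
  then have "jet_iso n k ((`) g ` U) (act_jet g U \<sigma>) \<xi> = qmap (n - k) \<xi> (h \<xi>)"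
    by (rule jet_iso_eqI[OF _ V(2,3) k])
  also have "\<dots> = act g (jet_iso n k U \<sigma> (g -` \<xi>))"
    using jet_iso_eqI[OF r U' k] V(2) by (simp add: h_def qmap_act_tensor[OF g])
  also have "\<dots> = act_sec g U (jet_iso n k U \<sigma>) \<xi>"
    using \<xi> by (simp add: act_sec_def)
  finally show "jet_iso n k ((`) g ` U) (act_jet g U \<sigma>) \<xi> = act_sec g U (jet_iso n k U \<sigma>) \<xi>" .
qed

lemma equivariant_jet_iso_jet_iso:
  assumes "k \<le> n"
  shows "equivariant_jet_iso n k (jet_iso n k)"
  unfolding equivariant_jet_iso_def
  using bij_betw_jet_iso jet_iso_restrict jet_iso_add jet_iso_mult jet_iso_jet_eval jet_iso_act SL_aut assms
  by simp

end

section \<open>The projection of jets in terms of tensors\<close>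

theorem proposition3p2:
  fixes scale :: "complex \<Rightarrow> 'v::ab_group_add \<Rightarrow> 'v" and n k :: nat
  assumes "complex_plane scale" and "1 \<le> k" and "k \<le> n"
  shows "complex_plane.equivariant_jet_iso scale n k (complex_plane.jet_iso scale n k)
    \<and> complex_plane.equivariant_jet_iso scale n (k - 1) (complex_plane.jet_iso scale n (k - 1))
    \<and> (\<forall>U. openin (complex_plane.lines_top scale) U \<longrightarrow>
         (\<forall>\<sigma> \<in> complex_plane.jet_sec scale n k U.
            complex_plane.jet_iso scale n (k - 1) U (complex_plane.jet_proj scale n k U \<sigma>)
            = complex_plane.Id_tensor_varpi (n - k) U (complex_plane.jet_iso scale n k U \<sigma>)))"
proof -
  interpret complex_plane scale by fact
  have "k - 1 \<le> n"
    using assms by simp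
  then show ?thesis
    using equivariant_jet_iso_jet_iso jet_iso_proj assms by blast
qed

end
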